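(* Assume that $\mathcal P$ is differentiable in quadratic mean at $P_0$ in the sense defined in the context, and that $J=\mathbb E_0\,\tilde\ell(X)\tilde\ell(X)^{\mathrm t}$ is nonsingular. Let $(m_n)_{n\ge1}$ be a subsequence of indices tending to infinity such that: (1) there is a function $g$ with $\mathbb E_0\,g(X)=0$, $\mathbb E_0\,g(X)^2<\infty$ and $\mathbb E_0\,g(X)\tilde\ell(X)=0$ such that $$\log\frac{\mathrm dP_{m_n}^n}{\mathrm dP_0^n}=\frac1{\sqrt n}\sum_{i=1}^n g(X_i)-\tfrac12\mathbb E_0\,g(X_1)^2+o_{P_0^n}(1);$$ (2) the efficient scores $\tilde\ell_{m_n}$ exist and $\lim_{n\to\infty}\int\|\tilde\ell_{m_n}p_{m_n}^{1/2}-\tilde\ell\,p_0^{1/2}\|^2\,\mathrm d\mu=0$; (3) with $A_{m,n}(h)=\log\mathrm{pl}_{m,n}(\theta_0+h/\sqrt n)-\log\mathrm{pl}_{m,n}(\theta_0)$, for each $h$, $$A_{m_n,n}(h)=\frac{h^{\mathrm t}}{\sqrt n}\sum_{i=1}^n\tilde\ell_{m_n}(X_i)-\tfrac12h^{\mathrm t}J_{m_n}h+o_{P_{m_n}^n}(1).$$ If $h\mapsto A_{m_n,n}(h)$ is concave, then $$\sqrt n(\widehat\theta_{m_n,n}-\theta_0)=\frac1{\sqrt n}\sum_{i=1}^nJ_{m_n}^{-1}\tilde\ell_{m_n}(X_i)+o_{P_{m_n}^n}(1),$$ and $\widehat\theta_{m_n,n}$ is best regular in $\mathcal P$.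
   Context: Setting. $X_1,\dots,X_n$ are i.i.d. copies of $X$ with law $P_0:=P_{\theta_0,\eta_0}$ belonging to a semiparametric family $\mathcal P=\{P_{\theta,\eta}:\theta\in\Theta,\eta\in\mathcal H\}$, with $\Theta\subset\mathbb R^p$ and $\mathcal H$ an infinite-dimensional space. The laws are dominated by a $\sigma$-finite measure $\mu$, with densities $p_{\theta,\eta}$; $p_0=p_{\theta_0,\eta_0}$. For each $m\ge1$, $\mathcal H_m=\{\eta_\gamma:\gamma\in\Gamma_m\}$, $\Gamma_m\subset\mathbb R^{k_m}$, is a parametric family of functions, and $T_m:\mathcal H_m\to\Gamma_m$, $T_m\eta_\gamma=\gamma$, is an isomorphism. $\mathcal P_m=\{P_{\theta,T_m^{-1}\gamma}:\theta\in\Theta,\gamma\in\Gamma_m\}$ is a parametric model with $\mu$-densities $p_{\theta,T_m^{-1}\gamma}$. Fix vectors $\gamma_0=\gamma_{0,m}\in\Gamma_m$ (with $\eta_{\gamma_{0,m}}$ approaching $\eta_0$ as $m\to\infty$) and put $P_m=P_{\theta_0,T_m^{-1}\gamma_0}$ with density $p_m$. $\mathbb E_0,\mathbb E_m$ denote expectation under $P_0,P_m$; a superscript $n$ denotes the $n$-fold product measure. $\|\cdot\|$ is the Euclidean norm. Parametric scores. $\dot\ell_m=\partial_\theta\log p_{\theta,T_m^{-1}\gamma}$ and $\dot v_m=\partial_\gamma\log p_{\theta,T_m^{-1}\gamma}$ evaluated at $(\theta_0,\gamma_0)$. The Fisher information blocks are $i_{m,00}=\mathbb E_m\dot\ell_m\dot\ell_m^{\mathrm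 t}$, $i_{m,01}=\mathbb E_m\dot\ell_m\dot v_m^{\mathrm t}=i_{m,10}^{\mathrm t}$, $i_{m,11}=\mathbb E_m\dot v_m\dot v_m^{\mathrm t}$. The efficient score in $\mathcal P_m$ is $\tilde\ell_m=\dot\ell_m-i_{m,01}i_{m,11}^{-1}\dot v_m$ and its variance is $J_m=\mathbb E_m\tilde\ell_m\tilde\ell_m^{\mathrm t}=i_{m,00}-i_{m,01}i_{m,11}^{-1}i_{m,10}$. Profile likelihood. $L_{m,n}(\theta,\gamma)=\prod_{i=1}^np_{\theta,T_m^{-1}\gamma}(X_i)$ and $\mathrm{pl}_{m,n}(\theta)=\sup_{\gamma\in\Gamma_m}L_{m,n}(\theta,\gamma)$; for large enough $n$ the supremum is assumed attained, for each $\theta$, at some $\widehat\gamma(\theta)$. $\widehat\theta_{m,n}$ is the maximum likelihood estimator of $\theta$ in $\mathcal P_m$, i.e. the maximiser of $\theta\mapsto\mathrm{pl}_{m,n}(\theta)$. Differentiability in quadratic mean of $\mathcal P$ at $P_0$. $B$ is a linear space; for $b\in B$, $\eta_n(b)\to\eta_0$ as $n\to\infty$ and $\eta_n(0)=\eta_0$. For each $h=(\tau,b)\in\mathbb R^p\times B$, $P_{\theta_0+\tau/\sqrt n,\eta_n(b)}\in\mathcal P$ for all large $n$ and $$\lim_{n\to\infty}\int\{\sqrt n(p_{\theta_0+\tau/\sqrt n,\eta_n(b)}^{1/2}-p_0^{1/2})-\tfrac12Ah\,p_0^{1/2}\}^2\,\mathrm d\mu=0,$$ where $A:\mathbb R^p\times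 B\to L_2(P_0)$ is a bounded linear map. Write $Ah=\tau^{\mathrm t}\dot\ell+Db$, with $\dot\ell$ the score for $\theta$ and $D:B\to L_2(P_0)$ linear. The efficient score is $\tilde\ell=\dot\ell-\Pi\dot\ell$, with $\Pi$ the (componentwise) orthogonal projection in $L_2(P_0)$ onto the closure of $\{Db:b\in B\}$. Regularity. An estimator sequence $\widehat\theta_n$ is regular if there is a law $L$ such that for every $(\tau,b)\in\mathbb R^p\times B$, $\sqrt n(\widehat\theta_n-\theta_0-\tau/\sqrt n)$ converges weakly to $L$ under $P^n_{\theta_0+\tau/\sqrt n,\eta_n(b)}$. It is best regular in $\mathcal P$ if it is regular with $L=\mathrm N(0,J^{-1})$. *)

theory Defs
  imports "HOL-Probability.Probability"
begin

section \<open>Samples, stochastic order symbols and weak convergence\<close>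

text \<open>A sample of size \<open>n\<close> is a function on \<open>{..<n}\<close>, so that \<open>X i\<close> is \<open>x i\<close> and the
  \<open>n\<close>-fold product law lives on the product space indexed by \<open>{..<n}\<close>.\<close>

definition prod_law :: "nat \<Rightarrow> 'x measure \<Rightarrow> (nat \<Rightarrow> 'x) measure" where
  "prod_law n P = (\<Pi>\<^sub>M i\<in>{..<n}. P)"

text \<open>\<open>Y n = o(1)\<close> in \<open>P n\<close>-probability. Remainders take values in \<open>ereal\<close>, because log-likelihoods
  may be \<open>-\<infinity>\<close>; an infinite remainder counts as a large one. Outer measure is used because a
  supremum over an uncountable parameter set need not be measurable. On measurable sets it is the
  usual probability, whereas \<open>measure\<close> would be \<open>0\<close> on a nonmeasurable set.\<close>

definition oP1 :: "(nat \<Rightarrow> 's measure) \<Rightarrow> (nat \<Rightarrow> 's \<Rightarrow> ereal) \<Rightarrow> bool" where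
  "oP1 P Y \<longleftrightarrow> (\<forall>\<epsilon>>0. ((\<lambda>n. outer_measure_of (P n) {x \<in> space (P n). ereal \<epsilon> < \<bar>Y n x\<bar>}) \<longlongrightarrow> 0) sequentially)"

definition weakly_converges :: "(nat \<Rightarrow> ('a::topological_space) measure) \<Rightarrow> 'a measure \<Rightarrow> bool" where
  "weakly_converges Q L \<longleftrightarrow>
    (\<forall>f :: 'a \<Rightarrow> real. continuous_on UNIV f \<longrightarrow> bounded (range f) \<longrightarrow>
       (\<lambda>n. \<integral>x. f x \<partial>Q n) \<longlonglongrightarrow> (\<integral>x. f x \<partial>L))"

text \<open>The centred normal law with nonsingular covariance matrix \<open>S\<close>.\<close>

definition normal_law :: "real^'p^'p \<Rightarrow> (real^'p) measure" where
  "normal_law S = density lborel (\<lambda>x. ennreal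
     (exp (- (x \<bullet> (matrix_inv S *v x)) / 2) / sqrt ((2 * pi) ^ CARD('p) * det S)))"

definition elog :: "ennreal \<Rightarrow> ereal" where
  "elog a = (if a = 0 then -\<infinity> else if a = \<infinity> then \<infinity> else ereal (ln (enn2real a)))"

text \<open>Concavity of an extended-real-valued function that is given on \<open>S\<close> and is understood to be
  \<open>-\<infinity>\<close> outside \<open>S\<close>: its hypograph is convex.\<close>

definition ext_concave_on :: "'a::real_vector set \<Rightarrow> ('a \<Rightarrow> ereal) \<Rightarrow> bool" where
  "ext_concave_on S f \<longleftrightarrow> convex {(h, r :: real). h \<in> S \<and> ereal r \<le> f h}"

section \<open>Square integrable functions\<close>

text \<open>Members of \<open>L\<^sub>2(P)\<close> are represented by functions; linearity and equality are almost everywhere.\<close>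

definition L2 :: "'x measure \<Rightarrow> ('x \<Rightarrow> real) set" where
  "L2 P = {f \<in> borel_measurable P. integrable P (\<lambda>x. (f x)\<^sup>2)}"

definition bounded_linear_L2 :: "'x measure \<Rightarrow> ('h::real_normed_vector \<Rightarrow> 'x \<Rightarrow> real) \<Rightarrow> bool" where
  "bounded_linear_L2 P A \<longleftrightarrow>
     (\<forall>h. A h \<in> L2 P) \<and>
     (\<forall>h h'. AE x in P. A (h + h') x = A h x + A h' x) \<and>
     (\<forall>c h. AE x in P. A (c *\<^sub>R h) x = c * A h x) \<and>
     (\<exists>C. \<forall>h. sqrt (\<integral>x. (A h x)\<^sup>2 \<partial>P) \<le> C * norm h)"

definition L2_closure :: "'x measure \<Rightarrow> ('x \<Rightarrow> real) set \<Rightarrow> ('x \<Rightarrow> real) set" where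
  "L2_closure P S = {f \<in> L2 P. \<forall>\<epsilon>>0. \<exists>s\<in>S. sqrt (\<integral>x. (f x - s x)\<^sup>2 \<partial>P) < \<epsilon>}"

text \<open>\<open>g\<close> is (a version of) the orthogonal projection of \<open>f\<close> onto the closed subspace \<open>V\<close>.\<close>

definition is_L2_projection :: "'x measure \<Rightarrow> ('x \<Rightarrow> real) set \<Rightarrow> ('x \<Rightarrow> real) \<Rightarrow> ('x \<Rightarrow> real) \<Rightarrow> bool" where
  "is_L2_projection P V f g \<longleftrightarrow> g \<in> V \<and> (\<forall>u\<in>V. (\<integral>x. (f x - g x) * u x \<partial>P) = 0)"

definition second_moment :: "'x measure \<Rightarrow> ('x \<Rightarrow> real^'p) \<Rightarrow> real^'p^'p" where
  "second_moment P f = (\<chi> a b. \<integral>x. f x $ a * f x $ b \<partial>P)"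

section \<open>The semiparametric model\<close>

text \<open>\<open>p \<theta> \<eta>\<close> is the density of \<open>P\<^bsub>\<theta>,\<eta>\<^esub>\<close> with respect to the dominating measure \<open>M\<close>.\<close>

definition law :: "'x measure \<Rightarrow> (real^'p \<Rightarrow> 'e \<Rightarrow> 'x \<Rightarrow> real) \<Rightarrow> real^'p \<Rightarrow> 'e \<Rightarrow> 'x measure" where
  "law M p \<theta> \<eta> = density M (\<lambda>x. ennreal (p \<theta> \<eta> x))"

definition is_density :: "'x measure \<Rightarrow> ('x \<Rightarrow> real) \<Rightarrow> bool" where
  "is_density M f \<longleftrightarrow> f \<in> borel_measurable M \<and> (\<forall>x\<in>space M. 0 \<le> f x) \<and> (\<integral>\<^sup>+x. ennreal (f x) \<partial>M) = 1"

text \<open>The vector \<open>\<theta>\<^sub>0 + \<tau>/\<surd>n\<close>.\<close>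

definition local_par :: "real^'p \<Rightarrow> nat \<Rightarrow> real^'p \<Rightarrow> real^'p" where
  "local_par \<theta>0 n \<tau> = \<theta>0 + (1 / sqrt (real n)) *\<^sub>R \<tau>"

text \<open>Differentiability in quadratic mean at \<open>(\<theta>\<^sub>0,\<eta>\<^sub>0)\<close> with derivative
  \<open>A (\<tau>,b) = \<tau> \<bullet> score + D b\<close>. The linear space \<open>B\<close> is the type \<open>'b\<close>, normed so that boundedness
  of \<open>A\<close> makes sense. The integral is a nonnegative extended integral, hence never defaults to \<open>0\<close>.\<close>

definition diff_quadratic_mean ::
  "'x measure \<Rightarrow> (real^'p) set \<Rightarrow> ('e::topological_space) set \<Rightarrow> (real^'p \<Rightarrow> 'e \<Rightarrow> 'x \<Rightarrow> real)
   \<Rightarrow> real^'p \<Rightarrow> 'e \<Rightarrow> (nat \<Rightarrow> 'b::real_normed_vector \<Rightarrow> 'e)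
   \<Rightarrow> ((real^'p) \<times> 'b \<Rightarrow> 'x \<Rightarrow> real) \<Rightarrow> ('x \<Rightarrow> real^'p) \<Rightarrow> ('b \<Rightarrow> 'x \<Rightarrow> real) \<Rightarrow> bool" where
  "diff_quadratic_mean M \<Theta> H p \<theta>0 \<eta>0 \<eta>n A score D \<longleftrightarrow>
     (\<forall>b. (\<lambda>n. \<eta>n n b) \<longlonglongrightarrow> \<eta>0) \<and>
     (\<forall>n. \<eta>n n 0 = \<eta>0) \<and>
     bounded_linear_L2 (law M p \<theta>0 \<eta>0) A \<and>
     (\<forall>a. (\<lambda>x. score x $ a) \<in> L2 (law M p \<theta>0 \<eta>0)) \<and>
     (\<forall>b. D b \<in> L2 (law M p \<theta>0 \<eta>0)) \<and>
     (\<forall>\<tau> b. AE x in law M p \<theta>0 \<eta>0. A (\<tau>, b) x = \<tau> \<bullet> score x + D b x) \<and>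
     (\<forall>\<tau> b.
        (\<forall>\<^sub>F n in sequentially. local_par \<theta>0 n \<tau> \<in> \<Theta> \<and> \<eta>n n b \<in> H) \<and>
        ((\<lambda>n. \<integral>\<^sup>+x. ennreal ((sqrt (real n) * (sqrt (p (local_par \<theta>0 n \<tau>) (\<eta>n n b) x) - sqrt (p \<theta>0 \<eta>0 x))
                 - 1/2 * A (\<tau>, b) x * sqrt (p \<theta>0 \<eta>0 x))\<^sup>2) \<partial>M) \<longlongrightarrow> 0) sequentially)"

definition is_efficient_score ::
  "'x measure \<Rightarrow> ('x \<Rightarrow> real^'p) \<Rightarrow> ('b \<Rightarrow> 'x \<Rightarrow> real) \<Rightarrow> ('x \<Rightarrow> real^'p) \<Rightarrow> bool" where
  "is_efficient_score P score D eff \<longleftrightarrow>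
     (\<exists>\<Pi>s :: 'x \<Rightarrow> real^'p.
        (\<forall>a. is_L2_projection P (L2_closure P (range D)) (\<lambda>x. score x $ a) (\<lambda>x. \<Pi>s x $ a)) \<and>
        eff = (\<lambda>x. score x - \<Pi>s x))"

text \<open>\<open>est n\<close> is evaluated at a sample of size \<open>n\<close>.\<close>

definition regular_with_limit ::
  "'x measure \<Rightarrow> (real^'p \<Rightarrow> 'e \<Rightarrow> 'x \<Rightarrow> real) \<Rightarrow> real^'p \<Rightarrow> (nat \<Rightarrow> 'b \<Rightarrow> 'e)
   \<Rightarrow> (nat \<Rightarrow> (nat \<Rightarrow> 'x) \<Rightarrow> real^'p) \<Rightarrow> (real^'p) measure \<Rightarrow> bool" where
  "regular_with_limit M p \<theta>0 \<eta>n est L \<longleftrightarrow>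
     prob_space L \<and> sets L = sets borel \<and>
     (\<forall>\<tau> b. weakly_converges
        (\<lambda>n. distr (prod_law n (law M p (local_par \<theta>0 n \<tau>) (\<eta>n n b))) borel
               (\<lambda>x. sqrt (real n) *\<^sub>R (est n x - local_par \<theta>0 n \<tau>))) L)"

definition best_regular ::
  "'x measure \<Rightarrow> (real^'p \<Rightarrow> 'e \<Rightarrow> 'x \<Rightarrow> real) \<Rightarrow> real^'p \<Rightarrow> (nat \<Rightarrow> 'b \<Rightarrow> 'e)
   \<Rightarrow> real^'p^'p \<Rightarrow> (nat \<Rightarrow> (nat \<Rightarrow> 'x) \<Rightarrow> real^'p) \<Rightarrow> bool" where
  "best_regular M p \<theta>0 \<eta>n J est \<longleftrightarrow>
     regular_with_limit M p \<theta>0 \<eta>n est (normal_law (matrix_inv J))"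

section \<open>Parametric approximations\<close>

text \<open>Since the dimension \<open>k\<close> varies with the approximation, vectors in \<open>\<real>\<^sup>k\<close> are functions on
  \<open>{..<k}\<close> (in the sense of \<^const>\<open>extensional\<close>). In a parametric model with densities \<open>q \<theta> \<gamma>\<close> the
  scores are the vectors of partial derivatives of the log-density at \<open>(\<theta>\<^sub>0,\<gamma>\<^sub>0)\<close>, defined almost
  everywhere under the law at that point and with finite Fisher information. Positivity near the
  point is required because \<open>ln 0 = 0\<close>.\<close>

definition parametric_scores ::
  "'x measure \<Rightarrow> (real^'p) set \<Rightarrow> nat \<Rightarrow> (nat \<Rightarrow> real) set \<Rightarrow> (real^'p \<Rightarrow> (nat \<Rightarrow> real) \<Rightarrow> 'x \<Rightarrow> real)
   \<Rightarrow> real^'p \<Rightarrow> (nat \<Rightarrow> real) \<Rightarrow> ('x \<Rightarrow> real^'p) \<Rightarrow> ('x \<Rightarrow> nat \<Rightarrow> real) \<Rightarrow> bool" where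
  "parametric_scores M \<Theta> k \<Gamma> q \<theta>0 \<gamma>0 ldot vdot \<longleftrightarrow>
     (\<forall>a. (\<lambda>x. ldot x $ a) \<in> L2 (law M q \<theta>0 \<gamma>0)) \<and>
     (\<forall>i<k. (\<lambda>x. vdot x i) \<in> L2 (law M q \<theta>0 \<gamma>0)) \<and>
     (AE x in law M q \<theta>0 \<gamma>0.
        (\<forall>a. (\<forall>\<^sub>F t in at 0. \<theta>0 + t *\<^sub>R axis a 1 \<in> \<Theta> \<and> 0 < q (\<theta>0 + t *\<^sub>R axis a 1) \<gamma>0 x) \<and>
             ((\<lambda>t. ln (q (\<theta>0 + t *\<^sub>R axis a 1) \<gamma>0 x)) has_real_derivative ldot x $ a) (at 0)) \<and>
        (\<forall>i<k. (\<forall>\<^sub>F u in at (\<gamma>0 i). \<gamma>0(i := u) \<in> \<Gamma> \<and> 0 < q \<theta>0 (\<gamma>0(i := u)) x) \<and>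
             ((\<lambda>u. ln (q \<theta>0 (\<gamma>0(i := u)) x)) has_real_derivative vdot x i) (at (\<gamma>0 i))))"

text \<open>The efficient score \<open>ldot - i\<^sub>0\<^sub>1 i\<^sub>1\<^sub>1\<^sup>-\<^sup>1 vdot\<close>, with \<open>W\<close> the inverse of \<open>i\<^sub>1\<^sub>1\<close>; it exists only if the
  scores exist and \<open>i\<^sub>1\<^sub>1\<close> is invertible. As for every score, its mean is zero, so that its second
  moment matrix is its variance.\<close>

definition is_parametric_efficient_score ::
  "'x measure \<Rightarrow> (real^'p) set \<Rightarrow> nat \<Rightarrow> (nat \<Rightarrow> real) set \<Rightarrow> (real^'p \<Rightarrow> (nat \<Rightarrow> real) \<Rightarrow> 'x \<Rightarrow> real)
   \<Rightarrow> real^'p \<Rightarrow> (nat \<Rightarrow> real) \<Rightarrow> ('x \<Rightarrow> real^'p) \<Rightarrow> bool" where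
  "is_parametric_efficient_score M \<Theta> k \<Gamma> q \<theta>0 \<gamma>0 eff \<longleftrightarrow>
     (\<exists>ldot vdot i01 i11 W.
        parametric_scores M \<Theta> k \<Gamma> q \<theta>0 \<gamma>0 ldot vdot \<and>
        (\<forall>a. \<forall>j<k. i01 a j = (\<integral>x. ldot x $ a * vdot x j \<partial>law M q \<theta>0 \<gamma>0)) \<and>
        (\<forall>i<k. \<forall>j<k. i11 i j = (\<integral>x. vdot x i * vdot x j \<partial>law M q \<theta>0 \<gamma>0)) \<and>
        (\<forall>i<k. \<forall>j<k. (\<Sum>r<k. i11 i r * W r j) = (if i = j then 1 else 0)) \<and>
        (\<forall>i<k. \<forall>j<k. (\<Sum>r<k. W i r * i11 r j) = (if i = j then 1 else 0)) \<and>
        eff = (\<lambda>x. ldot x - (\<chi> a. \<Sum>i<k. \<Sum>j<k. i01 a i * W i j * vdot x j)) \<and>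
        (\<integral>x. eff x \<partial>law M q \<theta>0 \<gamma>0) = 0)"

definition likelihood ::
  "(real^'p \<Rightarrow> 'g \<Rightarrow> 'x \<Rightarrow> real) \<Rightarrow> nat \<Rightarrow> (nat \<Rightarrow> 'x) \<Rightarrow> real^'p \<Rightarrow> 'g \<Rightarrow> ennreal" where
  "likelihood q n x \<theta> \<gamma> = (\<Prod>i<n. ennreal (q \<theta> \<gamma> (x i)))"

definition profile_likelihood ::
  "(real^'p \<Rightarrow> 'g \<Rightarrow> 'x \<Rightarrow> real) \<Rightarrow> 'g set \<Rightarrow> nat \<Rightarrow> (nat \<Rightarrow> 'x) \<Rightarrow> real^'p \<Rightarrow> ennreal" where
  "profile_likelihood q \<Gamma> n x \<theta> = (SUP \<gamma>\<in>\<Gamma>. likelihood q n x \<theta> \<gamma>)"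

definition profile_log_ratio ::
  "(real^'p \<Rightarrow> 'g \<Rightarrow> 'x \<Rightarrow> real) \<Rightarrow> 'g set \<Rightarrow> real^'p \<Rightarrow> nat \<Rightarrow> (nat \<Rightarrow> 'x) \<Rightarrow> real^'p \<Rightarrow> ereal" where
  "profile_log_ratio q \<Gamma> \<theta>0 n x h =
     elog (profile_likelihood q \<Gamma> n x (local_par \<theta>0 n h)) - elog (profile_likelihood q \<Gamma> n x \<theta>0)"

text \<open>The log-likelihood ratio \<open>log dP\<^sub>1\<^sup>n/dP\<^sub>0\<^sup>n\<close> of laws with densities \<open>f1\<close> and \<open>f0\<close>, i.e. the logarithm
  of the quotient of product densities, which is the density of the absolutely continuous part. It
  may be \<open>-\<infinity>\<close>; the value where the \<open>f0\<close>-density vanishes is immaterial under \<open>P\<^sub>0\<^sup>n\<close>.\<close>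

definition log_lik_ratio :: "('x \<Rightarrow> real) \<Rightarrow> ('x \<Rightarrow> real) \<Rightarrow> nat \<Rightarrow> (nat \<Rightarrow> 'x) \<Rightarrow> ereal" where
  "log_lik_ratio f1 f0 n x = elog (ennreal ((\<Prod>i<n. f1 (x i)) / (\<Prod>i<n. f0 (x i))))"

end

theory Submission
  imports Defs
begin

text \<open>
  As a function of the local parameter, the profile log-likelihood is concave and, at each of finitely
  many points, close to a quadratic function. Concavity turns this into control of the maximiser;
  nothing here need be measurable, so the argument runs under outer measure.

  For regularity, compare \<open>P\<^sub>m\<close> with the law whose \<open>P\<^sub>0\<close>-density is proportional to \<open>exp (g\<^sub>n / \<surd>n)\<close>,
  \<open>g\<^sub>n\<close> being \<open>g\<close> truncated and centred. The expansion of the log-likelihood ratio forces the Hellinger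
  affinity of the \<open>n\<close>-fold products of these two laws to tend to 1, so that they are at Hellinger distance
  \<open>o(n\<^sup>-\<^sup>1\<^sup>/\<^sup>2)\<close>, and \<open>\<surd>n (\<surd>p\<^sub>m - \<surd>p\<^sub>0)\<close> tends to \<open>g \<surd>p\<^sub>0 / 2\<close> in \<open>L\<^sub>2\<close>. Tilted laws have product
  likelihood ratios with bounded second and inverse first moments, which makes \<open>P\<^sub>0\<^sup>n\<close>, \<open>P\<^sub>m\<^sup>n\<close> and the
  local alternatives mutually contiguous; the expansion of the estimator therefore holds under each
  local alternative with direction \<open>f = Ah\<close>. There the characteristic function of the normalised sum
  of the scores, a product of \<open>n\<close> equal factors, converges to that of a Gaussian variable with variance \<open>J\<close>
  and mean \<open>E\<^sub>0 (f - g) eff\<close>. As \<open>g\<close> is orthogonal to the efficient score this is \<open>J \<tau>\<close>, whatever \<open>b\<close>.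
\<close>

section \<open>Square-integrable functions and densities\<close>

text \<open>The obstacle is that condition (1) controls n-sample likelihood ratios in probability,
  whereas regularity calls for an L2 derivative of the root density of one observation. The
  Hellinger affinity connects the two: it is multiplicative over products and at most 1, so a lower
  bound for the n-sample affinity that tends to 1 already forces n times (1 - affinity of one
  observation) to 0. Truncation at n^(1/4) makes the comparison law tractable: its exponents are at
  most 2 n^(-1/4) in absolute value, so exponential moments exist and have second-order expansions,
  while the level still tends to infinity and no L2 mass of \<open>g\<close> is lost in the limit.
  Characteristic functions under an alternative are expanded around the root density of the
  approximating law, under which the approximating scores are centred; the term of order sqrt n then
  vanishes exactly, and no rate for the convergence of the scores is required. Since the L2 spaces
  of moving laws are not comparable directly, everything is moved to L2 of the dominating measure by
  multiplication with root densities.\<close>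

lemma L2_measurable: "f \<in> L2 M \<Longrightarrow> f \<in> borel_measurable M"
  by (simp add: L2_def)

lemma L2_integrable_square: "f \<in> L2 M \<Longrightarrow> integrable M (\<lambda>x. (f x)\<^sup>2)"
  by (simp add: L2_def)

lemma L2_integrable_mult:
  assumes "f \<in> L2 M" "g \<in> L2 M"
  shows "integrable M (\<lambda>x. f x * g x)"
proof (rule Bochner_Integration.integrable_bound)
  show "integrable M (\<lambda>x. (f x)\<^sup>2 + (g x)\<^sup>2)"
    using assms by (intro Bochner_Integration.integrable_add L2_integrable_square)
  show "(\<lambda>x. f x * g x) \<in> borel_measurable M"
    using assms by (intro borel_measurable_times L2_measurable)
  have "\<bar>a * b\<bar> \<le> a\<^sup>2 + b\<^sup>2" for a b :: real
    using sum_squares_bound[of "\<bar>a\<bar>" "\<bar>b\<bar>"] mult_nonneg_nonneg[of "\<bar>a\<bar>" "\<bar>b\<bar>"]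
    unfolding abs_mult power2_abs by linarith
  then show "AE x in M. norm (f x * g x) \<le> norm ((f x)\<^sup>2 + (g x)\<^sup>2)"
    by auto
qed

lemma L2_scale:
  assumes "f \<in> L2 M" shows "(\<lambda>x. c * f x) \<in> L2 M"
  using assms by (auto simp: L2_def power_mult_distrib)

lemma L2_add:
  assumes "f \<in> L2 M" "g \<in> L2 M" shows "(\<lambda>x. f x + g x) \<in> L2 M"
  using assms L2_integrable_mult[OF assms]
  by (auto simp: L2_def power2_sum mult.assoc)

lemma L2_diff:
  assumes "f \<in> L2 M" "g \<in> L2 M" shows "(\<lambda>x. f x - g x) \<in> L2 M"
  using L2_add[OF assms(1) L2_scale[OF assms(2), of "-1"]] by simp

lemma L2_zero [simp]: "(\<lambda>x. 0) \<in> L2 M"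
  by (simp add: L2_def)

lemma L2_sum:
  assumes "\<And>i. i \<in> I \<Longrightarrow> f i \<in> L2 M"
  shows "(\<lambda>x. \<Sum>i\<in>I. f i x) \<in> L2 M"
  using assms by (induction I rule: infinite_finite_induct) (auto intro: L2_add)

lemma (in finite_measure) L2_const: "(\<lambda>x. c) \<in> L2 M"
  by (simp add: L2_def)

lemma (in finite_measure) L2_integrable:
  assumes "f \<in> L2 M" shows "integrable M f"
  using L2_integrable_mult[OF assms L2_const[of 1]] by simp

lemma L2_bounded_mult:
  assumes "f \<in> L2 M" "g \<in> borel_measurable M" "\<And>x. \<bar>g x\<bar> \<le> c"
  shows "(\<lambda>x. g x * f x) \<in> L2 M"
proof -
  have "integrable M (\<lambda>x. (g x * f x)\<^sup>2)"
  proof (rule Bochner_Integration.integrable_bound)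
    show "integrable M (\<lambda>x. c\<^sup>2 * (f x)\<^sup>2)"
      using assms(1) by (simp add: L2_def)
    show "(\<lambda>x. (g x * f x)\<^sup>2) \<in> borel_measurable M"
      using assms by (auto simp: L2_def)
    have "(g x)\<^sup>2 \<le> c\<^sup>2" for x
      using assms(3)[of x] by (metis abs_ge_zero power2_abs power_mono)
    then show "AE x in M. norm ((g x * f x)\<^sup>2) \<le> norm (c\<^sup>2 * (f x)\<^sup>2)"
      by (auto simp: power_mult_distrib intro!: mult_right_mono)
  qed
  then show ?thesis using assms by (auto simp: L2_def)
qed

lemma L2_Cauchy_Schwarz_abs:
  assumes "f \<in> L2 M" "g \<in> L2 M"
  shows "(\<integral>x. \<bar>f x * g x\<bar> \<partial>M) \<le> sqrt (\<integral>x. (f x)\<^sup>2 \<partial>M) * sqrt (\<integral>x. (g x)\<^sup>2 \<partial>M)"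
proof -
  have i: "integrable M (\<lambda>x. \<bar>f x * g x\<bar>)"
    using L2_integrable_mult[OF assms] by simp
  have "ennreal ((\<integral>x. \<bar>f x * g x\<bar> \<partial>M)\<^sup>2) = (\<integral>\<^sup>+x. ennreal \<bar>f x\<bar> * ennreal \<bar>g x\<bar> \<partial>M)\<^sup>2"
    by (simp add: ennreal_mult'[symmetric] abs_mult[symmetric] nn_integral_eq_integral[OF i]
        ennreal_power)
  also have "\<dots> \<le> (\<integral>\<^sup>+x. (ennreal \<bar>f x\<bar>)\<^sup>2 \<partial>M) * (\<integral>\<^sup>+x. (ennreal \<bar>g x\<bar>)\<^sup>2 \<partial>M)"
    using assms by (intro Cauchy_Schwarz_nn_integral) (auto simp: L2_def)
  also have "\<dots> = ennreal ((\<integral>x. (f x)\<^sup>2 \<partial>M) * (\<integral>x. (g x)\<^sup>2 \<partial>M))"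
    using assms by (simp add: ennreal_power nn_integral_eq_integral L2_integrable_square ennreal_mult)
  finally have "(\<integral>x. \<bar>f x * g x\<bar> \<partial>M)\<^sup>2 \<le> (\<integral>x. (f x)\<^sup>2 \<partial>M) * (\<integral>x. (g x)\<^sup>2 \<partial>M)"
    by (subst (asm) ennreal_le_iff) auto
  then have "sqrt ((\<integral>x. \<bar>f x * g x\<bar> \<partial>M)\<^sup>2) \<le> sqrt ((\<integral>x. (f x)\<^sup>2 \<partial>M) * (\<integral>x. (g x)\<^sup>2 \<partial>M))"
    by (rule real_sqrt_le_mono)
  then show ?thesis by (simp add: real_sqrt_mult)
qed

lemma L2_Cauchy_Schwarz:
  assumes "f \<in> L2 M" "g \<in> L2 M"
  shows "\<bar>\<integral>x. f x * g x \<partial>M\<bar> \<le> sqrt (\<integral>x. (f x)\<^sup>2 \<partial>M) * sqrt (\<integral>x. (g x)\<^sup>2 \<partial>M)"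
  using L2_Cauchy_Schwarz_abs[OF assms] integral_abs_bound[of M "\<lambda>x. f x * g x"] by linarith

text \<open>Membership is demanded at every index because the Bochner integral of a square that is
  not integrable defaults to 0 and would feign convergence. Sequences that make sense only for large
  n are therefore patched at the other indices in the final proof.\<close>

definition L2_tendsto :: "'a measure \<Rightarrow> (nat \<Rightarrow> 'a \<Rightarrow> real) \<Rightarrow> ('a \<Rightarrow> real) \<Rightarrow> bool" where
  "L2_tendsto M F f \<longleftrightarrow> (\<forall>n. F n \<in> L2 M) \<and> f \<in> L2 M \<and> (\<lambda>n. \<integral>x. (F n x - f x)\<^sup>2 \<partial>M) \<longlonglongrightarrow> 0"

lemma L2_tendstoD:
  assumes "L2_tendsto M F f"
  shows "F n \<in> L2 M" "f \<in> L2 M" "(\<lambda>n. \<integral>x. (F n x - f x)\<^sup>2 \<partial>M) \<longlonglongrightarrow> 0"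
  using assms by (auto simp: L2_tendsto_def)

lemma square_add_le: "(a + b)\<^sup>2 \<le> 2 * a\<^sup>2 + 2 * (b::real)\<^sup>2"
  using sum_squares_bound[of a b] by (simp add: power2_sum)

lemma L2_tendsto_const: "f \<in> L2 M \<Longrightarrow> L2_tendsto M (\<lambda>_. f) f"
  by (simp add: L2_tendsto_def)

lemma integral_square_add_le:
  assumes "f \<in> L2 M" "g \<in> L2 M"
  shows "(\<integral>x. (f x + g x)\<^sup>2 \<partial>M) \<le> 2 * (\<integral>x. (f x)\<^sup>2 \<partial>M) + 2 * (\<integral>x. (g x)\<^sup>2 \<partial>M)"
proof -
  have "(\<integral>x. (f x + g x)\<^sup>2 \<partial>M) \<le> (\<integral>x. 2 * (f x)\<^sup>2 + 2 * (g x)\<^sup>2 \<partial>M)"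
    using assms L2_add[OF assms] by (intro integral_mono square_add_le) (auto simp: L2_def)
  also have "\<dots> = 2 * (\<integral>x. (f x)\<^sup>2 \<partial>M) + 2 * (\<integral>x. (g x)\<^sup>2 \<partial>M)"
    using assms by (subst Bochner_Integration.integral_add) (auto simp: L2_def)
  finally show ?thesis .
qed

lemma L2_tendsto_add:
  assumes "L2_tendsto M F f" "L2_tendsto M G g"
  shows "L2_tendsto M (\<lambda>n x. F n x + G n x) (\<lambda>x. f x + g x)"
proof -
  note F = L2_tendstoD[OF assms(1)] and G = L2_tendstoD[OF assms(2)]
  have "(\<lambda>n. \<integral>x. (F n x + G n x - (f x + g x))\<^sup>2 \<partial>M) \<longlonglongrightarrow> 0"
  proof (rule tendsto_sandwich[OF _ _ tendsto_const])
    show "\<forall>\<^sub>F n in sequentially. (\<integral>x. (F n x + G n x - (f x + g x))\<^sup>2 \<partial>M)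
        \<le> 2 * (\<integral>x. (F n x - f x)\<^sup>2 \<partial>M) + 2 * (\<integral>x. (G n x - g x)\<^sup>2 \<partial>M)"
      using integral_square_add_le[OF L2_diff[OF F(1,2)] L2_diff[OF G(1,2)]]
      by (auto simp: algebra_simps)
    show "(\<lambda>n. 2 * (\<integral>x. (F n x - f x)\<^sup>2 \<partial>M) + 2 * (\<integral>x. (G n x - g x)\<^sup>2 \<partial>M)) \<longlonglongrightarrow> 0"
      using tendsto_add[OF tendsto_mult_left[OF F(3), of 2] tendsto_mult_left[OF G(3), of 2]] by simp
  qed auto
  then show ?thesis using F G by (auto simp: L2_tendsto_def intro: L2_add)
qed

lemma L2_tendsto_scale:
  assumes "L2_tendsto M F f"
  shows "L2_tendsto M (\<lambda>n x. c * F n x) (\<lambda>x. c * f x)"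
proof -
  note F = L2_tendstoD[OF assms]
  have "(\<lambda>n. \<integral>x. (c * F n x - c * f x)\<^sup>2 \<partial>M) = (\<lambda>n. c\<^sup>2 * (\<integral>x. (F n x - f x)\<^sup>2 \<partial>M))"
    by (simp add: right_diff_distrib[symmetric] power_mult_distrib)
  moreover have "(\<lambda>n. c\<^sup>2 * (\<integral>x. (F n x - f x)\<^sup>2 \<partial>M)) \<longlonglongrightarrow> 0"
    using tendsto_mult_left[OF F(3), of "c\<^sup>2"] by simp
  ultimately show ?thesis using F by (auto simp: L2_tendsto_def intro: L2_scale)
qed

lemma L2_tendsto_diff:
  assumes "L2_tendsto M F f" "L2_tendsto M G g"
  shows "L2_tendsto M (\<lambda>n x. F n x - G n x) (\<lambda>x. f x - g x)"
  using L2_tendsto_add[OF assms(1) L2_tendsto_scale[OF assms(2), of "-1"]] by simp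

text \<open>With FG - fg = (F - f)(G - g) + (F - f)g + f(G - g), each of the three terms is bounded
  by Cauchy-Schwarz.\<close>

lemma L2_tendsto_mult:
  assumes "L2_tendsto M F f" "L2_tendsto M G g"
  shows "(\<lambda>n. \<integral>x. F n x * G n x \<partial>M) \<longlonglongrightarrow> (\<integral>x. f x * g x \<partial>M)"
proof -
  note F = L2_tendstoD[OF assms(1)] and G = L2_tendstoD[OF assms(2)]
  define N where "N u = sqrt (\<integral>x. (u x)\<^sup>2 \<partial>M)" for u :: "'a \<Rightarrow> real"
  let ?F = "\<lambda>n x. F n x - f x" and ?G = "\<lambda>n x. G n x - g x"
  have FN: "(\<lambda>n. N (?F n)) \<longlonglongrightarrow> 0" and GN: "(\<lambda>n. N (?G n)) \<longlonglongrightarrow> 0"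
    using tendsto_real_sqrt[OF F(3)] tendsto_real_sqrt[OF G(3)] by (auto simp: N_def)
  have "(\<lambda>n. (\<integral>x. F n x * G n x \<partial>M) - (\<integral>x. f x * g x \<partial>M)) \<longlonglongrightarrow> 0"
  proof (rule Lim_null_comparison)
    show "\<forall>\<^sub>F n in sequentially. norm ((\<integral>x. F n x * G n x \<partial>M) - (\<integral>x. f x * g x \<partial>M))
        \<le> N (?F n) * N (?G n) + N (?F n) * N g + N f * N (?G n)"
    proof (rule always_eventually, rule allI)
      fix n
      have i: "integrable M (\<lambda>x. ?F n x * ?G n x)" "integrable M (\<lambda>x. ?F n x * g x)"
          "integrable M (\<lambda>x. f x * ?G n x)" "integrable M (\<lambda>x. f x * g x)"
        using F G by (intro L2_integrable_mult L2_diff; simp)+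
      have "(\<integral>x. F n x * G n x \<partial>M)
          = (\<integral>x. ?F n x * ?G n x + ?F n x * g x + f x * ?G n x + f x * g x \<partial>M)"
        by (rule Bochner_Integration.integral_cong) (auto simp: algebra_simps)
      also have "\<dots> = (\<integral>x. ?F n x * ?G n x \<partial>M) + (\<integral>x. ?F n x * g x \<partial>M) + (\<integral>x. f x * ?G n x \<partial>M)
          + (\<integral>x. f x * g x \<partial>M)"
        using i by simp
      finally show "norm ((\<integral>x. F n x * G n x \<partial>M) - (\<integral>x. f x * g x \<partial>M))
        \<le> N (?F n) * N (?G n) + N (?F n) * N g + N f * N (?G n)"
        using L2_Cauchy_Schwarz[OF L2_diff[OF F(1,2)] L2_diff[OF G(1,2)], of n n]
          L2_Cauchy_Schwarz[OF L2_diff[OF F(1,2)] G(2), of n]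
          L2_Cauchy_Schwarz[OF F(2) L2_diff[OF G(1,2)], of n]
        unfolding N_def real_norm_def by linarith
    qed
    show "(\<lambda>n. N (?F n) * N (?G n) + N (?F n) * N g + N f * N (?G n)) \<longlonglongrightarrow> 0"
      using FN GN by (auto intro!: tendsto_eq_intros)
  qed
  then show ?thesis by (simp add: LIM_zero_iff)
qed

lemma L2_tendsto_square:
  "L2_tendsto M F f \<Longrightarrow> (\<lambda>n. \<integral>x. (F n x)\<^sup>2 \<partial>M) \<longlonglongrightarrow> (\<integral>x. (f x)\<^sup>2 \<partial>M)"
  using L2_tendsto_mult[of M F f F f] by (simp add: power2_eq_square)

lemma L2_tendsto_zero_iff:
  "L2_tendsto M F (\<lambda>_. 0) \<longleftrightarrow> (\<forall>n. F n \<in> L2 M) \<and> (\<lambda>n. \<integral>x. (F n x)\<^sup>2 \<partial>M) \<longlonglongrightarrow> 0"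
  by (simp add: L2_tendsto_def)

lemma L2_tendsto_cong:
  assumes "L2_tendsto M F f" "L2_tendsto M (\<lambda>n x. G n x - F n x) (\<lambda>_. 0)"
  shows "L2_tendsto M G f"
  using L2_tendsto_add[OF assms] by simp

lemma L2_nn_integral:
  "f \<in> L2 M \<Longrightarrow> (\<integral>\<^sup>+x. ennreal ((f x)\<^sup>2) \<partial>M) = ennreal (\<integral>x. (f x)\<^sup>2 \<partial>M)"
  by (simp add: nn_integral_eq_integral L2_integrable_square)

text \<open>Condition (2) and differentiability in quadratic mean are stated with extended
  integrals; this is their entry point into \<open>L2_tendsto\<close>.\<close>

lemma L2_tendsto_nnI:
  assumes "\<And>n. F n \<in> L2 M" "f \<in> L2 M"
    and "(\<lambda>n. \<integral>\<^sup>+x. ennreal ((F n x - f x)\<^sup>2) \<partial>M) \<longlonglongrightarrow> 0"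
  shows "L2_tendsto M F f"
proof -
  have "(\<lambda>n. ennreal (\<integral>x. (F n x - f x)\<^sup>2 \<partial>M)) \<longlonglongrightarrow> ennreal 0"
    using assms(3) by (simp add: L2_nn_integral[OF L2_diff[OF assms(1,2)]])
  then have "(\<lambda>n. \<integral>x. (F n x - f x)\<^sup>2 \<partial>M) \<longlonglongrightarrow> 0"
    by (subst (asm) tendsto_ennreal_iff) auto
  then show ?thesis using assms by (auto simp: L2_tendsto_def)
qed

lemma is_densityD:
  assumes "is_density M f"
  shows "f \<in> borel_measurable M" "x \<in> space M \<Longrightarrow> 0 \<le> f x" "prob_space (density M f)"
    "(\<lambda>x. sqrt (f x)) \<in> L2 M" "integrable M f" "(\<integral>x. f x \<partial>M) = 1"
    "(\<integral>x. (sqrt (f x))\<^sup>2 \<partial>M) = 1"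
proof -
  show m: "f \<in> borel_measurable M" and p: "\<And>x. x \<in> space M \<Longrightarrow> 0 \<le> f x" using assms by (auto simp: is_density_def)
  have e: "(\<integral>\<^sup>+x. ennreal (f x) \<partial>M) = 1" using assms by (auto simp: is_density_def)
  show "prob_space (density M f)"
    by (rule prob_spaceI) (use m e in \<open>auto simp: emeasure_density cong: nn_integral_cong\<close>)
  show i: "integrable M f"
    using m p e by (intro integrableI_nonneg) auto
  have [simp]: "AE x in M. 0 \<le> f x" using p by auto
  show i1: "(\<integral>x. f x \<partial>M) = 1"
    by (subst integral_eq_nn_integral) (use m e in auto)
  \<comment> \<open>\<open>sqrt\<close> is an odd function, so the squared root is the absolute
    value even at points outside \<open>space M\<close> where \<open>f\<close> may be
    negative.\<close>
  have "(sqrt (f x))\<^sup>2 = \<bar>f x\<bar>" for x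
    by (metis power2_abs real_sqrt_abs real_sqrt_power)
  then show "(\<lambda>x. sqrt (f x)) \<in> L2 M" using m i by (auto simp: L2_def)
  have "(\<integral>x. (sqrt (f x))\<^sup>2 \<partial>M) = (\<integral>x. f x \<partial>M)"
    using p by (intro Bochner_Integration.integral_cong) auto
  then show "(\<integral>x. (sqrt (f x))\<^sup>2 \<partial>M) = 1" using i1 by simp
qed

text \<open>Multiplication by \<open>sqrt p\<close> embeds L2 of the law with density
  \<open>p\<close> isometrically into L2 of the dominating measure, a common space for all laws of
  the model.\<close>

lemma L2_density_iff:
  assumes "is_density M p"
  shows "f \<in> L2 (density M p) \<longleftrightarrow> f \<in> borel_measurable M \<and> (\<lambda>x. f x * sqrt (p x)) \<in> L2 M"
proof -
  note p = is_densityD[OF assms]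
  have [measurable]: "p \<in> borel_measurable M" by (rule p)
  have "integrable (density M p) (\<lambda>x. (f x)\<^sup>2) \<longleftrightarrow> integrable M (\<lambda>x. (f x * sqrt (p x))\<^sup>2)"
    if [measurable]: "f \<in> borel_measurable M"
  proof -
    have "integrable (density M p) (\<lambda>x. (f x)\<^sup>2) \<longleftrightarrow> integrable M (\<lambda>x. p x *\<^sub>R (f x)\<^sup>2)"
      by (rule integrable_density) (use p in auto)
    also have "\<dots> \<longleftrightarrow> integrable M (\<lambda>x. (f x * sqrt (p x))\<^sup>2)"
      by (rule Bochner_Integration.integrable_cong)
        (use p(2) in \<open>auto simp: power_mult_distrib\<close>)
    finally show ?thesis .
  qed
  then show ?thesis by (auto simp: L2_def measurable_density_eq1)
qed

lemma integral_density_mult: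
  assumes "is_density M p" "f \<in> borel_measurable M" "g \<in> borel_measurable M"
  shows "(\<integral>x. f x * g x \<partial>density M p) = (\<integral>x. (f x * sqrt (p x)) * (g x * sqrt (p x)) \<partial>M)"
proof -
  note p = is_densityD[OF assms(1)]
  have "(\<integral>x. f x * g x \<partial>density M p) = (\<integral>x. p x *\<^sub>R (f x * g x) \<partial>M)"
    by (rule integral_density) (use p assms in auto)
  also have "\<dots> = (\<integral>x. (f x * sqrt (p x)) * (g x * sqrt (p x)) \<partial>M)"
  proof (rule Bochner_Integration.integral_cong)
    fix x assume "x \<in> space M"
    then have "sqrt (p x) * sqrt (p x) = p x" using p(2) by simp
    then show "p x *\<^sub>R (f x * g x) = (f x * sqrt (p x)) * (g x * sqrt (p x))"
      by (simp add: mult.assoc mult.left_commute)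
  qed simp
  finally show ?thesis .
qed

lemma integral_density_square:
  assumes "is_density M p" "f \<in> borel_measurable M"
  shows "(\<integral>x. (f x)\<^sup>2 \<partial>density M p) = (\<integral>x. (f x * sqrt (p x))\<^sup>2 \<partial>M)"
  using integral_density_mult[OF assms assms(2)] by (simp add: power2_eq_square)

lemma integral_density_sqrt:
  assumes "is_density M p" "f \<in> borel_measurable M"
  shows "(\<integral>x. f x \<partial>density M p) = (\<integral>x. (f x * sqrt (p x)) * sqrt (p x) \<partial>M)"
  using integral_density_mult[OF assms, of "\<lambda>_. 1"] by simp

section \<open>Product laws, Hellinger affinity and Hellinger distance\<close>

lemma space_prod_law: "x \<in> space (prod_law n M) \<Longrightarrow> i < n \<Longrightarrow> x i \<in> space M"
  by (auto simp: prod_law_def space_PiM PiE_iff)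

lemma sets_prod_law_cong: "sets M = sets N \<Longrightarrow> sets (prod_law n M) = sets (prod_law n N)"
  unfolding prod_law_def by (rule sets_PiM_cong) auto

lemma measurable_prod_law_component:
  "i < n \<Longrightarrow> (\<lambda>x. x i) \<in> measurable (prod_law n M) M"
  unfolding prod_law_def by (rule measurable_component_singleton) simp

lemma measurable_prod_law_comp:
  "i < n \<Longrightarrow> f \<in> measurable M N \<Longrightarrow> (\<lambda>x. f (x i)) \<in> measurable (prod_law n M) N"
  by (rule measurable_compose[OF measurable_prod_law_component])

lemma borel_measurable_prod_law_sum:
  fixes f :: "'a \<Rightarrow> 'b::{second_countable_topology, topological_comm_monoid_add}"
  assumes "f \<in> borel_measurable M"
  shows "(\<lambda>x. \<Sum>i<n. f (x i)) \<in> borel_measurable (prod_law n M)"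
  by (rule borel_measurable_sum) (rule measurable_prod_law_comp, auto intro: assms)

lemma prob_space_prod_law:
  assumes "prob_space P" shows "prob_space (prod_law n P)"
proof -
  interpret prob_space P by fact
  show ?thesis unfolding prod_law_def by (rule prob_space_PiM) (rule assms)
qed

lemma integral_prod_law_prod:
  fixes f :: "nat \<Rightarrow> 'a \<Rightarrow> 'b::{real_normed_field,banach,second_countable_topology}"
  assumes "sigma_finite_measure M" "\<And>i. i < n \<Longrightarrow> integrable M (f i)"
  shows "(\<integral>x. (\<Prod>i<n. f i (x i)) \<partial>prod_law n M) = (\<Prod>i<n. \<integral>x. f i x \<partial>M)"
    and "integrable (prod_law n M) (\<lambda>x. \<Prod>i<n. f i (x i))"
proof -
  interpret product_sigma_finite "\<lambda>_::nat. M"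
    using assms by (simp add: product_sigma_finite_def)
  show "(\<integral>x. (\<Prod>i<n. f i (x i)) \<partial>prod_law n M) = (\<Prod>i<n. \<integral>x. f i x \<partial>M)"
    unfolding prod_law_def by (rule product_integral_prod) (use assms in auto)
  show "integrable (prod_law n M) (\<lambda>x. \<Prod>i<n. f i (x i))"
    unfolding prod_law_def by (rule product_integrable_prod) (use assms in auto)
qed

lemma is_density_prod:
  assumes M: "sigma_finite_measure M" and f: "is_density M f"
  shows "is_density (prod_law n M) (\<lambda>x. \<Prod>i<n. f (x i))"
    and "prod_law n (density M f) = density (prod_law n M) (\<lambda>x. ennreal (\<Prod>i<n. f (x i)))"
proof -
  interpret product_sigma_finite "\<lambda>_::nat. M"
    using assms by (simp add: product_sigma_finite_def)
  note D = is_densityD[OF f]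
  have [measurable]: "f \<in> borel_measurable M" by (rule D)
  have nn: "0 \<le> f (x i)" if "x \<in> space (prod_law n M)" "i < n" for x i
    by (rule D(2)[OF space_prod_law[OF that]])
  have meas: "(\<lambda>x. \<Prod>i<n. f (x i)) \<in> borel_measurable (prod_law n M)"
    by (rule borel_measurable_prod) (rule measurable_prod_law_comp[where f=f], simp_all)
  have e: "ennreal (\<Prod>i<n. f (x i)) = (\<Prod>i<n. ennreal (f (x i)))"
    if "x \<in> space (prod_law n M)" for x
    by (rule prod_ennreal[symmetric]) (use nn[OF that] in simp)
  have "(\<integral>\<^sup>+x. ennreal (\<Prod>i<n. f (x i)) \<partial>prod_law n M) = (\<integral>\<^sup>+x. (\<Prod>i<n. ennreal (f (x i))) \<partial>prod_law n M)"
    by (intro nn_integral_cong e)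
  also have "\<dots> = (\<Prod>i<n. \<integral>\<^sup>+x. ennreal (f x) \<partial>M)"
    unfolding prod_law_def by (rule product_nn_integral_prod) auto
  also have "\<dots> = 1" using f by (simp add: is_density_def)
  finally show "is_density (prod_law n M) (\<lambda>x. \<Prod>i<n. f (x i))"
    using meas nn by (auto simp: is_density_def intro!: prod_nonneg)
  interpret P: prob_space "density M f" by (rule D)
  interpret PP: product_sigma_finite "\<lambda>_::nat. density M f"
    by standard
  have "density (prod_law n M) (\<lambda>x. ennreal (\<Prod>i<n. f (x i))) = PiM {..<n} (\<lambda>_. density M f)"
  proof (rule PP.PiM_eqI)
    show "sets (density (prod_law n M) (\<lambda>x. ennreal (\<Prod>i<n. f (x i)))) = sets (PiM {..<n} (\<lambda>_. density M f))"
      by (simp add: prod_law_def cong: sets_PiM_cong)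
    fix A assume A: "\<And>i. i \<in> {..<n} \<Longrightarrow> A i \<in> sets (density M f)"
    then have A': "\<And>i. i < n \<Longrightarrow> A i \<in> sets M" by simp
    have ms: "Pi\<^sub>E {..<n} A \<in> sets (prod_law n M)"
      unfolding prod_law_def by (rule sets_PiM_I_finite) (use A' in auto)
    have "emeasure (density (prod_law n M) (\<lambda>x. ennreal (\<Prod>i<n. f (x i)))) (Pi\<^sub>E {..<n} A)
        = (\<integral>\<^sup>+x. ennreal (\<Prod>i<n. f (x i)) * indicator (Pi\<^sub>E {..<n} A) x \<partial>prod_law n M)"
      using meas ms by (intro emeasure_density) auto
    also have "\<dots> = (\<integral>\<^sup>+x. (\<Prod>i<n. ennreal (f (x i)) * indicator (A i) (x i)) \<partial>prod_law n M)"
    proof (rule nn_integral_cong)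
      fix x assume x: "x \<in> space (prod_law n M)"
      \<comment> \<open>Points of the product space are already extensional, so a point outside the
        rectangle has a coordinate outside its side, and one factor is 0.\<close>
      have "indicator (Pi\<^sub>E {..<n} A) x = (\<Prod>i<n. indicator (A i) (x i) :: ennreal)"
      proof (cases "x \<in> Pi\<^sub>E {..<n} A")
        case True then have "i < n \<Longrightarrow> x i \<in> A i" for i by (auto simp: PiE_iff)
        then show ?thesis using True by simp
      next
        case False
        have "x \<in> extensional {..<n}"
          using x unfolding prod_law_def space_PiM by (simp add: PiE_iff)
        then obtain i where i: "i \<in> {..<n}" "x i \<notin> A i"
          using False by (auto simp: PiE_iff)
        have "(\<Prod>i<n. indicator (A i) (x i) :: ennreal) = 0"
          by (rule prod_zero) (use i in \<open>auto intro!: bexI[of _ i]\<close>)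
        then show ?thesis using False by simp
      qed
      then show "ennreal (\<Prod>i<n. f (x i)) * indicator (Pi\<^sub>E {..<n} A) x
          = (\<Prod>i<n. ennreal (f (x i)) * indicator (A i) (x i))"
        by (simp add: e[OF x] prod.distrib)
    qed
    also have "\<dots> = (\<Prod>i<n. \<integral>\<^sup>+x. ennreal (f x) * indicator (A i) x \<partial>M)"
      unfolding prod_law_def by (rule product_nn_integral_prod) (use A' in auto)
    also have "\<dots> = (\<Prod>i<n. emeasure (density M f) (A i))"
      using A' by (auto simp: emeasure_density intro!: prod.cong)
    finally show "emeasure (density (prod_law n M) (\<lambda>x. ennreal (\<Prod>i<n. f (x i)))) (Pi\<^sub>E {..<n} A)
      = (\<Prod>i\<in>{..<n}. emeasure (density M f) (A i))" .
  qed simp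
  then show "prod_law n (density M f) = density (prod_law n M) (\<lambda>x. ennreal (\<Prod>i<n. f (x i)))"
    by (simp add: prod_law_def)
qed

text \<open>Each \<open>u (x i) * u (x j)\<close> is rewritten as a product over all coordinates
  with most factors equal to 1, so that its integral factorises. Off the diagonal one of the factors
  is the mean of \<open>u\<close>, which is 0.\<close>

lemma prod_law_integral_square:
  assumes P: "prob_space P" and u: "u \<in> L2 P" and z: "(\<integral>x. u x \<partial>P) = 0"
  shows "(\<integral>x. (\<Sum>i<n. u (x i))\<^sup>2 \<partial>prod_law n P) = real n * (\<integral>x. (u x)\<^sup>2 \<partial>P)"
    and "integrable (prod_law n P) (\<lambda>x. (\<Sum>i<n. u (x i))\<^sup>2)"
proof -
  interpret prob_space P by fact
  have sf: "sigma_finite_measure P" by (rule sigma_finite_measure_axioms)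
  have iu: "integrable P u" by (rule L2_integrable[OF u])
  have iu2: "integrable P (\<lambda>x. (u x)\<^sup>2)" by (rule L2_integrable_square[OF u])
  have diag: "(\<lambda>x. u (x i) * u (x i)) = (\<lambda>x. \<Prod>k<n. if k = i then (u (x k))\<^sup>2 else 1)"
    if "i < n" for i
    using that by (auto simp: fun_eq_iff power2_eq_square)
  have off: "(\<lambda>x. u (x i) * u (x j)) = (\<lambda>x. \<Prod>k<n. if k = i \<or> k = j then u (x k) else 1)"
    if "i < n" "j < n" "i \<noteq> j" for i j
  proof
    fix x
    have "(\<Prod>k<n. if k = i \<or> k = j then u (x k) else 1) = (\<Prod>k\<in>{i,j}. u (x k))"
      using that by (intro prod.mono_neutral_cong_right) auto
    then show "u (x i) * u (x j) = (\<Prod>k<n. if k = i \<or> k = j then u (x k) else 1)"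
      using that by simp
  qed
  have id: "integrable (prod_law n P) (\<lambda>x. u (x i) * u (x j))"
    and ii: "(\<integral>x. u (x i) * u (x j) \<partial>prod_law n P) = (if i = j then (\<integral>x. (u x)\<^sup>2 \<partial>P) else 0)"
    if ij: "i < n" "j < n" for i j
  proof -
    have "integrable (prod_law n P) (\<lambda>x. u (x i) * u (x j)) \<and>
      (\<integral>x. u (x i) * u (x j) \<partial>prod_law n P) = (if i = j then (\<integral>x. (u x)\<^sup>2 \<partial>P) else 0)"
    proof (cases "i = j")
      case True
      define g where "g k = (if k = i then (\<lambda>y. (u y)\<^sup>2) else (\<lambda>_. 1))" for k
      have eq: "(\<lambda>x. u (x i) * u (x j)) = (\<lambda>x. \<Prod>k<n. g k (x k))"
        unfolding True[symmetric] diag[OF ij(1)] by (intro ext prod.cong) (auto simp: g_def)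
      have ig: "integrable P (g k)" for k using iu2 by (simp add: g_def)
      have "(\<Prod>k<n. \<integral>x. g k x \<partial>P) = (\<Prod>k<n. if k = i then (\<integral>x. (u x)\<^sup>2 \<partial>P) else 1)"
        by (intro prod.cong) (auto simp: g_def prob_space)
      then show ?thesis
        unfolding eq using integral_prod_law_prod[OF sf, of n g] ig ij True by simp
    next
      case False
      define g where "g k = (if k = i \<or> k = j then u else (\<lambda>_. 1))" for k
      have eq: "(\<lambda>x. u (x i) * u (x j)) = (\<lambda>x. \<Prod>k<n. g k (x k))"
        unfolding off[OF ij False] by (intro ext prod.cong) (auto simp: g_def)
      have ig: "integrable P (g k)" for k using iu by (simp add: g_def)
      have "(\<Prod>k<n. \<integral>x. g k x \<partial>P) = 0"
        using ij z by (auto simp: g_def prod_zero_iff intro!: bexI[of _ i])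
      then show ?thesis
        unfolding eq using integral_prod_law_prod[OF sf, of n g] ig ij False by simp
    qed
    then show "integrable (prod_law n P) (\<lambda>x. u (x i) * u (x j))"
      "(\<integral>x. u (x i) * u (x j) \<partial>prod_law n P) = (if i = j then (\<integral>x. (u x)\<^sup>2 \<partial>P) else 0)" by auto
  qed
  have sq: "(\<lambda>x. (\<Sum>i<n. u (x i))\<^sup>2) = (\<lambda>x. \<Sum>i<n. \<Sum>j<n. u (x i) * u (x j))"
    by (simp add: power2_eq_square sum_product fun_eq_iff)
  show "integrable (prod_law n P) (\<lambda>x. (\<Sum>i<n. u (x i))\<^sup>2)"
    unfolding sq using id by (intro Bochner_Integration.integrable_sum) auto
  have "(\<integral>x. (\<Sum>i<n. u (x i))\<^sup>2 \<partial>prod_law n P) = (\<Sum>i<n. \<Sum>j<n. if i = j then (\<integral>x. (u x)\<^sup>2 \<partial>P) else 0)"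
    unfolding sq using id by (subst Bochner_Integration.integral_sum) (auto simp: ii Bochner_Integration.integral_sum
        intro!: Bochner_Integration.integrable_sum sum.cong)
  then show "(\<integral>x. (\<Sum>i<n. u (x i))\<^sup>2 \<partial>prod_law n P) = real n * (\<integral>x. (u x)\<^sup>2 \<partial>P)"
    by (simp add: sum.delta)
qed

lemma prod_law_Chebyshev:
  assumes P: "prob_space P" and u: "u \<in> L2 P" and z: "(\<integral>x. u x \<partial>P) = 0" and e: "0 < e" and n: "0 < n"
  shows "measure (prod_law n P) {x \<in> space (prod_law n P). e \<le> \<bar>(1 / sqrt (real n)) * (\<Sum>i<n. u (x i))\<bar>}
    \<le> (\<integral>x. (u x)\<^sup>2 \<partial>P) / e\<^sup>2"
proof -
  interpret PP: prob_space "prod_law n P" by (rule prob_space_prod_law[OF P])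
  let ?s = "\<lambda>x. ((1 / sqrt (real n)) * (\<Sum>i<n. u (x i)))\<^sup>2"
  have s: "?s = (\<lambda>x. (1 / real n) * (\<Sum>i<n. u (x i))\<^sup>2)"
    by (simp add: power_mult_distrib power_divide fun_eq_iff)
  have i: "integrable (prod_law n P) ?s" "(\<integral>x. ?s x \<partial>prod_law n P) = (\<integral>x. (u x)\<^sup>2 \<partial>P)"
    unfolding s using prod_law_integral_square[OF P u z, of n] n by auto
  have "e \<le> \<bar>y\<bar> \<longleftrightarrow> e\<^sup>2 \<le> y\<^sup>2" for y
    using e abs_le_square_iff[of e y] by simp
  then have "{x \<in> space (prod_law n P). e \<le> \<bar>(1 / sqrt (real n)) * (\<Sum>i<n. u (x i))\<bar>}
     = {x \<in> space (prod_law n P). e\<^sup>2 \<le> ?s x}"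
    by (simp only:)
  moreover have "measure (prod_law n P) {x \<in> space (prod_law n P). e\<^sup>2 \<le> ?s x} \<le> (\<integral>x. ?s x \<partial>prod_law n P) / e\<^sup>2"
    using i(1) e by (intro integral_Markov_inequality_measure[where A="{}"]) auto
  ultimately show ?thesis using i(2) by simp
qed

lemma sqrt_prod: "sqrt (\<Prod>i\<in>I. f i) = (\<Prod>i\<in>I. sqrt (f i))"
  by (induction I rule: infinite_finite_induct) (auto simp: real_sqrt_mult)

text \<open>Tensorisation is what reduces statements about samples of size n to statements about a
  single observation.\<close>

lemma affinity_prod:
  assumes M: "sigma_finite_measure M" and f: "is_density M f" and g: "is_density M g"
  shows "(\<integral>x. sqrt (\<Prod>i<n. f (x i)) * sqrt (\<Prod>i<n. g (x i)) \<partial>prod_law n M)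
    = (\<integral>x. sqrt (f x) * sqrt (g x) \<partial>M) ^ n"
proof -
  have "(\<integral>x. sqrt (\<Prod>i<n. f (x i)) * sqrt (\<Prod>i<n. g (x i)) \<partial>prod_law n M)
    = (\<integral>x. (\<Prod>i<n. sqrt (f (x i)) * sqrt (g (x i))) \<partial>prod_law n M)"
    by (simp add: sqrt_prod prod.distrib)
  also have "\<dots> = (\<Prod>i<n. \<integral>x. sqrt (f x) * sqrt (g x) \<partial>M)"
    using f g by (intro integral_prod_law_prod(1)[OF M] L2_integrable_mult is_densityD)
  finally show ?thesis by simp
qed

lemma affinity_eq:
  assumes f: "is_density M f" and g: "is_density M g"
  shows "(\<integral>x. (sqrt (f x) - sqrt (g x))\<^sup>2 \<partial>M) = 2 - 2 * (\<integral>x. sqrt (f x) * sqrt (g x) \<partial>M)"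
proof -
  note F = is_densityD[OF f] and G = is_densityD[OF g]
  have "(\<integral>x. (sqrt (f x) - sqrt (g x))\<^sup>2 \<partial>M)
     = (\<integral>x. ((sqrt (f x))\<^sup>2 + (sqrt (g x))\<^sup>2) - 2 * (sqrt (f x) * sqrt (g x)) \<partial>M)"
    by (simp add: power2_diff mult.assoc)
  also have "\<dots> = (\<integral>x. (sqrt (f x))\<^sup>2 \<partial>M) + (\<integral>x. (sqrt (g x))\<^sup>2 \<partial>M) - (\<integral>x. 2 * (sqrt (f x) * sqrt (g x)) \<partial>M)"
    using L2_integrable_square[OF F(4)] L2_integrable_square[OF G(4)] L2_integrable_mult[OF F(4) G(4)]
    by (subst Bochner_Integration.integral_diff) (auto intro!: Bochner_Integration.integral_add)
  finally show ?thesis using F G by simp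
qed

lemma affinity_bounds:
  assumes f: "is_density M f" and g: "is_density M g"
  shows "0 \<le> (\<integral>x. sqrt (f x) * sqrt (g x) \<partial>M)" "(\<integral>x. sqrt (f x) * sqrt (g x) \<partial>M) \<le> 1"
proof -
  show "0 \<le> (\<integral>x. sqrt (f x) * sqrt (g x) \<partial>M)"
    using is_densityD(2)[OF f] is_densityD(2)[OF g]
    by (intro Bochner_Integration.integral_nonneg) auto
  have "0 \<le> (\<integral>x. (sqrt (f x) - sqrt (g x))\<^sup>2 \<partial>M)"
    by (rule Bochner_Integration.integral_nonneg) auto
  then show "(\<integral>x. sqrt (f x) * sqrt (g x) \<partial>M) \<le> 1"
    using affinity_eq[OF f g] by simp
qed

text \<open>The difference of the densities factorises as (sqrt f - sqrt g)(sqrt f + sqrt g).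
  Cauchy-Schwarz leaves the Hellinger distance times the norm of the second factor, which is at most
  2 because both roots have norm 1.\<close>

lemma measure_density_le_Hellinger:
  assumes f: "is_density M f" and g: "is_density M g" and B: "B \<in> sets M"
  shows "measure (density M f) B \<le> measure (density M g) B + 2 * sqrt (\<integral>x. (sqrt (f x) - sqrt (g x))\<^sup>2 \<partial>M)"
proof -
  note F = is_densityD[OF f] and G = is_densityD[OF g]
  have me: "measure (density M h) B = (\<integral>x. h x * indicator B x \<partial>M)" if "is_density M h" for h
  proof -
    note H = is_densityD[OF that]
    interpret H: prob_space "density M h" by (rule H)
    have "measure (density M h) B = (\<integral>x. indicator B x \<partial>density M h)"
      using B by simp
    also have "\<dots> = (\<integral>x. h x *\<^sub>R indicator B x \<partial>M)"
      using H B by (intro integral_density) auto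
    finally show ?thesis by simp
  qed
  let ?d = "\<lambda>x. sqrt (f x) - sqrt (g x)" and ?s = "\<lambda>x. sqrt (f x) + sqrt (g x)"
  have d: "?d \<in> L2 M" and s: "?s \<in> L2 M" using F G by (auto intro: L2_diff L2_add)
  have i: "integrable M (\<lambda>x. h x * indicator B x)" if "integrable M h" for h :: "_ \<Rightarrow> real"
    using integrable_mult_indicator[OF B that] by (simp add: mult.commute)
  have "(\<integral>x. f x * indicator B x \<partial>M) - (\<integral>x. g x * indicator B x \<partial>M)
      = (\<integral>x. f x * indicator B x - g x * indicator B x \<partial>M)"
    using F G by (intro Bochner_Integration.integral_diff[symmetric] i) auto
  also have "\<dots> \<le> (\<integral>x. \<bar>?d x * ?s x\<bar> \<partial>M)"
  proof (rule integral_mono)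
    show "integrable M (\<lambda>x. f x * indicator B x - g x * indicator B x)"
      using F G by (intro Bochner_Integration.integrable_diff i) auto
    show "integrable M (\<lambda>x. \<bar>?d x * ?s x\<bar>)"
      using L2_integrable_mult[OF d s] by simp
    fix x assume "x \<in> space M"
    then have "?d x * ?s x = f x - g x"
      using F(2) G(2) by (simp add: algebra_simps)
    then show "f x * indicator B x - g x * indicator B x \<le> \<bar>?d x * ?s x\<bar>"
      by (auto simp: indicator_def)
  qed
  also have "\<dots> \<le> sqrt (\<integral>x. (?d x)\<^sup>2 \<partial>M) * sqrt (\<integral>x. (?s x)\<^sup>2 \<partial>M)"
    by (rule L2_Cauchy_Schwarz_abs[OF d s])
  also have "\<dots> \<le> sqrt (\<integral>x. (?d x)\<^sup>2 \<partial>M) * 2"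
  proof (rule mult_left_mono)
    have "(\<integral>x. (?s x)\<^sup>2 \<partial>M) \<le> 2 * (\<integral>x. (sqrt (f x))\<^sup>2 \<partial>M) + 2 * (\<integral>x. (sqrt (g x))\<^sup>2 \<partial>M)"
      using F G by (intro integral_square_add_le) auto
    then have "(\<integral>x. (?s x)\<^sup>2 \<partial>M) \<le> 2\<^sup>2" using F G by simp
    then show "sqrt (\<integral>x. (?s x)\<^sup>2 \<partial>M) \<le> 2" by (rule real_le_lsqrt[rotated]) simp
  qed simp
  finally show ?thesis by (simp add: me f g)
qed

text \<open>By Bernoulli's inequality 2 - 2 r^n \<le> n (2 - 2 r) for the affinity r of one
  observation: the squared Hellinger distance grows at most linearly in the sample size.\<close>

lemma prod_law_measure_le_Hellinger:
  assumes M: "sigma_finite_measure M" and f: "is_density M f" and g: "is_density M g"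
    and B: "B \<in> sets (prod_law n M)"
  shows "measure (prod_law n (density M f)) B
    \<le> measure (prod_law n (density M g)) B + 2 * sqrt (real n * (\<integral>x. (sqrt (f x) - sqrt (g x))\<^sup>2 \<partial>M))"
proof -
  let ?r = "\<integral>x. sqrt (f x) * sqrt (g x) \<partial>M"
  note r = affinity_bounds[OF f g]
  have "measure (prod_law n (density M f)) B \<le> measure (prod_law n (density M g)) B
     + 2 * sqrt (\<integral>x. (sqrt (\<Prod>i<n. f (x i)) - sqrt (\<Prod>i<n. g (x i)))\<^sup>2 \<partial>prod_law n M)"
    unfolding is_density_prod(2)[OF M f] is_density_prod(2)[OF M g]
    by (intro measure_density_le_Hellinger is_density_prod(1) M f g B)
  also have "(\<integral>x. (sqrt (\<Prod>i<n. f (x i)) - sqrt (\<Prod>i<n. g (x i)))\<^sup>2 \<partial>prod_law n M) = 2 - 2 * ?r ^ n"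
    by (simp only: affinity_eq[OF is_density_prod(1)[OF M f] is_density_prod(1)[OF M g]] affinity_prod[OF M f g])
  also have "2 - 2 * ?r ^ n \<le> real n * (2 - 2 * ?r)"
    using Bernoulli_inequality[of "?r - 1" n] r by (simp add: algebra_simps)
  also have "2 - 2 * ?r = (\<integral>x. (sqrt (f x) - sqrt (g x))\<^sup>2 \<partial>M)"
    by (rule affinity_eq[OF f g, symmetric])
  finally show ?thesis by simp
qed

section \<open>Exponential tilting\<close>

text \<open>The logarithm of the power is squeezed by (z - 1)/z \<le> ln z \<le> z - 1, both sides
  multiplied by n; the assumption also forces z to tend to 1.\<close>

lemma tendsto_power_exp:
  fixes z :: "nat \<Rightarrow> real"
  assumes "(\<lambda>n. real n * (z n - 1)) \<longlonglongrightarrow> w"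
  shows "(\<lambda>n. z n ^ n) \<longlonglongrightarrow> exp w"
proof -
  have inv: "(\<lambda>n. 1 / real n) \<longlonglongrightarrow> 0" by (rule lim_1_over_n)
  have "(\<lambda>n. real n * (z n - 1) * (1 / real n)) \<longlonglongrightarrow> w * 0"
    by (rule tendsto_mult[OF assms inv])
  moreover have "\<forall>\<^sub>F n in sequentially. real n * (z n - 1) * (1 / real n) = z n - 1"
    using eventually_gt_at_top[of 0] by eventually_elim auto
  ultimately have "(\<lambda>n. z n - 1) \<longlonglongrightarrow> 0"
    by (auto elim: Lim_transform_eventually)
  then have z1: "z \<longlonglongrightarrow> 1" by (simp add: LIM_zero_iff)
  then have pos: "\<forall>\<^sub>F n in sequentially. z n > 0" by (rule order_tendstoD) simp
  have "(\<lambda>n. real n * ln (z n)) \<longlonglongrightarrow> w"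
  proof (rule tendsto_sandwich[OF _ _ _ assms])
    show "\<forall>\<^sub>F n in sequentially. real n * ln (z n) \<le> real n * (z n - 1)"
      using pos by eventually_elim (auto intro!: mult_left_mono ln_le_minus_one)
    show "\<forall>\<^sub>F n in sequentially. real n * (z n - 1) / z n \<le> real n * ln (z n)"
      using pos
    proof eventually_elim
      case (elim n)
      have "ln (1 / z n) \<le> 1 / z n - 1" using elim by (intro ln_le_minus_one) simp
      then have "(z n - 1) / z n \<le> ln (z n)" using elim by (simp add: ln_div diff_divide_distrib)
      then show ?case by (metis mult_left_mono of_nat_0_le_iff times_divide_eq_right)
    qed
    show "(\<lambda>n. real n * (z n - 1) / z n) \<longlonglongrightarrow> w"
      using tendsto_divide[OF assms z1] by simp
  qed
  then have "(\<lambda>n. exp (real n * ln (z n))) \<longlonglongrightarrow> exp w" by (rule tendsto_exp)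
  moreover have "\<forall>\<^sub>F n in sequentially. exp (real n * ln (z n)) = z n ^ n"
    using pos by eventually_elim (simp add: exp_of_nat_mult)
  ultimately show ?thesis by (rule Lim_transform_eventually)
qed

text \<open>Lagrange's remainder has coefficient exp t / 6 with exp t \<le> exp 1 \<le> 3; the
  resulting 1/2 is rounded up to 1.\<close>

lemma exp_Taylor2_bound:
  fixes y :: real assumes "\<bar>y\<bar> \<le> 1" shows "\<bar>exp y - 1 - y - y\<^sup>2 / 2\<bar> \<le> \<bar>y\<bar> ^ 3"
proof -
  obtain t where t: "\<bar>t\<bar> \<le> \<bar>y\<bar>" "exp y = (\<Sum>m<3. y ^ m / fact m) + exp t / fact 3 * y ^ 3"
    using Maclaurin_exp_le[of y 3] by blast
  have "exp t \<le> exp 1" using t assms by simp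
  also have "\<dots> \<le> 3" by (rule exp_le)
  finally have "\<bar>exp t / 6 * y ^ 3\<bar> \<le> 1 * \<bar>y\<bar> ^ 3"
    unfolding abs_mult power_abs by (intro mult_right_mono) auto
  then show ?thesis using t by (simp add: eval_nat_numeral fact_numeral)
qed

lemma exp_Taylor1_bound:
  fixes y :: real assumes "\<bar>y\<bar> \<le> 1" shows "\<bar>exp y - 1 - y\<bar> \<le> 2 * y\<^sup>2"
proof -
  obtain t where t: "\<bar>t\<bar> \<le> \<bar>y\<bar>" "exp y = (\<Sum>m<2. y ^ m / fact m) + exp t / fact 2 * y ^ 2"
    using Maclaurin_exp_le[of y 2] by blast
  have "exp t \<le> exp 1" using t assms by simp
  also have "\<dots> \<le> 3" by (rule exp_le)
  finally have "\<bar>exp t / 2 * y ^ 2\<bar> \<le> 2 * \<bar>y\<bar> ^ 2"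
    unfolding abs_mult power_abs by (intro mult_right_mono) auto
  then show ?thesis using t by (simp add: eval_nat_numeral fact_numeral)
qed

text \<open>The truncation level is n^(1/4): it tends to infinity, so nothing is lost in L2, but it
  is of smaller order than sqrt n, so the exponents used in tilting tend to 0 uniformly. Subtracting
  the integral restores the mean zero that truncation destroys.\<close>

definition centred_trunc :: "'a measure \<Rightarrow> ('a \<Rightarrow> real) \<Rightarrow> nat \<Rightarrow> 'a \<Rightarrow> real" where
  "centred_trunc P f n x = (if \<bar>f x\<bar> \<le> sqrt (sqrt (real n)) then f x else 0)
     - (\<integral>y. (if \<bar>f y\<bar> \<le> sqrt (sqrt (real n)) then f y else 0) \<partial>P)"

text \<open>One function serves three purposes: at c = 1 it normalises the tilt, and together with
  the values at 2 and -1 it gives the second moment and the first inverse moment of the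
  tilt.\<close>

definition tilt_mgf :: "'a measure \<Rightarrow> ('a \<Rightarrow> real) \<Rightarrow> nat \<Rightarrow> real \<Rightarrow> real" where
  "tilt_mgf P f n c = (\<integral>x. exp (c * (centred_trunc P f n x / sqrt (real n))) \<partial>P)"

definition tilt :: "'a measure \<Rightarrow> ('a \<Rightarrow> real) \<Rightarrow> nat \<Rightarrow> 'a \<Rightarrow> real" where
  "tilt P f n x = exp (centred_trunc P f n x / sqrt (real n)) / tilt_mgf P f n 1"

context
  fixes P :: "'a measure" and f :: "'a \<Rightarrow> real"
  assumes P: "prob_space P" and f: "f \<in> L2 P" and f0: "(\<integral>x. f x \<partial>P) = 0"
begin

interpretation prob_space P by (rule P)

lemma trunc_L2_tendsto:
  "L2_tendsto P (\<lambda>n x. if \<bar>f x\<bar> \<le> sqrt (sqrt (real n)) then f x else 0) f" (is "L2_tendsto P ?t f")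
proof -
  note [measurable] = L2_measurable[OF f]
  have t: "?t n \<in> L2 P" for n
  proof -
    have "(\<lambda>x. (if \<bar>f x\<bar> \<le> sqrt (sqrt (real n)) then 1 else 0) * f x) \<in> L2 P"
      by (rule L2_bounded_mult[OF f, where c=1]) auto
    moreover have "(\<lambda>x. (if \<bar>f x\<bar> \<le> sqrt (sqrt (real n)) then 1 else 0) * f x) = ?t n" by auto
    ultimately show ?thesis by simp
  qed
  have "(\<lambda>n. \<integral>x. (?t n x - f x)\<^sup>2 \<partial>P) \<longlonglongrightarrow> (\<integral>x. 0 \<partial>P)"
  proof (rule integral_dominated_convergence[where w="\<lambda>x. (f x)\<^sup>2"])
    show "integrable P (\<lambda>x. (f x)\<^sup>2)" by (rule L2_integrable_square[OF f])
    have "(\<lambda>n. (?t n x - f x)\<^sup>2) \<longlonglongrightarrow> 0" for x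
    proof (rule tendsto_eventually)
      show "\<forall>\<^sub>F n in sequentially. (?t n x - f x)\<^sup>2 = 0"
        \<comment> \<open>As soon as n \<ge> (f x)^4 the truncation leaves \<open>f x\<close>
          unchanged.\<close>
        using eventually_ge_at_top[of "nat \<lceil>(\<bar>f x\<bar>\<^sup>2)\<^sup>2\<rceil>"]
      proof eventually_elim
        case (elim n)
        then have "(\<bar>f x\<bar>\<^sup>2)\<^sup>2 \<le> real n" by linarith
        then have "\<bar>f x\<bar> \<le> sqrt (sqrt (real n))" by (intro real_le_rsqrt)
        then show ?case by simp
      qed
    qed
    then show "AE x in P. (\<lambda>n. (?t n x - f x)\<^sup>2) \<longlonglongrightarrow> 0" by simp
  qed auto
  then show ?thesis using t f by (simp add: L2_tendsto_def)
qed

lemma centred_trunc_measurable [measurable]: "centred_trunc P f n \<in> borel_measurable P"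
  using L2_measurable[OF f] unfolding centred_trunc_def by measurable

lemma centred_trunc_bound: "\<bar>centred_trunc P f n x\<bar> \<le> 2 * sqrt (sqrt (real n))"
proof -
  note [measurable] = L2_measurable[OF f]
  have "\<bar>\<integral>y. (if \<bar>f y\<bar> \<le> sqrt (sqrt (real n)) then f y else 0) \<partial>P\<bar>
     \<le> (\<integral>y. \<bar>if \<bar>f y\<bar> \<le> sqrt (sqrt (real n)) then f y else 0\<bar> \<partial>P)"
    by (rule integral_abs_bound)
  also have "\<dots> \<le> (\<integral>y. sqrt (sqrt (real n)) \<partial>P)"
    by (intro integral_mono integrable_const_bound[where B="sqrt (sqrt (real n))"]) auto
  finally have "\<bar>\<integral>y. (if \<bar>f y\<bar> \<le> sqrt (sqrt (real n)) then f y else 0) \<partial>P\<bar> \<le> sqrt (sqrt (real n))"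
    by (simp add: prob_space)
  moreover have "\<bar>if \<bar>f x\<bar> \<le> sqrt (sqrt (real n)) then f x else 0\<bar> \<le> sqrt (sqrt (real n))" by simp
  ultimately show ?thesis unfolding centred_trunc_def by linarith
qed

lemma centred_trunc_L2_tendsto: "L2_tendsto P (centred_trunc P f) f"
proof -
  let ?m = "\<lambda>n. \<integral>y. (if \<bar>f y\<bar> \<le> sqrt (sqrt (real n)) then f y else 0) \<partial>P"
  have "?m \<longlonglongrightarrow> 0"
    using L2_tendsto_mult[OF trunc_L2_tendsto L2_tendsto_const[OF L2_const[of 1]]] f0
    by simp
  then have "(\<lambda>n. (?m n)\<^sup>2) \<longlonglongrightarrow> 0" using tendsto_power[of ?m 0 sequentially 2] by simp
  then have "L2_tendsto P (\<lambda>n x. ?m n) (\<lambda>_. 0)"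
    unfolding L2_tendsto_zero_iff by (simp add: L2_const prob_space)
  from L2_tendsto_diff[OF trunc_L2_tendsto this] show ?thesis
    by (simp add: centred_trunc_def[abs_def])
qed

lemma centred_trunc_L2: "centred_trunc P f n \<in> L2 P"
  by (rule L2_tendstoD[OF centred_trunc_L2_tendsto])

lemma centred_trunc_mean: "(\<integral>x. centred_trunc P f n x \<partial>P) = 0"
proof -
  note [measurable] = L2_measurable[OF f]
  show ?thesis
    unfolding centred_trunc_def
    by (subst Bochner_Integration.integral_diff)
      (auto simp: prob_space intro!: integrable_const_bound[where B="sqrt (sqrt (real n))"])
qed

lemma centred_trunc_scaled_bound:
  "\<bar>centred_trunc P f n x / sqrt (real n)\<bar> \<le> 2 / sqrt (sqrt (real n))"
proof (cases "n = 0")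
  case False
  have "\<bar>centred_trunc P f n x / sqrt (real n)\<bar> \<le> 2 * sqrt (sqrt (real n)) / sqrt (real n)"
    using centred_trunc_bound[of n x] by (simp add: abs_divide divide_right_mono)
  also have "\<dots> = 2 / sqrt (sqrt (real n))"
    using False by (simp add: field_simps)
  finally show ?thesis .
qed simp

lemma scaled_bound_tendsto: "(\<lambda>n. c * (2 / sqrt (sqrt (real n)))) \<longlonglongrightarrow> 0"
proof -
  have "filterlim (\<lambda>n. sqrt (sqrt (real n))) at_top sequentially"
    by (intro filterlim_compose[OF sqrt_at_top] filterlim_real_sequentially)
  then have "(\<lambda>n. 2 / sqrt (sqrt (real n))) \<longlonglongrightarrow> 0"
    by (intro tendsto_divide_0[OF tendsto_const] filterlim_at_top_imp_at_infinity)
  from tendsto_mult_right_zero[OF this] show ?thesis .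
qed

lemma exp_centred_trunc_integrable:
  "integrable P (\<lambda>x. exp (c * (centred_trunc P f n x / sqrt (real n))))"
proof (rule integrable_const_bound[where B="exp (\<bar>c\<bar> * (2 / sqrt (sqrt (real n))))"])
  have "c * (centred_trunc P f n x / sqrt (real n)) \<le> \<bar>c\<bar> * (2 / sqrt (sqrt (real n)))" for x
  proof -
    have "c * (centred_trunc P f n x / sqrt (real n)) \<le> \<bar>c\<bar> * \<bar>centred_trunc P f n x / sqrt (real n)\<bar>"
      by (metis abs_ge_self abs_mult)
    also have "\<dots> \<le> \<bar>c\<bar> * (2 / sqrt (sqrt (real n)))"
      by (intro mult_left_mono centred_trunc_scaled_bound) simp
    finally show ?thesis .
  qed
  then show "AE x in P. norm (exp (c * (centred_trunc P f n x / sqrt (real n)))) \<le> exp (\<bar>c\<bar> * (2 / sqrt (sqrt (real n))))"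
    by simp
qed measurable

text \<open>Jensen's inequality in the form exp u \<ge> 1 + u, whose linear part integrates to 0 by
  the centring.\<close>

lemma tilt_mgf_ge_1: "1 \<le> tilt_mgf P f n c"
proof -
  have i: "integrable P (\<lambda>x. c * (centred_trunc P f n x / sqrt (real n)))"
    using L2_integrable[OF centred_trunc_L2, of n] by auto
  have "1 = (\<integral>x. 1 + c * (centred_trunc P f n x / sqrt (real n)) \<partial>P)"
    using i by (subst Bochner_Integration.integral_add) (auto simp: prob_space centred_trunc_mean)
  also have "\<dots> \<le> tilt_mgf P f n c"
    unfolding tilt_mgf_def using i exp_centred_trunc_integrable
    by (intro integral_mono) auto
  finally show ?thesis .
qed

text \<open>In the second-order Taylor expansion the linear term vanishes by the centring and the
  quadratic term converges in mean. The cubic remainder is at most a vanishing uniform bound times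
  the quadratic term.\<close>

lemma tilt_mgf_expansion:
  "(\<lambda>n. real n * (tilt_mgf P f n c - 1)) \<longlonglongrightarrow> c\<^sup>2 * (\<integral>x. (f x)\<^sup>2 \<partial>P) / 2"
proof -
  define v where "v n x = centred_trunc P f n x / sqrt (real n)" for n x
  define s where "s n = (\<integral>x. (centred_trunc P f n x)\<^sup>2 \<partial>P)" for n
  have s: "s \<longlonglongrightarrow> (\<integral>x. (f x)\<^sup>2 \<partial>P)"
    unfolding s_def by (rule L2_tendsto_square[OF centred_trunc_L2_tendsto])
  \<comment> \<open>\<open>k n\<close> bounds the whole exponent uniformly in x; once it is at most
    1 the Taylor bound applies everywhere.\<close>
  define k where "k n = \<bar>c\<bar> * (2 / sqrt (sqrt (real n)))" for n
  have k: "k \<longlonglongrightarrow> 0" unfolding k_def by (rule scaled_bound_tendsto)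
  have ke: "\<forall>\<^sub>F n in sequentially. k n \<le> 1"
    using order_tendstoD(2)[OF k, of 1] by (auto elim: eventually_mono)
  have vL2: "v n \<in> L2 P" for n
    using L2_scale[OF centred_trunc_L2, of "1 / sqrt (real n)" n] by (simp add: v_def[abs_def])
  have "(\<lambda>n. real n * (tilt_mgf P f n c - 1) - c\<^sup>2 * s n / 2) \<longlonglongrightarrow> 0"
  proof (rule Lim_null_comparison)
    show "(\<lambda>n. k n * (c\<^sup>2 * s n)) \<longlonglongrightarrow> 0"
      using tendsto_mult[OF k tendsto_mult_left[OF s, of "c\<^sup>2"]] by simp
    show "\<forall>\<^sub>F n in sequentially. norm (real n * (tilt_mgf P f n c - 1) - c\<^sup>2 * s n / 2) \<le> k n * (c\<^sup>2 * s n)"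
      using ke eventually_gt_at_top[of 0]
    proof eventually_elim
      case (elim n)
      have nv: "real n * (v n x)\<^sup>2 = (centred_trunc P f n x)\<^sup>2" for x
        using elim by (simp add: v_def power_divide)
      have b: "\<bar>c * v n x\<bar> \<le> k n" for x
        unfolding k_def abs_mult v_def by (intro mult_left_mono centred_trunc_scaled_bound) simp
      have i1: "integrable P (\<lambda>x. exp (c * v n x))"
        using exp_centred_trunc_integrable by (simp add: v_def)
      have i2: "integrable P (\<lambda>x. c * v n x)" using L2_integrable[OF vL2] by simp
      have i3: "integrable P (\<lambda>x. (v n x)\<^sup>2)" by (rule L2_integrable_square[OF vL2])
      have m: "(\<integral>x. v n x \<partial>P) = 0" by (simp add: v_def centred_trunc_mean)
      have sn: "real n * (\<integral>x. (v n x)\<^sup>2 \<partial>P) = s n"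
        unfolding s_def nv[symmetric] by simp
      have eq: "(\<integral>x. exp (c * v n x) - 1 - c * v n x - (c * v n x)\<^sup>2 / 2 \<partial>P)
          = tilt_mgf P f n c - 1 - c\<^sup>2 * (\<integral>x. (v n x)\<^sup>2 \<partial>P) / 2"
      proof -
        have i4: "integrable P (\<lambda>x. (c * v n x)\<^sup>2 / 2)" using i3 by (simp add: power_mult_distrib)
        have "(\<integral>x. exp (c * v n x) - 1 - c * v n x - (c * v n x)\<^sup>2 / 2 \<partial>P)
          = (\<integral>x. exp (c * v n x) \<partial>P) - (\<integral>x. 1 \<partial>P) - (\<integral>x. c * v n x \<partial>P) - (\<integral>x. (c * v n x)\<^sup>2 / 2 \<partial>P)"
          using i1 i2 i4 by simp
        moreover have "(\<integral>x. exp (c * v n x) \<partial>P) = tilt_mgf P f n c" by (simp add: tilt_mgf_def v_def)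
        moreover have "(\<integral>x. c * v n x \<partial>P) = 0" using m by simp
        moreover have "(\<integral>x. (c * v n x)\<^sup>2 / 2 \<partial>P) = c\<^sup>2 * (\<integral>x. (v n x)\<^sup>2 \<partial>P) / 2"
          by (simp add: power_mult_distrib)
        ultimately show ?thesis by (simp add: prob_space)
      qed
      have "real n * (tilt_mgf P f n c - 1) - c\<^sup>2 * s n / 2
         = real n * (\<integral>x. exp (c * v n x) - 1 - c * v n x - (c * v n x)\<^sup>2 / 2 \<partial>P)"
        unfolding sn[symmetric] eq by (simp add: field_simps)
      also have "norm \<dots> \<le> real n * (\<integral>x. \<bar>exp (c * v n x) - 1 - c * v n x - (c * v n x)\<^sup>2 / 2\<bar> \<partial>P)"
        by (simp add: abs_mult mult_left_mono integral_abs_bound)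
      also have "\<dots> \<le> real n * (\<integral>x. k n * (c\<^sup>2 * (v n x)\<^sup>2) \<partial>P)"
      proof (intro mult_left_mono integral_mono)
        fix x
        have "\<bar>c * v n x\<bar> ^ 3 = \<bar>c * v n x\<bar> * (c\<^sup>2 * (v n x)\<^sup>2)"
          unfolding power_mult_distrib[symmetric] by (simp add: power3_eq_cube power2_eq_square)
        also have "\<dots> \<le> k n * (c\<^sup>2 * (v n x)\<^sup>2)" by (intro mult_right_mono b) simp
        finally show "\<bar>exp (c * v n x) - 1 - c * v n x - (c * v n x)\<^sup>2 / 2\<bar> \<le> k n * (c\<^sup>2 * (v n x)\<^sup>2)"
          using exp_Taylor2_bound[of "c * v n x"] b[of x] elim by linarith
      qed (use i1 i2 i3 in \<open>auto simp: power_mult_distrib\<close>)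
      also have "\<dots> = k n * (c\<^sup>2 * s n)" using i3 unfolding sn[symmetric] by (simp add: mult_ac)
      finally show ?case .
    qed
  qed
  from tendsto_add[OF this tendsto_divide[OF tendsto_mult_left[OF s, of "c\<^sup>2"] tendsto_const[of 2]]]
  show ?thesis by simp
qed

lemma tilt_mgf_power: "(\<lambda>n. tilt_mgf P f n c ^ n) \<longlonglongrightarrow> exp (c\<^sup>2 * (\<integral>x. (f x)\<^sup>2 \<partial>P) / 2)"
  by (rule tendsto_power_exp[OF tilt_mgf_expansion])

lemma tilt_pos: "0 < tilt P f n x"
  using tilt_mgf_ge_1[of n 1] by (simp add: tilt_def)

lemma tilt_measurable [measurable]: "tilt P f n \<in> borel_measurable P"
  unfolding tilt_def by measurable

lemma tilt_integrable: "integrable P (tilt P f n)"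
  using exp_centred_trunc_integrable[of 1 n] by (auto simp: tilt_def[abs_def])

lemma tilt_density: "is_density P (tilt P f n)"
proof -
  have "(\<integral>x. tilt P f n x \<partial>P) = 1"
    using tilt_mgf_ge_1[of n 1] by (simp add: tilt_def tilt_mgf_def)
  then have "(\<integral>\<^sup>+x. ennreal (tilt P f n x) \<partial>P) = 1"
    using tilt_integrable[of n] tilt_pos[of n] by (subst nn_integral_eq_integral) (auto intro: less_imp_le)
  then show ?thesis using tilt_pos[of n] by (auto simp: is_density_def intro: less_imp_le)
qed

lemma tilt_L2: "tilt P f n \<in> L2 P"
  and tilt_square: "(\<integral>x. (tilt P f n x)\<^sup>2 \<partial>P) = tilt_mgf P f n 2 / (tilt_mgf P f n 1)\<^sup>2"
  and tilt_inverse_integrable: "integrable P (\<lambda>x. 1 / tilt P f n x)"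
  and tilt_inverse: "(\<integral>x. 1 / tilt P f n x \<partial>P) = tilt_mgf P f n (-1) * tilt_mgf P f n 1"
proof -
  have e: "(tilt P f n x)\<^sup>2 = exp (2 * (centred_trunc P f n x / sqrt (real n))) / (tilt_mgf P f n 1)\<^sup>2" for x
    unfolding tilt_def power_divide exp_double by simp
  have e': "1 / tilt P f n x = exp ((-1) * (centred_trunc P f n x / sqrt (real n))) * tilt_mgf P f n 1" for x
    by (simp add: tilt_def exp_minus field_simps)
  show "tilt P f n \<in> L2 P"
    using exp_centred_trunc_integrable[of 2 n] by (simp add: L2_def e)
  show "(\<integral>x. (tilt P f n x)\<^sup>2 \<partial>P) = tilt_mgf P f n 2 / (tilt_mgf P f n 1)\<^sup>2"
    unfolding e by (simp add: tilt_mgf_def)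
  show "integrable P (\<lambda>x. 1 / tilt P f n x)"
    unfolding e' using exp_centred_trunc_integrable[of "-1" n] by (intro integrable_mult_left) simp
  show "(\<integral>x. 1 / tilt P f n x \<partial>P) = tilt_mgf P f n (-1) * tilt_mgf P f n 1"
    unfolding e' by (simp add: tilt_mgf_def)
qed

text \<open>The root of the tilt is \<open>r n * exp (v n x / 2)\<close>. The exponential
  contributes half of the truncated function, while the normaliser is 1 + O(1/n) and so disappears
  after multiplication by sqrt n.\<close>

lemma tilt_L2_derivative:
  "L2_tendsto P (\<lambda>n x. sqrt (real n) * (sqrt (tilt P f n x) - 1)) (\<lambda>x. 1/2 * f x)"
proof -
  define v where "v n x = centred_trunc P f n x / sqrt (real n)" for n x
  define K where "K n = tilt_mgf P f n 1" for n
  define k where "k n = 1 * (2 / sqrt (sqrt (real n)))" for n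
  have k: "k \<longlonglongrightarrow> 0" unfolding k_def by (rule scaled_bound_tendsto)
  have ke: "\<forall>\<^sub>F n in sequentially. k n \<le> 1"
    using order_tendstoD(2)[OF k, of 1] by (auto elim: eventually_mono)
  have K1: "1 \<le> K n" for n unfolding K_def by (rule tilt_mgf_ge_1)
  define r where "r n = 1 / sqrt (K n)" for n
  have r1: "0 < r n" "r n \<le> 1" for n using K1[of n] by (auto simp: r_def divide_le_eq)
  have sq: "sqrt (tilt P f n x) = r n * exp (v n x / 2)" for n x
  proof -
    have "sqrt (exp (v n x)) = exp (v n x / 2)"
      by (rule real_sqrt_unique) (auto simp: exp_double[symmetric] simp flip: exp_of_nat_mult)
    then show ?thesis by (simp add: tilt_def r_def K_def real_sqrt_divide v_def)
  qed
  \<comment> \<open>Since 1/K \<le> r \<le> 1, the deficit 1 - r is at most 1 - 1/K \<le> K - 1,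
    which is of order 1/n.\<close>
  have nr: "(\<lambda>n. sqrt (real n) * (1 - r n)) \<longlonglongrightarrow> 0"
  proof (rule Lim_null_comparison)
    have "(\<lambda>n. real n * (K n - 1) * (1 / sqrt (real n))) \<longlonglongrightarrow> (1\<^sup>2 * (\<integral>x. (f x)\<^sup>2 \<partial>P) / 2) * 0"
      unfolding K_def
      by (intro tendsto_mult tilt_mgf_expansion tendsto_divide_0[OF tendsto_const]
          filterlim_at_top_imp_at_infinity filterlim_compose[OF sqrt_at_top] filterlim_real_sequentially)
    then show "(\<lambda>n. real n * (K n - 1) * (1 / sqrt (real n))) \<longlonglongrightarrow> 0" by simp
    show "\<forall>\<^sub>F n in sequentially. norm (sqrt (real n) * (1 - r n)) \<le> real n * (K n - 1) * (1 / sqrt (real n))"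
    proof (rule always_eventually, rule allI)
      fix n
      have "1 / K n \<le> r n"
      proof -
        have "sqrt (K n) \<le> K n" using K1[of n] by (simp add: real_sqrt_le_iff' real_le_lsqrt power2_eq_square)
        then show ?thesis using K1[of n] unfolding r_def by (intro divide_left_mono) auto
      qed
      moreover have "1 - 1 / K n \<le> K n - 1"
      proof -
        have "1 - 1 / K n = (K n - 1) / K n" using K1[of n] by (simp add: field_simps)
        also have "\<dots> \<le> (K n - 1) / 1" using K1[of n] by (intro divide_left_mono) auto
        finally show ?thesis by simp
      qed
      ultimately have "1 - r n \<le> K n - 1" by linarith
      then have "sqrt (real n) * (1 - r n) \<le> sqrt (real n) * (K n - 1)" by (intro mult_left_mono) auto
      also have "\<dots> = real n * (K n - 1) * (1 / sqrt (real n))"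
        by (cases "n = 0") (auto simp: field_simps)
      finally show "norm (sqrt (real n) * (1 - r n)) \<le> real n * (K n - 1) * (1 / sqrt (real n))"
        using r1[of n] by simp
    qed
  qed
  have r0: "(\<lambda>n. 1 - r n) \<longlonglongrightarrow> 0"
  proof (rule Lim_null_comparison[OF _ nr])
    show "\<forall>\<^sub>F n in sequentially. norm (1 - r n) \<le> sqrt (real n) * (1 - r n)"
      using eventually_ge_at_top[of 1]
    proof eventually_elim
      case (elim n)
      then have "1 * (1 - r n) \<le> sqrt (real n) * (1 - r n)" using r1[of n] by (intro mult_right_mono) auto
      then show ?case using r1[of n] by simp
    qed
  qed
  define a where "a n = k n + (1 - r n)" for n
  define b where "b n = sqrt (real n) * (1 - r n)" for n
  have a0: "a \<longlonglongrightarrow> 0" unfolding a_def using tendsto_add[OF k r0] by simp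
  have b0: "b \<longlonglongrightarrow> 0" unfolding b_def by (rule nr)
  let ?U = "\<lambda>n x. sqrt (real n) * (sqrt (tilt P f n x) - 1)"
  have U: "?U n \<in> L2 P" for n
    using is_densityD(4)[OF tilt_density] by (intro L2_scale L2_diff L2_const) auto
  let ?c = "centred_trunc P f"
  \<comment> \<open>Three errors add up: the Taylor remainder of exp and the rescaling of the linear
    term by \<open>r n\<close>, both proportional to the truncated function and collected in
    \<open>a n\<close>, and the constant \<open>b n\<close> that the normaliser leaves
    behind.\<close>
  have pt: "\<bar>?U n x - 1/2 * ?c n x\<bar> \<le> \<bar>a n * ?c n x\<bar> + b n" if n: "k n \<le> 1" "n > 0" for n x
  proof -
    have vb: "\<bar>v n x\<bar> \<le> k n" unfolding v_def k_def using centred_trunc_scaled_bound[of n x] by simp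
    have sv: "sqrt (real n) * v n x = ?c n x" using n by (simp add: v_def)
    have "\<bar>sqrt (real n) * (exp (v n x / 2) - 1 - v n x / 2)\<bar> \<le> sqrt (real n) * (2 * (v n x / 2)\<^sup>2)"
      unfolding abs_mult using vb n by (simp add: exp_Taylor1_bound mult_left_mono)
    also have "\<dots> = \<bar>v n x\<bar> / 2 * \<bar>sqrt (real n) * v n x\<bar>"
      by (simp add: abs_mult power2_eq_square abs_mult_self_eq)
    also have "\<dots> \<le> k n * \<bar>?c n x\<bar>" unfolding sv using vb by (intro mult_right_mono) auto
    finally have e: "\<bar>sqrt (real n) * (exp (v n x / 2) - 1 - v n x / 2)\<bar> \<le> k n * \<bar>?c n x\<bar>" .
    have "?U n x - 1/2 * ?c n x = r n * (sqrt (real n) * (exp (v n x / 2) - 1 - v n x / 2))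
       - (1 - r n) * (?c n x / 2) - sqrt (real n) * (1 - r n)"
      unfolding sq sv[symmetric] by (simp add: field_simps)
    moreover have "\<bar>r n * (sqrt (real n) * (exp (v n x / 2) - 1 - v n x / 2))\<bar> \<le> 1 * (k n * \<bar>?c n x\<bar>)"
      unfolding abs_mult[of "r n"] using e r1[of n] by (intro mult_mono) auto
    moreover have "\<bar>(1 - r n) * (?c n x / 2)\<bar> \<le> (1 - r n) * \<bar>?c n x\<bar>"
      unfolding abs_mult using r1[of n] by (simp add: mult_left_mono)
    moreover have "\<bar>sqrt (real n) * (1 - r n)\<bar> = b n" using r1[of n] by (simp add: b_def)
    moreover have "\<bar>a n * ?c n x\<bar> = k n * \<bar>?c n x\<bar> + (1 - r n) * \<bar>?c n x\<bar>"
    proof -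
      have "0 \<le> a n" using r1[of n] by (simp add: a_def k_def)
      then have "\<bar>a n * ?c n x\<bar> = a n * \<bar>?c n x\<bar>" by (simp only: abs_mult abs_of_nonneg)
      then show ?thesis by (simp add: a_def distrib_right)
    qed
    ultimately show ?thesis by linarith
  qed
  have "L2_tendsto P (\<lambda>n x. ?U n x - 1/2 * ?c n x) (\<lambda>_. 0)"
    unfolding L2_tendsto_zero_iff
  proof (intro conjI allI)
    fix n show d: "(\<lambda>x. ?U n x - 1/2 * ?c n x) \<in> L2 P"
      by (intro L2_diff U L2_scale centred_trunc_L2)
  next
    have d: "(\<lambda>x. ?U n x - 1/2 * ?c n x) \<in> L2 P" for n
      by (intro L2_diff U L2_scale centred_trunc_L2)
    show "(\<lambda>n. \<integral>x. (?U n x - 1/2 * ?c n x)\<^sup>2 \<partial>P) \<longlonglongrightarrow> 0"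
    proof (rule Lim_null_comparison)
      show "(\<lambda>n. 2 * (a n)\<^sup>2 * (\<integral>x. (?c n x)\<^sup>2 \<partial>P) + 2 * (b n)\<^sup>2) \<longlonglongrightarrow> 0"
        using a0 b0 by (auto intro!: tendsto_eq_intros L2_tendsto_square[OF centred_trunc_L2_tendsto])
      show "\<forall>\<^sub>F n in sequentially. norm (\<integral>x. (?U n x - 1/2 * ?c n x)\<^sup>2 \<partial>P)
          \<le> 2 * (a n)\<^sup>2 * (\<integral>x. (?c n x)\<^sup>2 \<partial>P) + 2 * (b n)\<^sup>2"
        using ke eventually_gt_at_top[of 0]
      proof eventually_elim
        case (elim n)
        have "(\<integral>x. (?U n x - 1/2 * ?c n x)\<^sup>2 \<partial>P) \<le> (\<integral>x. 2 * (a n)\<^sup>2 * (?c n x)\<^sup>2 + 2 * (b n)\<^sup>2 \<partial>P)"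
        proof (rule integral_mono)
          show "integrable P (\<lambda>x. (?U n x - 1/2 * ?c n x)\<^sup>2)" by (rule L2_integrable_square[OF d])
          show "integrable P (\<lambda>x. 2 * (a n)\<^sup>2 * (?c n x)\<^sup>2 + 2 * (b n)\<^sup>2)"
            using L2_integrable_square[OF centred_trunc_L2] by simp
          fix x
          have "(?U n x - 1/2 * ?c n x)\<^sup>2 \<le> (\<bar>a n * ?c n x\<bar> + b n)\<^sup>2"
            using pt[OF elim, of x] by (metis abs_ge_zero power2_abs power_mono)
          also have "\<dots> \<le> 2 * \<bar>a n * ?c n x\<bar>\<^sup>2 + 2 * (b n)\<^sup>2" by (rule square_add_le)
          finally show "(?U n x - 1/2 * ?c n x)\<^sup>2 \<le> 2 * (a n)\<^sup>2 * (?c n x)\<^sup>2 + 2 * (b n)\<^sup>2"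
            by (simp add: power_mult_distrib)
        qed
        also have "\<dots> = 2 * (a n)\<^sup>2 * (\<integral>x. (?c n x)\<^sup>2 \<partial>P) + 2 * (b n)\<^sup>2"
          using L2_integrable_square[OF centred_trunc_L2] by (simp add: prob_space)
        finally show ?case by simp
      qed
    qed
  qed
  with L2_tendsto_scale[OF centred_trunc_L2_tendsto, of "1/2"] show ?thesis
    by (rule L2_tendsto_cong)
qed

end

section \<open>Contiguity of local alternatives\<close>

lemma measure_density_eq_integral:
  assumes "is_density M h" "B \<in> sets M"
  shows "measure (density M h) B = (\<integral>x. h x * indicator B x \<partial>M)"
    and "integrable M (\<lambda>x. h x * indicator B x)"
proof -
  note H = is_densityD[OF assms(1)]
  interpret H: prob_space "density M h" by (rule H)
  have "measure (density M h) B = (\<integral>x. indicator B x \<partial>density M h)"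
    using assms(2) by simp
  also have "\<dots> = (\<integral>x. h x *\<^sub>R indicator B x \<partial>M)"
    using H assms(2) by (intro integral_density) auto
  finally show "measure (density M h) B = (\<integral>x. h x * indicator B x \<partial>M)" by simp
  show "integrable M (\<lambda>x. h x * indicator B x)"
    using integrable_mult_indicator[OF assms(2) H(5)] by (simp add: mult.commute)
qed

text \<open>Cauchy-Schwarz applied to \<open>w\<close> and the indicator of B. A bounded second
  moment of the likelihood ratio thus gives contiguity with an explicit modulus.\<close>

lemma measure_density_le_second_moment:
  assumes P: "prob_space P" and w: "is_density P w" "w \<in> L2 P" and B: "B \<in> sets P"
  shows "measure (density P w) B \<le> sqrt (\<integral>x. (w x)\<^sup>2 \<partial>P) * sqrt (measure P B)"
proof -
  interpret prob_space P by fact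
  have s: "(\<lambda>x. (indicator B x)\<^sup>2) = (indicator B :: _ \<Rightarrow> real)" by (auto simp: indicator_def)
  have i: "indicator B \<in> L2 P" using B by (simp add: L2_def s integrable_real_indicator emeasure_eq_measure)
  have "(\<integral>x. (indicator B x)\<^sup>2 \<partial>P) = measure P B"
    using B unfolding s by simp
  then show ?thesis
    using L2_Cauchy_Schwarz[OF w(2) i] measure_density_eq_integral[OF w(1) B] by simp
qed

text \<open>The converse direction: the indicator of B is split into 1 / sqrt w and sqrt w times the
  indicator before Cauchy-Schwarz is applied.\<close>

lemma measure_le_density_inverse_moment:
  assumes P: "prob_space P" and w: "is_density P w" "\<And>x. x \<in> space P \<Longrightarrow> 0 < w x"
    and i: "integrable P (\<lambda>x. 1 / w x)" and B: "B \<in> sets P"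
  shows "measure P B \<le> sqrt (\<integral>x. 1 / w x \<partial>P) * sqrt (measure (density P w) B)"
proof -
  interpret prob_space P by fact
  note W = is_densityD[OF w(1)]
  have [measurable]: "w \<in> borel_measurable P" by (rule W)
  have sqi: "integrable P (\<lambda>x. (1 / sqrt (w x))\<^sup>2)" "(\<integral>x. (1 / sqrt (w x))\<^sup>2 \<partial>P) = (\<integral>x. 1 / w x \<partial>P)"
  proof -
    have e: "(1 / sqrt (w x))\<^sup>2 = 1 / w x" if "x \<in> space P" for x
      using w(2)[OF that] by (simp add: power_divide)
    show "integrable P (\<lambda>x. (1 / sqrt (w x))\<^sup>2)"
      using i e by (subst Bochner_Integration.integrable_cong[OF refl e]) auto
    show "(\<integral>x. (1 / sqrt (w x))\<^sup>2 \<partial>P) = (\<integral>x. 1 / w x \<partial>P)"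
      by (rule Bochner_Integration.integral_cong[OF refl e])
  qed
  then have l1: "(\<lambda>x. 1 / sqrt (w x)) \<in> L2 P" by (simp add: L2_def)
  have l2: "(\<lambda>x. indicator B x * sqrt (w x)) \<in> L2 P"
    by (rule L2_bounded_mult[OF W(4), where c=1]) (use B in \<open>auto simp: indicator_def\<close>)
  have e1: "(\<integral>x. 1 / sqrt (w x) * (indicator B x * sqrt (w x)) \<partial>P) = (\<integral>x. indicator B x \<partial>P)"
  proof (rule Bochner_Integration.integral_cong[OF refl])
    fix x assume "x \<in> space P"
    from w(2)[OF this] show "1 / sqrt (w x) * (indicator B x * sqrt (w x)) = indicator B x" by simp
  qed
  have e2: "(\<integral>x. (indicator B x * sqrt (w x))\<^sup>2 \<partial>P) = measure (density P w) B"
    unfolding measure_density_eq_integral(1)[OF w(1) B]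
  proof (rule Bochner_Integration.integral_cong[OF refl])
    fix x assume "x \<in> space P"
    from w(2)[OF this] show "(indicator B x * sqrt (w x))\<^sup>2 = w x * indicator B x"
      by (auto simp: indicator_def)
  qed
  have "measure P B = (\<integral>x. 1 / sqrt (w x) * (indicator B x * sqrt (w x)) \<partial>P)"
    unfolding e1 using B by simp
  then show ?thesis
    using L2_Cauchy_Schwarz[OF l1 l2] unfolding e2 sqi(2) by linarith
qed

lemma L2_tendsto_density:
  assumes p: "is_density M p" and U: "L2_tendsto (density M p) U u"
  shows "L2_tendsto M (\<lambda>n x. U n x * sqrt (p x)) (\<lambda>x. u x * sqrt (p x))"
proof -
  note U' = L2_tendstoD[OF U]
  have m: "U n \<in> borel_measurable M" "u \<in> borel_measurable M" for n
    using U'(1)[of n] U'(2) L2_density_iff[OF p] by auto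
  have "(\<integral>x. (U n x - u x)\<^sup>2 \<partial>density M p) = (\<integral>x. (U n x * sqrt (p x) - u x * sqrt (p x))\<^sup>2 \<partial>M)" for n
    using integral_density_square[OF p, of "\<lambda>x. U n x - u x"] m by (simp add: algebra_simps)
  then show ?thesis
    using U' L2_density_iff[OF p] by (auto simp: L2_tendsto_def)
qed

text \<open>The order of the arguments matters: smallness passes from the second sequence to the
  first. The two sequences live on common sigma-algebras wherever this is applied, so that
  \<open>measure\<close> never meets its default value on a nonmeasurable set.\<close>

definition contiguous :: "(nat \<Rightarrow> 's measure) \<Rightarrow> (nat \<Rightarrow> 's measure) \<Rightarrow> bool" where
  "contiguous Q P \<longleftrightarrow> (\<forall>B. (\<forall>n. B n \<in> sets (P n)) \<longrightarrow> (\<lambda>n. measure (P n) (B n)) \<longlonglongrightarrow> 0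
     \<longrightarrow> (\<lambda>n. measure (Q n) (B n)) \<longlonglongrightarrow> 0)"

lemma contiguousD:
  "contiguous Q P \<Longrightarrow> (\<And>n. B n \<in> sets (P n)) \<Longrightarrow> (\<lambda>n. measure (P n) (B n)) \<longlonglongrightarrow> 0
     \<Longrightarrow> (\<lambda>n. measure (Q n) (B n)) \<longlonglongrightarrow> 0"
  unfolding contiguous_def by blast

lemma contiguous_trans:
  assumes "contiguous R Q" "contiguous Q P" "\<And>n. sets (Q n) = sets (P n)"
  shows "contiguous R P"
  using assms unfolding contiguous_def by metis

definition tilted :: "'a measure \<Rightarrow> ('a \<Rightarrow> real) \<Rightarrow> ('a \<Rightarrow> real) \<Rightarrow> nat \<Rightarrow> 'a \<Rightarrow> real" where
  "tilted M p f n x = p x * tilt (density M p) f n x"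

context
  fixes M :: "'a measure" and p0 f :: "'a \<Rightarrow> real"
  assumes M: "sigma_finite_measure M" and p0: "is_density M p0"
    and f: "f \<in> L2 (density M p0)" and f0: "(\<integral>x. f x \<partial>density M p0) = 0"
begin

private abbreviation "P0 \<equiv> density M p0"

private lemma prob_P0: "prob_space P0" by (rule is_densityD[OF p0])

private lemma sf_P0: "sigma_finite_measure P0"
proof -
  interpret prob_space P0 by (rule prob_P0)
  show ?thesis by (rule sigma_finite_measure_axioms)
qed

lemma density_tilted: "density M (tilted M p0 f n) = density P0 (tilt P0 f n)"
proof -
  have [measurable]: "p0 \<in> borel_measurable M" by (rule is_densityD[OF p0])
  have [measurable]: "tilt P0 f n \<in> borel_measurable M"
    using tilt_measurable[OF prob_P0 f f0] by simp
  have "density P0 (tilt P0 f n) = density M (\<lambda>x. ennreal (p0 x) * ennreal (tilt P0 f n x))"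
    by (subst density_density_eq) auto
  also have "\<dots> = density M (tilted M p0 f n)"
    using is_densityD(2)[OF p0] tilt_pos[OF prob_P0 f f0]
    by (intro density_cong) (auto simp: tilted_def ennreal_mult less_imp_le)
  finally show ?thesis by simp
qed

lemma tilted_density: "is_density M (tilted M p0 f n)"
proof -
  have [measurable]: "p0 \<in> borel_measurable M" by (rule is_densityD[OF p0])
  have [measurable]: "tilt P0 f n \<in> borel_measurable M"
    using tilt_measurable[OF prob_P0 f f0] by simp
  have m[measurable]: "tilted M p0 f n \<in> borel_measurable M"
    unfolding tilted_def by measurable
  have nn: "0 \<le> tilted M p0 f n x" if "x \<in> space M" for x
    using is_densityD(2)[OF p0 that] tilt_pos[OF prob_P0 f f0, of n x] by (simp add: tilted_def)
  interpret T: prob_space "density P0 (tilt P0 f n)"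
    by (rule is_densityD(3)[OF tilt_density[OF prob_P0 f f0]])
  have "(\<integral>\<^sup>+x. ennreal (tilted M p0 f n x) \<partial>M) = emeasure (density M (tilted M p0 f n)) (space M)"
    by (subst emeasure_density) (auto intro!: nn_integral_cong)
  also have "\<dots> = 1" unfolding density_tilted using T.emeasure_space_1 by simp
  finally show ?thesis using m nn by (simp add: is_density_def)
qed

lemma tilted_L2_derivative:
  "L2_tendsto M (\<lambda>n x. sqrt (real n) * (sqrt (tilted M p0 f n x) - sqrt (p0 x))) (\<lambda>x. 1/2 * f x * sqrt (p0 x))"
proof -
  have "(\<lambda>x. sqrt (real n) * (sqrt (tilt P0 f n x) - 1) * sqrt (p0 x))
      = (\<lambda>x. sqrt (real n) * (sqrt (tilted M p0 f n x) - sqrt (p0 x)))" for n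
    by (simp add: tilted_def fun_eq_iff real_sqrt_mult algebra_simps)
  with L2_tendsto_density[OF p0 tilt_L2_derivative[OF prob_P0 f f0]] show ?thesis by simp
qed

text \<open>Second and inverse moments of the product likelihood ratio are n-th powers. With S the
  second moment of \<open>f\<close>, both converge to exp S: the first as exp (2 S) / exp S, the
  second as exp (S/2) * exp (S/2). Bounded moments then give contiguity in both directions.\<close>

lemma tilted_contiguous:
  "contiguous (\<lambda>n. prod_law n (density M (tilted M p0 f n))) (\<lambda>n. prod_law n P0)"
  "contiguous (\<lambda>n. prod_law n P0) (\<lambda>n. prod_law n (density M (tilted M p0 f n)))"
proof -
  let ?t = "\<lambda>n. tilt P0 f n" and ?S = "\<integral>x. (f x)\<^sup>2 \<partial>P0"
  note td = tilt_density[OF prob_P0 f f0] and tp = tilt_pos[OF prob_P0 f f0]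
  note mg = tilt_mgf_power[OF prob_P0 f f0]
  have eq: "prod_law n (density M (tilted M p0 f n)) = density (prod_law n P0) (\<lambda>x. ennreal (\<Prod>i<n. ?t n (x i)))" for n
    unfolding density_tilted by (rule is_density_prod(2)[OF sf_P0 td])
  have dp: "is_density (prod_law n P0) (\<lambda>x. \<Prod>i<n. ?t n (x i))" for n
    by (rule is_density_prod(1)[OF sf_P0 td])
  have sq: "(\<lambda>x. \<Prod>i<n. ?t n (x i)) \<in> L2 (prod_law n P0)"
     "(\<integral>x. (\<Prod>i<n. ?t n (x i))\<^sup>2 \<partial>prod_law n P0) = (tilt_mgf P0 f n 2 / (tilt_mgf P0 f n 1)\<^sup>2) ^ n" for n
  proof -
    note * = integral_prod_law_prod[OF sf_P0, of n "\<lambda>_ x. (?t n x)\<^sup>2", OF L2_integrable_square[OF tilt_L2[OF prob_P0 f f0]]]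
    show "(\<lambda>x. \<Prod>i<n. ?t n (x i)) \<in> L2 (prod_law n P0)"
      using *(2) is_densityD(1)[OF dp] by (simp add: L2_def prod_power_distrib)
    show "(\<integral>x. (\<Prod>i<n. ?t n (x i))\<^sup>2 \<partial>prod_law n P0) = (tilt_mgf P0 f n 2 / (tilt_mgf P0 f n 1)\<^sup>2) ^ n"
      using *(1) by (simp add: prod_power_distrib tilt_square[OF prob_P0 f f0])
  qed
  have inv: "integrable (prod_law n P0) (\<lambda>x. 1 / (\<Prod>i<n. ?t n (x i)))"
     "(\<integral>x. 1 / (\<Prod>i<n. ?t n (x i)) \<partial>prod_law n P0) = (tilt_mgf P0 f n (-1) * tilt_mgf P0 f n 1) ^ n" for n
  proof -
    note * = integral_prod_law_prod[OF sf_P0, of n "\<lambda>_ x. 1 / ?t n x", OF tilt_inverse_integrable[OF prob_P0 f f0]]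
    have e: "(\<lambda>x. 1 / (\<Prod>i<n. ?t n (x i))) = (\<lambda>x. \<Prod>i<n. 1 / ?t n (x i))"
      by (simp add: prod_dividef)
    show "integrable (prod_law n P0) (\<lambda>x. 1 / (\<Prod>i<n. ?t n (x i)))" unfolding e by (rule *(2))
    show "(\<integral>x. 1 / (\<Prod>i<n. ?t n (x i)) \<partial>prod_law n P0) = (tilt_mgf P0 f n (-1) * tilt_mgf P0 f n 1) ^ n"
      unfolding e *(1) by (simp add: tilt_inverse[OF prob_P0 f f0])
  qed
  have l1: "(\<lambda>n. (tilt_mgf P0 f n 2 / (tilt_mgf P0 f n 1)\<^sup>2) ^ n) \<longlonglongrightarrow> exp (2\<^sup>2 * ?S / 2) / (exp (1\<^sup>2 * ?S / 2))\<^sup>2"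
  proof -
    have "(\<lambda>n. tilt_mgf P0 f n 2 ^ n / (tilt_mgf P0 f n 1 ^ n)\<^sup>2) \<longlonglongrightarrow> exp (2\<^sup>2 * ?S / 2) / (exp (1\<^sup>2 * ?S / 2))\<^sup>2"
      by (intro tendsto_divide tendsto_power mg) simp
    then show ?thesis by (simp add: power_divide power_mult[symmetric] mult.commute)
  qed
  have l2: "(\<lambda>n. (tilt_mgf P0 f n (-1) * tilt_mgf P0 f n 1) ^ n) \<longlonglongrightarrow> exp ((-1)\<^sup>2 * ?S / 2) * exp (1\<^sup>2 * ?S / 2)"
    unfolding power_mult_distrib by (intro tendsto_mult mg)
  have prob: "prob_space (prod_law n P0)" for n by (rule prob_space_prod_law[OF prob_P0])
  show "contiguous (\<lambda>n. prod_law n (density M (tilted M p0 f n))) (\<lambda>n. prod_law n P0)"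
    unfolding contiguous_def
  proof (intro allI impI)
    fix B assume B: "\<forall>n. B n \<in> sets (prod_law n P0)" and B0: "(\<lambda>n. measure (prod_law n P0) (B n)) \<longlonglongrightarrow> 0"
    show "(\<lambda>n. measure (prod_law n (density M (tilted M p0 f n))) (B n)) \<longlonglongrightarrow> 0"
    proof (rule Lim_null_comparison)
      show "\<forall>\<^sub>F n in sequentially. norm (measure (prod_law n (density M (tilted M p0 f n))) (B n))
         \<le> sqrt ((tilt_mgf P0 f n 2 / (tilt_mgf P0 f n 1)\<^sup>2) ^ n) * sqrt (measure (prod_law n P0) (B n))"
        unfolding eq sq(2)[symmetric] real_norm_def abs_of_nonneg[OF measure_nonneg]
        by (intro always_eventually allI measure_density_le_second_moment prob dp sq(1)) (use B in blast)
      show "(\<lambda>n. sqrt ((tilt_mgf P0 f n 2 / (tilt_mgf P0 f n 1)\<^sup>2) ^ n) * sqrt (measure (prod_law n P0) (B n))) \<longlonglongrightarrow> 0"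
        using tendsto_mult[OF tendsto_real_sqrt[OF l1] tendsto_real_sqrt[OF B0]] by simp
    qed
  qed
  show "contiguous (\<lambda>n. prod_law n P0) (\<lambda>n. prod_law n (density M (tilted M p0 f n)))"
    unfolding contiguous_def
  proof (intro allI impI)
    fix B assume B: "\<forall>n. B n \<in> sets (prod_law n (density M (tilted M p0 f n)))"
      and B0: "(\<lambda>n. measure (prod_law n (density M (tilted M p0 f n))) (B n)) \<longlonglongrightarrow> 0"
    have B': "B n \<in> sets (prod_law n P0)" for n
      using B sets_prod_law_cong[of "density M (tilted M p0 f n)" P0 n] by auto
    show "(\<lambda>n. measure (prod_law n P0) (B n)) \<longlonglongrightarrow> 0"
    proof (rule Lim_null_comparison)
      show "\<forall>\<^sub>F n in sequentially. norm (measure (prod_law n P0) (B n))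
         \<le> sqrt ((tilt_mgf P0 f n (-1) * tilt_mgf P0 f n 1) ^ n) * sqrt (measure (prod_law n (density M (tilted M p0 f n))) (B n))"
        unfolding eq inv(2)[symmetric] real_norm_def abs_of_nonneg[OF measure_nonneg]
        by (intro always_eventually allI measure_le_density_inverse_moment prob dp inv(1) prod_pos ballI tp B')
      show "(\<lambda>n. sqrt ((tilt_mgf P0 f n (-1) * tilt_mgf P0 f n 1) ^ n) * sqrt (measure (prod_law n (density M (tilted M p0 f n))) (B n))) \<longlonglongrightarrow> 0"
        using tendsto_mult[OF tendsto_real_sqrt[OF l2] tendsto_real_sqrt[OF B0]] by simp
    qed
  qed
qed

text \<open>Under this rate the product measures of any events differ by a vanishing amount, which
  is more than contiguity demands.\<close>

lemma Hellinger_close_contiguous: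
  assumes q: "\<And>n. is_density M (q n)" and r: "\<And>n. is_density M (r n)"
    and l: "(\<lambda>n. real n * (\<integral>x. (sqrt (q n x) - sqrt (r n x))\<^sup>2 \<partial>M)) \<longlonglongrightarrow> 0"
  shows "contiguous (\<lambda>n. prod_law n (density M (q n))) (\<lambda>n. prod_law n (density M (r n)))"
  unfolding contiguous_def
proof (intro allI impI)
  fix B assume B: "\<forall>n. B n \<in> sets (prod_law n (density M (r n)))"
    and B0: "(\<lambda>n. measure (prod_law n (density M (r n))) (B n)) \<longlonglongrightarrow> 0"
  have B': "B n \<in> sets (prod_law n M)" for n
    using B sets_prod_law_cong[of "density M (r n)" M n] by auto
  show "(\<lambda>n. measure (prod_law n (density M (q n))) (B n)) \<longlonglongrightarrow> 0"
  proof (rule Lim_null_comparison)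
    show "\<forall>\<^sub>F n in sequentially. norm (measure (prod_law n (density M (q n))) (B n))
      \<le> measure (prod_law n (density M (r n))) (B n) + 2 * sqrt (real n * (\<integral>x. (sqrt (q n x) - sqrt (r n x))\<^sup>2 \<partial>M))"
      using prod_law_measure_le_Hellinger[OF M q r B'] by simp
    show "(\<lambda>n. measure (prod_law n (density M (r n))) (B n) + 2 * sqrt (real n * (\<integral>x. (sqrt (q n x) - sqrt (r n x))\<^sup>2 \<partial>M))) \<longlonglongrightarrow> 0"
      using tendsto_add[OF B0 tendsto_mult_left[OF tendsto_real_sqrt[OF l], of 2]] by simp
  qed
qed

text \<open>Two sequences with the same L2 derivative are at Hellinger distance of smaller order
  than n^(-1/2). An arbitrary local alternative may therefore be exchanged for the tilted law in the
  same direction, where contiguity is explicit.\<close>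

lemma local_alternatives_contiguous:
  assumes q: "\<And>n. is_density M (q n)"
    and d: "L2_tendsto M (\<lambda>n x. sqrt (real n) * (sqrt (q n x) - sqrt (p0 x))) (\<lambda>x. 1/2 * f x * sqrt (p0 x))"
  shows "contiguous (\<lambda>n. prod_law n (density M (q n))) (\<lambda>n. prod_law n P0)"
    and "contiguous (\<lambda>n. prod_law n P0) (\<lambda>n. prod_law n (density M (q n)))"
proof -
  let ?s = "tilted M p0 f"
  have "L2_tendsto M (\<lambda>n x. sqrt (real n) * (sqrt (q n x) - sqrt (?s n x))) (\<lambda>_. 0)"
    using L2_tendsto_diff[OF d tilted_L2_derivative] by (simp add: algebra_simps)
  then have "(\<lambda>n. \<integral>x. (sqrt (real n) * (sqrt (q n x) - sqrt (?s n x)))\<^sup>2 \<partial>M) \<longlonglongrightarrow> 0"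
    by (simp add: L2_tendsto_zero_iff)
  then have l: "(\<lambda>n. real n * (\<integral>x. (sqrt (q n x) - sqrt (?s n x))\<^sup>2 \<partial>M)) \<longlonglongrightarrow> 0"
    by (simp add: power_mult_distrib)
  then have l': "(\<lambda>n. real n * (\<integral>x. (sqrt (?s n x) - sqrt (q n x))\<^sup>2 \<partial>M)) \<longlonglongrightarrow> 0"
    by (simp add: power2_commute)
  show "contiguous (\<lambda>n. prod_law n (density M (q n))) (\<lambda>n. prod_law n P0)"
    by (rule contiguous_trans[OF Hellinger_close_contiguous[OF q tilted_density l] tilted_contiguous(1)])
      (simp cong: sets_prod_law_cong add: sets_prod_law_cong[of "density M (?s _)" P0])
  show "contiguous (\<lambda>n. prod_law n P0) (\<lambda>n. prod_law n (density M (q n)))"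
    by (rule contiguous_trans[OF tilted_contiguous(2) Hellinger_close_contiguous[OF tilted_density q l']])
      (rule sets_prod_law_cong, simp)
qed

end

text \<open>Root densities are unit vectors, and the derivative along a curve of unit vectors is
  orthogonal to the base point. Quantitatively, the inner product of the difference quotient with
  \<open>sqrt p0\<close> equals minus its squared norm divided by 2 sqrt n.\<close>

lemma dqm_mean_zero:
  assumes p0: "is_density M p0" and q: "\<And>n. is_density M (q n)" and f: "f \<in> borel_measurable M"
    and d: "L2_tendsto M (\<lambda>n x. sqrt (real n) * (sqrt (q n x) - sqrt (p0 x))) (\<lambda>x. 1/2 * f x * sqrt (p0 x))"
  shows "(\<integral>x. f x \<partial>density M p0) = 0"
proof -
  let ?w = "\<lambda>n x. sqrt (real n) * (sqrt (q n x) - sqrt (p0 x))"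
  let ?r = "\<lambda>n. \<integral>x. sqrt (q n x) * sqrt (p0 x) \<partial>M"
  have a: "(\<lambda>n. \<integral>x. ?w n x * sqrt (p0 x) \<partial>M) \<longlonglongrightarrow> (\<integral>x. 1/2 * f x * sqrt (p0 x) * sqrt (p0 x) \<partial>M)"
    by (rule L2_tendsto_mult[OF d L2_tendsto_const]) (rule is_densityD[OF p0])
  have b: "(\<lambda>n. - (1/2) * (1 / sqrt (real n)) * (\<integral>x. (?w n x)\<^sup>2 \<partial>M)) \<longlonglongrightarrow> - (1/2) * 0 * (\<integral>x. (1/2 * f x * sqrt (p0 x))\<^sup>2 \<partial>M)"
    by (intro tendsto_mult L2_tendsto_square[OF d] tendsto_const tendsto_divide_0[OF tendsto_const]
          filterlim_at_top_imp_at_infinity filterlim_compose[OF sqrt_at_top] filterlim_real_sequentially)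
  have "- (1/2) * (1 / sqrt (real n)) * (\<integral>x. (?w n x)\<^sup>2 \<partial>M) = (\<integral>x. ?w n x * sqrt (p0 x) \<partial>M)" for n
  proof (cases "n = 0")
    case False
    have "(\<integral>x. (?w n x)\<^sup>2 \<partial>M) = real n * (2 - 2 * ?r n)"
      by (simp add: power_mult_distrib affinity_eq[OF q p0])
    moreover have "(\<integral>x. ?w n x * sqrt (p0 x) \<partial>M) = sqrt (real n) * (?r n - 1)"
    proof -
      have "(\<integral>x. ?w n x * sqrt (p0 x) \<partial>M) = (\<integral>x. sqrt (real n) * (sqrt (q n x) * sqrt (p0 x) - (sqrt (p0 x))\<^sup>2) \<partial>M)"
        by (simp add: algebra_simps power2_eq_square)
      also have "\<dots> = sqrt (real n) * (?r n - 1)"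
        using is_densityD[OF p0] is_densityD[OF q] L2_integrable_mult[OF is_densityD(4)[OF q] is_densityD(4)[OF p0]]
          L2_integrable_square[OF is_densityD(4)[OF p0]]
        by simp
      finally show ?thesis .
    qed
    moreover have "- (1/2) * (1 / s) * (s * s * (2 - 2 * r)) = s * (r - 1)" if "s \<noteq> 0" for s r :: real
      using that by (simp add: field_simps)
    from this[of "sqrt (real n)" "?r n"]
    have "- (1/2) * (1 / sqrt (real n)) * (real n * (2 - 2 * ?r n)) = sqrt (real n) * (?r n - 1)"
      using False by simp
    ultimately show ?thesis by metis
  qed simp
  with b have "(\<lambda>n. \<integral>x. ?w n x * sqrt (p0 x) \<partial>M) \<longlonglongrightarrow> 0" by simp
  from LIMSEQ_unique[OF a this] have "(\<integral>x. (1/2 * f x * sqrt (p0 x)) * sqrt (p0 x) \<partial>M) = 0" .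
  then show ?thesis unfolding integral_density_sqrt[OF p0 f] by (simp add: mult.assoc)
qed

section \<open>Expansion of the log-likelihood ratio and differentiability in quadratic mean\<close>

text \<open>The outer measure of an exceptional set is attained by a measurable superset. From here
  on the exceptional sets can be fed into contiguity, which is about measurable events.\<close>

lemma oP1_measurable_cover:
  assumes "oP1 P Y" "0 < e"
  obtains E where "\<And>n. E n \<in> sets (P n)"
    "\<And>n x. x \<in> space (P n) \<Longrightarrow> x \<notin> E n \<Longrightarrow> \<bar>Y n x\<bar> \<le> ereal e"
    "(\<lambda>n. emeasure (P n) (E n)) \<longlonglongrightarrow> 0"
proof -
  let ?A = "\<lambda>n. {x \<in> space (P n). ereal e < \<bar>Y n x\<bar>}"
  have "\<forall>n. \<exists>E\<in>sets (P n). ?A n \<subseteq> E \<and> outer_measure_of (P n) (?A n) = emeasure (P n) E"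
    by (intro allI outer_measure_of_attain) auto
  then obtain E where E: "\<And>n. E n \<in> sets (P n)" "\<And>n. ?A n \<subseteq> E n"
     "\<And>n. outer_measure_of (P n) (?A n) = emeasure (P n) (E n)" by metis
  show ?thesis
  proof (rule that)
    show "E n \<in> sets (P n)" for n by (rule E)
    show "\<bar>Y n x\<bar> \<le> ereal e" if "x \<in> space (P n)" "x \<notin> E n" for n x
      using E(2)[of n] that by (auto simp: not_less[symmetric])
    show "(\<lambda>n. emeasure (P n) (E n)) \<longlonglongrightarrow> 0"
      using assms E(3) by (auto simp: oP1_def)
  qed
qed

lemma elog_ereal_ge:
  assumes "ereal r \<le> elog (ennreal a)" shows "exp r \<le> a"
proof -
  have "a > 0" using assms by (cases "a > 0") (auto simp: elog_def ennreal_neg split: if_splits)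
  then have "r \<le> ln a" using assms by (simp add: elog_def)
  then show ?thesis using \<open>a > 0\<close> by (metis exp_le_cancel_iff exp_ln)
qed

text \<open>From ln r \<le> r - 1 the quantity n (1 - r) is at most -ln (r^n), which tends to
  0.\<close>

lemma tendsto_affinity_rate:
  assumes r: "\<And>n. 0 \<le> r n" "\<And>n. r n \<le> (1::real)" and l: "(\<lambda>n. r n ^ n) \<longlonglongrightarrow> 1"
  shows "(\<lambda>n. real n * (1 - r n)) \<longlonglongrightarrow> 0"
proof (rule tendsto_sandwich[OF _ _ tendsto_const])
  have pos: "\<forall>\<^sub>F n in sequentially. 0 < r n ^ n" by (rule order_tendstoD[OF l]) simp
  show "\<forall>\<^sub>F n in sequentially. 0 \<le> real n * (1 - r n)" using r by simp
  show "\<forall>\<^sub>F n in sequentially. real n * (1 - r n) \<le> - ln (r n ^ n)"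
    using pos eventually_gt_at_top[of 0]
  proof eventually_elim
    case (elim n)
    then have p: "0 < r n" using r(1)[of n] by (metis less_eq_real_def power_eq_0_iff less_irrefl)
    have "real n * ln (r n) \<le> real n * (r n - 1)"
      using ln_le_minus_one[OF p] by (intro mult_left_mono) auto
    then show ?case using p by (simp add: ln_realpow algebra_simps)
  qed
  show "(\<lambda>n. - ln (r n ^ n)) \<longlonglongrightarrow> 0"
    using tendsto_minus[OF tendsto_ln[OF l]] by simp
qed

text \<open>Affinities are at most 1, so a lower bound is the whole task. Outside a set of small
  tilted probability the product density of \<open>q n\<close> is at least a factor close to 1 times
  the tilted one, and there the integrand sqrt Q sqrt T is at least that factor's root times
  T.\<close>

lemma loglik_expansion_imp_affinity:
  assumes M: "sigma_finite_measure M" and p0: "is_density M p0" and q: "\<And>n. is_density M (q n)"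
    and g: "g \<in> L2 (density M p0)" and g0: "(\<integral>x. g x \<partial>density M p0) = 0"
    and ll: "oP1 (\<lambda>n. prod_law n (density M p0))
       (\<lambda>n x. log_lik_ratio (q n) p0 n x
         - ereal ((1 / sqrt (real n)) * (\<Sum>i<n. g (x i)) - 1/2 * (\<integral>y. (g y)\<^sup>2 \<partial>density M p0)))"
  shows "(\<lambda>n. (\<integral>x. sqrt (q n x) * sqrt (tilted M p0 g n x) \<partial>M) ^ n) \<longlonglongrightarrow> 1"
proof -
  let ?P = "density M p0"
  let ?S = "\<integral>y. (g y)\<^sup>2 \<partial>?P"
  let ?s = "tilted M p0 g"
  let ?c = "centred_trunc ?P g"
  let ?r = "\<lambda>n. \<integral>x. sqrt (q n x) * sqrt (?s n x) \<partial>M"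
  have P: "prob_space ?P" by (rule is_densityD[OF p0])
  note sd = tilted_density[OF M p0 g g0]
  have r: "0 \<le> ?r n" "?r n \<le> 1" for n using affinity_bounds[OF q sd] by auto
  define K where "K n = tilt_mgf ?P g n 1" for n
  have K1: "1 \<le> K n" for n unfolding K_def by (rule tilt_mgf_ge_1[OF P g g0])
  have "(\<lambda>n. ln (K n ^ n)) \<longlonglongrightarrow> ln (exp (1\<^sup>2 * ?S / 2))"
    unfolding K_def by (intro tendsto_ln tilt_mgf_power[OF P g g0]) simp
  then have lK: "(\<lambda>n. real n * ln (K n)) \<longlonglongrightarrow> ?S / 2"
    using K1 by (subst (asm) ln_realpow) (auto intro: less_le_trans[OF zero_less_one])
  \<comment> \<open>The exponent collects 3 e before taking the root: one e from the remainder of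
    the expansion, one from replacing \<open>g\<close> by its truncation, one from the normalising
    constant. The mass lost on exceptional sets is d.\<close>
  have key: "\<forall>\<^sub>F n in sequentially. ?r n ^ n \<ge> exp (- (3/2) * e) * (1 - d)" if e: "0 < e" and d: "0 < d" "d < 1" for e d
  proof -
    obtain E where E: "\<And>n. E n \<in> sets (prod_law n ?P)"
      and Eb: "\<And>n x. x \<in> space (prod_law n ?P) \<Longrightarrow> x \<notin> E n \<Longrightarrow>
         \<bar>log_lik_ratio (q n) p0 n x - ereal ((1 / sqrt (real n)) * (\<Sum>i<n. g (x i)) - 1/2 * ?S)\<bar> \<le> ereal e"
      and E0: "(\<lambda>n. emeasure (prod_law n ?P) (E n)) \<longlonglongrightarrow> 0"
      by (rule oP1_measurable_cover[OF ll e], rule that)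
    define u where "u n x = ?c n x - g x" for n x
    have u: "u n \<in> L2 ?P" "(\<integral>x. u n x \<partial>?P) = 0" for n
    proof -
      interpret prob_space ?P by (rule P)
      show "u n \<in> L2 ?P" unfolding u_def by (intro L2_diff centred_trunc_L2[OF P g g0] g)
      show "(\<integral>x. u n x \<partial>?P) = 0" unfolding u_def
        using L2_integrable[OF centred_trunc_L2[OF P g g0]] L2_integrable[OF g]
        by (simp add: centred_trunc_mean[OF P g g0] g0)
    qed
    have u2: "(\<lambda>n. \<integral>x. (u n x)\<^sup>2 \<partial>?P) \<longlonglongrightarrow> 0"
      unfolding u_def by (rule L2_tendstoD[OF centred_trunc_L2_tendsto[OF P g g0]])
    define N where "N n = {x \<in> space (prod_law n ?P). e \<le> \<bar>(1 / sqrt (real n)) * (\<Sum>i<n. u n (x i))\<bar>}" for n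
    have Nm: "N n \<in> sets (prod_law n ?P)" for n
    proof -
      have [measurable]: "(\<lambda>x. \<Sum>i<n. u n (x i)) \<in> borel_measurable (prod_law n ?P)"
        by (rule borel_measurable_prod_law_sum[OF L2_measurable[OF u(1)]])
      show ?thesis unfolding N_def by measurable
    qed
    have N0: "(\<lambda>n. measure (prod_law n ?P) (N n)) \<longlonglongrightarrow> 0"
    proof (rule Lim_null_comparison)
      show "\<forall>\<^sub>F n in sequentially. norm (measure (prod_law n ?P) (N n)) \<le> (\<integral>x. (u n x)\<^sup>2 \<partial>?P) / e\<^sup>2"
        using eventually_gt_at_top[of 0]
        by eventually_elim (use prod_law_Chebyshev[OF P u e] in \<open>simp add: N_def\<close>)
      show "(\<lambda>n. (\<integral>x. (u n x)\<^sup>2 \<partial>?P) / e\<^sup>2) \<longlonglongrightarrow> 0"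
        using tendsto_divide[OF u2 tendsto_const, of "e\<^sup>2"] e by simp
    qed
    have pp: "prob_space (prod_law n ?P)" for n by (rule prob_space_prod_law[OF P])
    have E0': "(\<lambda>n. measure (prod_law n ?P) (E n)) \<longlonglongrightarrow> 0"
    proof -
      have "(\<lambda>n. ennreal (measure (prod_law n ?P) (E n))) \<longlonglongrightarrow> ennreal 0"
        using E0 by (simp add: finite_measure.emeasure_eq_measure prob_space.finite_measure pp)
      then show ?thesis by (subst (asm) tendsto_ennreal_iff) auto
    qed
    have EN: "(\<lambda>n. measure (prod_law n ?P) (E n \<union> N n)) \<longlonglongrightarrow> 0"
    proof (rule Lim_null_comparison)
      show "\<forall>\<^sub>F n in sequentially. norm (measure (prod_law n ?P) (E n \<union> N n))
         \<le> measure (prod_law n ?P) (E n) + measure (prod_law n ?P) (N n)"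
        using measure_Un_le[OF E Nm] by simp
      show "(\<lambda>n. measure (prod_law n ?P) (E n) + measure (prod_law n ?P) (N n)) \<longlonglongrightarrow> 0"
        using tendsto_add[OF E0' N0] by simp
    qed
    \<comment> \<open>Both exceptional sets are small under the base law; the mass that enters the
      affinity bound is tilted mass, so contiguity has to carry the smallness over.\<close>
    have "(\<lambda>n. measure (prod_law n (density M (?s n))) (E n \<union> N n)) \<longlonglongrightarrow> 0"
      by (rule contiguousD[OF tilted_contiguous(1)[OF M p0 g g0] _ EN]) (use E Nm in auto)
    then have ev1: "\<forall>\<^sub>F n in sequentially. measure (prod_law n (density M (?s n))) (E n \<union> N n) < d"
      using d by (auto dest: order_tendstoD)
    have ev2: "\<forall>\<^sub>F n in sequentially. \<bar>real n * ln (K n) - ?S / 2\<bar> < e"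
      using tendstoD[OF lK e] by (simp add: dist_real_def)
    show ?thesis using ev1 ev2
    proof eventually_elim
      case (elim n)
      let ?Q = "\<lambda>x. \<Prod>i<n. q n (x i)" and ?T = "\<lambda>x. \<Prod>i<n. ?s n (x i)"
      have sp: "space (prod_law n ?P) = space (prod_law n M)"
        by (simp add: prod_law_def space_PiM)
      define B where "B = space (prod_law n M) - (E n \<union> N n)"
      have setsn: "sets (prod_law n ?P) = sets (prod_law n M)" by (rule sets_prod_law_cong) simp
      have Bm: "B \<in> sets (prod_law n M)" unfolding B_def using E[of n] Nm[of n] setsn by auto
      note dQ = is_density_prod(1)[OF M q, of n n] and dT = is_density_prod[OF M sd, of n n]
      note d0 = is_density_prod(1)[OF M p0, of n]
      have lb: "exp (- 3 * e) * ?T x \<le> ?Q x" if x: "x \<in> B" for x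
      proof -
        have xs: "x \<in> space (prod_law n ?P)" "x \<in> space (prod_law n M)" and xE: "x \<notin> E n" and xN: "x \<notin> N n"
          using x sp by (auto simp: B_def)
        let ?lin = "(1 / sqrt (real n)) * (\<Sum>i<n. g (x i)) - 1/2 * ?S"
        let ?t = "(1 / sqrt (real n)) * (\<Sum>i<n. ?c n (x i)) - real n * ln (K n)"
        have T: "?T x = (\<Prod>i<n. p0 (x i)) * exp ?t"
        proof -
          have "?T x = (\<Prod>i<n. p0 (x i)) * (\<Prod>i<n. exp (?c n (x i) / sqrt (real n))) / K n ^ n"
            by (simp add: tilted_def tilt_def prod.distrib prod_dividef K_def)
          also have "(\<Prod>i<n. exp (?c n (x i) / sqrt (real n))) = exp ((1 / sqrt (real n)) * (\<Sum>i<n. ?c n (x i)))"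
            by (simp add: exp_sum sum_divide_distrib)
          also have "K n ^ n = exp (real n * ln (K n))"
            using K1[of n] by (simp add: exp_of_nat_mult)
          finally show ?thesis by (simp add: exp_diff)
        qed
        have "?t - ?lin = (1 / sqrt (real n)) * (\<Sum>i<n. u n (x i)) - (real n * ln (K n) - ?S / 2)"
          by (simp add: u_def sum_subtractf right_diff_distrib)
        moreover have "\<bar>(1 / sqrt (real n)) * (\<Sum>i<n. u n (x i))\<bar> < e"
          using xN xs by (simp add: N_def not_le)
        \<comment> \<open>Here two of the three e are spent: one on the truncated sum, by the choice
          of \<open>N n\<close>, and one on the normaliser.\<close>
        ultimately have tl: "?t - 2 * e \<le> ?lin" using elim(2) by linarith
        have "ereal (?lin - e) \<le> log_lik_ratio (q n) p0 n x"
          using Eb[OF xs(1) xE] by (cases "log_lik_ratio (q n) p0 n x") (auto simp: abs_le_iff)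
        then have "ereal (?t - 3 * e) \<le> log_lik_ratio (q n) p0 n x"
          using tl by (elim order_trans[rotated]) simp
        then have h: "exp (?t - 3 * e) \<le> ?Q x / (\<Prod>i<n. p0 (x i))"
          unfolding log_lik_ratio_def by (rule elog_ereal_ge)
        have p0n: "0 \<le> (\<Prod>i<n. p0 (x i))" using is_densityD(2)[OF d0 xs(2)] .
        \<comment> \<open>The case c = 0 contradicts the premises because b / 0 = 0. So the base
          density is positive at the point considered.\<close>
        have "a * c \<le> b" if "a \<le> b / c" "0 < a" "0 \<le> c" for a b c :: real
          using that by (cases "c = 0") (auto simp: pos_le_divide_eq)
        from this[OF h exp_gt_zero p0n]
        have "exp (?t - 3 * e) * (\<Prod>i<n. p0 (x i)) \<le> ?Q x" .
        moreover have eqx: "exp (- 3 * e) * (c * exp t) = exp (t - 3 * e) * c" for c t :: real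
          by (simp add: exp_diff exp_minus divide_inverse)
        ultimately show ?thesis unfolding T eqx by blast
      qed
      have iT: "integrable (prod_law n M) (\<lambda>x. ?T x * indicator B x)"
        and mT: "measure (prod_law n (density M (?s n))) B = (\<integral>x. ?T x * indicator B x \<partial>prod_law n M)"
        using measure_density_eq_integral[OF dT(1) Bm] dT(2) by auto
      interpret S: prob_space "prod_law n (density M (?s n))"
        by (rule prob_space_prod_law) (rule is_densityD[OF sd])
      have spS: "space (prod_law n (density M (?s n))) = space (prod_law n M)"
        by (simp add: prod_law_def space_PiM)
      have setsS: "sets (prod_law n (density M (?s n))) = sets (prod_law n M)" by (rule sets_prod_law_cong) simp
      have "measure (prod_law n (density M (?s n))) B = 1 - measure (prod_law n (density M (?s n))) (E n \<union> N n)"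
        unfolding B_def spS[symmetric] by (rule S.prob_compl) (use E[of n] Nm[of n] setsn setsS in auto)
      then have "exp (- (3/2) * e) * (1 - d) \<le> exp (- (3/2) * e) * (\<integral>x. ?T x * indicator B x \<partial>prod_law n M)"
        using elim(1) mT by (intro mult_left_mono) auto
      also have "\<dots> = (\<integral>x. exp (- (3/2) * e) * (?T x * indicator B x) \<partial>prod_law n M)" by simp
      also have "\<dots> \<le> (\<integral>x. sqrt (?Q x) * sqrt (?T x) \<partial>prod_law n M)"
      proof (rule integral_mono)
        show "integrable (prod_law n M) (\<lambda>x. sqrt (?Q x) * sqrt (?T x))"
          by (intro L2_integrable_mult is_densityD(4) dQ dT(1))
        fix x assume x: "x \<in> space (prod_law n M)"
        have T0: "0 \<le> ?T x" and Q0: "0 \<le> ?Q x" using is_densityD(2)[OF dT(1) x] is_densityD(2)[OF dQ x] .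
        show "exp (- (3/2) * e) * (?T x * indicator B x) \<le> sqrt (?Q x) * sqrt (?T x)"
        proof (cases "x \<in> B")
          case True
          have "sqrt (exp (- 3 * e)) = exp (- (3/2) * e)"
            by (rule real_sqrt_unique) (auto simp flip: exp_of_nat_mult)
          then have "exp (- (3/2) * e) * ?T x = sqrt (exp (- 3 * e) * ?T x) * sqrt (?T x)"
            using T0 by (simp add: real_sqrt_mult)
          also have "\<dots> \<le> sqrt (?Q x) * sqrt (?T x)"
            using lb[OF True] T0 by (intro mult_right_mono) auto
          finally show ?thesis using True by simp
        qed (use T0 Q0 in simp)
      qed (use iT in simp)
      also have "\<dots> = ?r n ^ n" by (rule affinity_prod[OF M q sd])
      finally show ?case .
    qed
  qed
  show ?thesis
  proof (rule order_tendstoI)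
    fix a :: real assume "1 < a"
    then show "\<forall>\<^sub>F n in sequentially. ?r n ^ n < a"
      using r by (auto intro!: always_eventually le_less_trans[OF power_le_one])
  next
    fix a :: real assume a: "a < 1"
    have "((\<lambda>e. exp (- (3/2) * e) * (1 - e)) \<longlongrightarrow> exp (- (3/2) * 0) * (1 - 0)) (at_right (0::real))"
      by (intro tendsto_intros)
    then have "\<forall>\<^sub>F e in at_right (0::real). a < exp (- (3/2) * e) * (1 - e)"
      using a by (auto dest: order_tendstoD)
    moreover have "\<forall>\<^sub>F e in at_right (0::real). 0 < e \<and> e < 1"
      unfolding eventually_at_right_field by (auto intro!: exI[of _ 1])
    ultimately have "\<forall>\<^sub>F e in at_right (0::real). a < exp (- (3/2) * e) * (1 - e) \<and> 0 < e \<and> e < 1"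
      by eventually_elim auto
    from eventually_happens'[OF trivial_limit_at_right_real this]
    obtain e where "a < exp (- (3/2) * e) * (1 - e)" "0 < e" "e < 1" by auto
    with key[of e e] show "\<forall>\<^sub>F n in sequentially. a < ?r n ^ n"
      by (auto elim: eventually_mono)
  qed
qed

text \<open>The tilted law has the required L2 derivative, and the affinity rate says that
  \<open>q n\<close> is too close to it, after scaling by sqrt n, for the derivative to
  differ.\<close>

lemma loglik_expansion_imp_dqm:
  assumes M: "sigma_finite_measure M" and p0: "is_density M p0" and q: "\<And>n. is_density M (q n)"
    and g: "g \<in> L2 (density M p0)" and g0: "(\<integral>x. g x \<partial>density M p0) = 0"
    and ll: "oP1 (\<lambda>n. prod_law n (density M p0))
       (\<lambda>n x. log_lik_ratio (q n) p0 n x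
         - ereal ((1 / sqrt (real n)) * (\<Sum>i<n. g (x i)) - 1/2 * (\<integral>y. (g y)\<^sup>2 \<partial>density M p0)))"
  shows "L2_tendsto M (\<lambda>n x. sqrt (real n) * (sqrt (q n x) - sqrt (p0 x))) (\<lambda>x. 1/2 * g x * sqrt (p0 x))"
proof -
  let ?s = "tilted M p0 g"
  note sd = tilted_density[OF M p0 g g0]
  have "(\<lambda>n. real n * (1 - (\<integral>x. sqrt (q n x) * sqrt (?s n x) \<partial>M))) \<longlonglongrightarrow> 0"
    by (rule tendsto_affinity_rate[OF _ _ loglik_expansion_imp_affinity[OF assms]])
      (use affinity_bounds[OF q sd] in auto)
  from tendsto_mult_left[OF this, of 2]
  have "(\<lambda>n. real n * (\<integral>x. (sqrt (q n x) - sqrt (?s n x))\<^sup>2 \<partial>M)) \<longlonglongrightarrow> 0"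
    unfolding affinity_eq[OF q sd] by (simp add: algebra_simps)
  then have "L2_tendsto M (\<lambda>n x. sqrt (real n) * (sqrt (q n x) - sqrt (?s n x))) (\<lambda>_. 0)"
    unfolding L2_tendsto_zero_iff
    using is_densityD(4)[OF q] is_densityD(4)[OF sd]
    by (auto simp: power_mult_distrib intro!: L2_scale L2_diff)
  from L2_tendsto_add[OF this tilted_L2_derivative[OF M p0 g g0]]
  show ?thesis by (simp add: algebra_simps)
qed

section \<open>Characteristic functions under local alternatives\<close>

text \<open>A complex logarithm is avoided by comparing with \<open>exp (w / of_nat n) ^ n\<close>:
  for two numbers in the closed unit disc the n-th powers differ by at most n times their distance.
  The sign of Re w puts the comparison number into that disc.\<close>

lemma tendsto_power_exp_complex:
  fixes z :: "nat \<Rightarrow> complex"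
  assumes l: "(\<lambda>n. of_nat n * (z n - 1)) \<longlonglongrightarrow> w" and z: "\<And>n. norm (z n) \<le> 1" and w: "Re w \<le> 0"
  shows "(\<lambda>n. z n ^ n) \<longlonglongrightarrow> exp w"
proof -
  have e: "(\<lambda>n. of_nat n * (exp (w / of_nat n) - 1)) \<longlonglongrightarrow> w"
  proof (cases "w = 0")
    case False
    have "((\<lambda>h. (exp h - 1) / h) \<longlongrightarrow> 1) (at (0::complex))"
      using DERIV_exp[of "0::complex"] by (simp add: DERIV_def)
    moreover have "filterlim (\<lambda>n. w / of_nat n) (at 0) sequentially"
      unfolding filterlim_at
    proof
      show "\<forall>\<^sub>F n in sequentially. w / of_nat n \<in> UNIV \<and> w / of_nat n \<noteq> 0"
        using eventually_gt_at_top[of 0] by eventually_elim (use False in auto)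
      show "(\<lambda>n. w / of_nat n) \<longlonglongrightarrow> 0"
        using tendsto_mult[OF tendsto_const[of w] lim_1_over_n[where 'a=complex]] by simp
    qed
    ultimately have "(\<lambda>n. (exp (w / of_nat n) - 1) / (w / of_nat n)) \<longlonglongrightarrow> 1"
      by (rule filterlim_compose)
    from tendsto_mult[OF tendsto_const[of w] this]
    have "(\<lambda>n. w * ((exp (w / of_nat n) - 1) / (w / of_nat n))) \<longlonglongrightarrow> w" by simp
    moreover have "w * ((e - 1) / (w / k)) = k * (e - 1)" for e k :: complex
      using False by simp
    ultimately show ?thesis by simp
  qed simp
  have "(\<lambda>n. z n ^ n - exp w) \<longlonglongrightarrow> 0"
  proof (rule Lim_null_comparison)
    show "(\<lambda>n. norm (of_nat n * (z n - 1) - of_nat n * (exp (w / of_nat n) - 1))) \<longlonglongrightarrow> 0"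
      using tendsto_norm[OF tendsto_diff[OF l e]] by simp
    show "\<forall>\<^sub>F n in sequentially. norm (z n ^ n - exp w)
       \<le> norm (of_nat n * (z n - 1) - of_nat n * (exp (w / of_nat n) - 1))"
      using eventually_gt_at_top[of 0]
    proof eventually_elim
      case (elim n)
      have "exp w = exp (w / of_nat n) ^ n" using elim by (simp flip: exp_of_nat_mult)
      then have "norm (z n ^ n - exp w) = norm (z n ^ n - exp (w / of_nat n) ^ n)" by simp
      also have "\<dots> \<le> real n * norm (z n - exp (w / of_nat n))"
        using w by (intro norm_power_diff z) (auto simp: divide_nonpos_nonneg)
      also have "\<dots> = norm (of_nat n * (z n - 1) - of_nat n * (exp (w / of_nat n) - 1))"
        by (simp add: right_diff_distrib[symmetric] norm_mult)
      finally show ?case .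
    qed
  qed
  then show ?thesis by (simp add: LIM_zero_iff)
qed

text \<open>This bound and the next two merge the Taylor bound for small x with the crude bound for
  large x into one factor min 1 |x|. That factor becomes the weight whose means are shown to
  vanish.\<close>

lemma iexp_bound0: "cmod (iexp x - 1) \<le> 2 * min 1 \<bar>x\<bar>"
  using iexp_approx1[of x 0] iexp_approx2[of x 0] by auto

lemma iexp_bound1: "cmod (iexp x - 1 - \<i> * x) \<le> 2 * \<bar>x\<bar> * min 1 \<bar>x\<bar>"
proof -
  have 1: "cmod (iexp x - 1 - \<i> * x) \<le> \<bar>x\<bar>\<^sup>2 / 2"
    using iexp_approx1[of x 1] by (simp add: eval_nat_numeral diff_diff_eq)
  have 2: "cmod (iexp x - 1 - \<i> * x) \<le> 2 * \<bar>x\<bar>"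
    using iexp_approx2[of x 1] by (simp add: diff_diff_eq)
  show ?thesis
  proof (cases "\<bar>x\<bar> \<le> 1")
    case True
    then have "2 * \<bar>x\<bar> * min 1 \<bar>x\<bar> = 2 * \<bar>x\<bar>\<^sup>2" by (simp add: power2_eq_square)
    moreover have "0 \<le> \<bar>x\<bar>\<^sup>2" by simp
    ultimately show ?thesis using 1 by linarith
  next
    case False
    then show ?thesis using 2 by simp
  qed
qed

lemma iexp_bound2: "cmod (iexp x - 1 - \<i> * x + x\<^sup>2 / 2) \<le> x\<^sup>2 * min 1 \<bar>x\<bar>"
proof -
  have s: "(\<Sum>k\<le>2. (\<i> * complex_of_real x) ^ k / fact k) = 1 + \<i> * x - x\<^sup>2 / 2"
  proof -
    have "(\<Sum>k\<le>2. h k) = h 0 + h 1 + h 2" for h :: "nat \<Rightarrow> complex" by (simp add: eval_nat_numeral)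
    then show ?thesis by (simp add: power_mult_distrib)
  qed
  have 1: "cmod (iexp x - 1 - \<i> * x + x\<^sup>2 / 2) \<le> \<bar>x\<bar> ^ 3 / 6"
    using iexp_approx1[of x 2] unfolding s by (simp add: fact_numeral algebra_simps)
  have 2: "cmod (iexp x - 1 - \<i> * x + x\<^sup>2 / 2) \<le> x\<^sup>2"
    using iexp_approx2[of x 2] unfolding s by (simp add: fact_numeral algebra_simps)
  show ?thesis
  proof (cases "\<bar>x\<bar> \<le> 1")
    case True
    then have "x\<^sup>2 * min 1 \<bar>x\<bar> = \<bar>x\<bar> ^ 3" by (simp add: power2_eq_square power3_eq_cube abs_mult_self_eq)
    moreover have "0 \<le> \<bar>x\<bar> ^ 3" by simp
    ultimately show ?thesis using 1 by linarith
  next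
    case False
    then show ?thesis using 2 by simp
  qed
qed

lemma norm_integral_le_integral:
  fixes f :: "'a \<Rightarrow> 'b::{banach, second_countable_topology}"
  assumes "integrable M f" "integrable M g" "\<And>x. norm (f x) \<le> g x"
  shows "norm (\<integral>x. f x \<partial>M) \<le> (\<integral>x. g x \<partial>M)"
proof -
  have "norm (\<integral>x. f x \<partial>M) \<le> (\<integral>x. norm (f x) \<partial>M)" by (rule integral_norm_bound)
  also have "\<dots> \<le> (\<integral>x. g x \<partial>M)" using assms by (intro integral_mono) auto
  finally show ?thesis .
qed

lemma integrable_mult_bounded:
  fixes f m :: "'a \<Rightarrow> real"
  assumes "integrable M f" "m \<in> borel_measurable M" "\<And>x. 0 \<le> m x" "\<And>x. m x \<le> 1"
  shows "integrable M (\<lambda>x. m x * f x)"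
proof (rule Bochner_Integration.integrable_bound[OF assms(1)])
  show "(\<lambda>x. m x * f x) \<in> borel_measurable M" using assms by auto
  show "AE x in M. norm (m x * f x) \<le> norm (f x)"
    using assms(3,4) by (auto simp: abs_mult intro!: mult_left_le_one_le)
qed

text \<open>Uniform integrability: weights vanishing in \<open>c\<^sup>2\<close>-mean also vanish in \<open>w\<^sup>2\<close>-mean.\<close>

lemma weighted_square_tendsto_zero:
  assumes c: "c \<in> L2 M" and w: "(\<lambda>x. w x * c x) \<in> L2 M"
    and m: "\<And>n. m n \<in> borel_measurable M" "\<And>n x. 0 \<le> m n x" "\<And>n x. m n x \<le> (1::real)"
    and l: "(\<lambda>n. \<integral>x. m n x * (c x)\<^sup>2 \<partial>M) \<longlonglongrightarrow> 0"
  shows "(\<lambda>n. \<integral>x. m n x * (w x * c x)\<^sup>2 \<partial>M) \<longlonglongrightarrow> 0"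
proof -
  let ?w = "\<lambda>x. (w x * c x)\<^sup>2"
  \<comment> \<open>The part of the integrand above the level k c^2. Its integral is small for large
    k, uniformly in the weights; below the level the integrand is at most k times the one assumed to
    vanish.\<close>
  let ?t = "\<lambda>(k::nat) x. ?w x - min (?w x) (real k * (c x)\<^sup>2)"
  have iw: "integrable M ?w" by (rule L2_integrable_square[OF w])
  have ic: "integrable M (\<lambda>x. (c x)\<^sup>2)" by (rule L2_integrable_square[OF c])
  have [measurable]: "c \<in> borel_measurable M" "(\<lambda>x. w x * c x) \<in> borel_measurable M"
    using c w by (auto intro: L2_measurable)
  have it: "integrable M (?t k)" for k
    by (rule Bochner_Integration.integrable_bound[OF iw]) auto
  have t0: "(\<lambda>k. \<integral>x. ?t k x \<partial>M) \<longlonglongrightarrow> (\<integral>x. 0 \<partial>M)"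
  proof (rule integral_dominated_convergence[where w="?w"])
    have "(\<lambda>k. ?t k x) \<longlonglongrightarrow> 0" for x
    proof (rule tendsto_eventually)
      show "\<forall>\<^sub>F k in sequentially. ?t k x = 0"
        using eventually_ge_at_top[of "nat \<lceil>(w x)\<^sup>2\<rceil>"]
      proof eventually_elim
        case (elim k)
        then have "(w x)\<^sup>2 \<le> real k" by linarith
        then have "?w x \<le> real k * (c x)\<^sup>2" by (simp add: power_mult_distrib mult_right_mono)
        then show ?case by simp
      qed
    qed
    then show "AE x in M. (\<lambda>k. ?t k x) \<longlonglongrightarrow> 0" by simp
  qed (use iw in auto)
  show ?thesis
  proof (rule LIMSEQ_I)
    fix e :: real assume e: "0 < e"
    have "\<forall>\<^sub>F k in sequentially. (\<integral>x. ?t k x \<partial>M) < e / 2"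
      using order_tendstoD(2)[OF t0, of "e/2"] e by simp
    then obtain k where k: "(\<integral>x. ?t k x \<partial>M) < e / 2"
      by (auto simp: eventually_sequentially)
    have "(\<lambda>n. real k * (\<integral>x. m n x * (c x)\<^sup>2 \<partial>M)) \<longlonglongrightarrow> 0"
      using tendsto_mult_left[OF l, of "real k"] by simp
    then have "\<forall>\<^sub>F n in sequentially. real k * (\<integral>x. m n x * (c x)\<^sup>2 \<partial>M) < e / 2"
      by (rule order_tendstoD) (use e in simp)
    then obtain N where N: "\<And>n. n \<ge> N \<Longrightarrow> real k * (\<integral>x. m n x * (c x)\<^sup>2 \<partial>M) < e / 2"
      by (auto simp: eventually_sequentially)
    show "\<exists>N. \<forall>n\<ge>N. norm ((\<integral>x. m n x * ?w x \<partial>M) - 0) < e"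
    proof (intro exI allI impI)
      fix n assume n: "N \<le> n"
      have i: "integrable M (\<lambda>x. m n x * ?w x)" "integrable M (\<lambda>x. m n x * (c x)\<^sup>2)"
        by (intro integrable_mult_bounded iw ic m)+
      have "(\<integral>x. m n x * ?w x \<partial>M) \<le> (\<integral>x. real k * (m n x * (c x)\<^sup>2) + ?t k x \<partial>M)"
      proof (rule integral_mono)
        fix x
        have "m n x * ?w x = m n x * min (?w x) (real k * (c x)\<^sup>2) + m n x * ?t k x"
          by (simp add: algebra_simps)
        also have "\<dots> \<le> m n x * (real k * (c x)\<^sup>2) + ?t k x"
          using m(2,3)[of n x] by (intro add_mono mult_left_mono mult_left_le_one_le) auto
        finally show "m n x * ?w x \<le> real k * (m n x * (c x)\<^sup>2) + ?t k x" by (simp add: mult_ac)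
      qed (use i it in auto)
      also have "\<dots> = real k * (\<integral>x. m n x * (c x)\<^sup>2 \<partial>M) + (\<integral>x. ?t k x \<partial>M)"
        using i it by (subst Bochner_Integration.integral_add) auto
      finally have "(\<integral>x. m n x * ?w x \<partial>M) < e" using N[OF n] k by linarith
      moreover have "0 \<le> (\<integral>x. m n x * ?w x \<partial>M)" using m by (intro Bochner_Integration.integral_nonneg) auto
      ultimately show "norm ((\<integral>x. m n x * ?w x \<partial>M) - 0) < e" by simp
    qed
  qed
qed

text \<open>Since the weights are at most 1, exchanging \<open>w\<close> for \<open>W n\<close>
  costs no more than twice the squared L2 distance.\<close>

lemma L2_tendsto_weighted_zero:
  assumes W: "L2_tendsto M W w"
    and m: "\<And>n. m n \<in> borel_measurable M" "\<And>n x. 0 \<le> m n x" "\<And>n x. m n x \<le> (1::real)"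
    and l: "(\<lambda>n. \<integral>x. m n x * (w x)\<^sup>2 \<partial>M) \<longlonglongrightarrow> 0"
  shows "(\<lambda>n. \<integral>x. m n x * (W n x)\<^sup>2 \<partial>M) \<longlonglongrightarrow> 0"
proof (rule Lim_null_comparison)
  note W' = L2_tendstoD[OF W]
  show "(\<lambda>n. 2 * (\<integral>x. (W n x - w x)\<^sup>2 \<partial>M) + 2 * (\<integral>x. m n x * (w x)\<^sup>2 \<partial>M)) \<longlonglongrightarrow> 0"
    using tendsto_add[OF tendsto_mult_left[OF W'(3), of 2] tendsto_mult_left[OF l, of 2]] by simp
  show "\<forall>\<^sub>F n in sequentially. norm (\<integral>x. m n x * (W n x)\<^sup>2 \<partial>M)
    \<le> 2 * (\<integral>x. (W n x - w x)\<^sup>2 \<partial>M) + 2 * (\<integral>x. m n x * (w x)\<^sup>2 \<partial>M)"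
  proof (rule always_eventually, rule allI)
    fix n
    have i: "integrable M (\<lambda>x. m n x * (W n x)\<^sup>2)" "integrable M (\<lambda>x. m n x * (w x)\<^sup>2)"
      by (intro integrable_mult_bounded L2_integrable_square W' m)+
    have i2: "integrable M (\<lambda>x. (W n x - w x)\<^sup>2)" by (intro L2_integrable_square L2_diff W')
    have "(\<integral>x. m n x * (W n x)\<^sup>2 \<partial>M) \<le> (\<integral>x. 2 * (W n x - w x)\<^sup>2 + 2 * (m n x * (w x)\<^sup>2) \<partial>M)"
    proof (rule integral_mono)
      fix x
      have "m n x * (W n x)\<^sup>2 \<le> m n x * (2 * (W n x - w x)\<^sup>2 + 2 * (w x)\<^sup>2)"
        using square_add_le[of "W n x - w x" "w x"] m(2) by (intro mult_left_mono) auto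
      also have "\<dots> = m n x * (2 * (W n x - w x)\<^sup>2) + 2 * (m n x * (w x)\<^sup>2)" by (simp add: algebra_simps)
      also have "\<dots> \<le> 2 * (W n x - w x)\<^sup>2 + 2 * (m n x * (w x)\<^sup>2)"
        using m(2,3)[of n x] by (intro add_right_mono mult_left_le_one_le) auto
      finally show "m n x * (W n x)\<^sup>2 \<le> 2 * (W n x - w x)\<^sup>2 + 2 * (m n x * (w x)\<^sup>2)" .
    qed (use i i2 in auto)
    also have "\<dots> = 2 * (\<integral>x. (W n x - w x)\<^sup>2 \<partial>M) + 2 * (\<integral>x. m n x * (w x)\<^sup>2 \<partial>M)"
      using i i2 by (subst Bochner_Integration.integral_add) auto
    finally show "norm (\<integral>x. m n x * (W n x)\<^sup>2 \<partial>M)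
      \<le> 2 * (\<integral>x. (W n x - w x)\<^sup>2 \<partial>M) + 2 * (\<integral>x. m n x * (w x)\<^sup>2 \<partial>M)"
      using m by (subst real_norm_def, subst abs_of_nonneg) (auto intro!: Bochner_Integration.integral_nonneg)
  qed
qed

text \<open>To be read with E = exp (i X), s = sqrt n, a the root density of the centring law and s
  a + z equal to s times the root density of the alternative. The first bracket is remainder; the
  second holds, in order, the mean, the variance and the drift.\<close>

lemma iexp_square_expansion:
  fixes E s X a z :: complex
  shows "(E - 1) * (s * a + z)\<^sup>2 =
    (s\<^sup>2 * (E - 1 - \<i> * X + X\<^sup>2 / 2) * a\<^sup>2 + 2 * s * (E - 1 - \<i> * X) * a * z + (E - 1) * z\<^sup>2)
    + (\<i> * (s\<^sup>2 * X * a\<^sup>2) - (s * X * a)\<^sup>2 / 2 + \<i> * (2 * (s * X * a * z)))"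
  by (simp add: power2_eq_square field_simps)

text \<open>Writing the alternative's root density as that of \<open>q n\<close> plus Z / sqrt n
  turns n (z - 1) into integrals that converge by L2 convergence alone: -1/2 of the integral of Y^2
  gives the variance, and 2 i times the integral of Y Z gives the drift. No joint limit law of
  scores and likelihood ratios enters.\<close>

lemma char_limit_local_alternatives:
  assumes p0: "is_density M p0" and q: "\<And>n. is_density M (q n)" and r: "\<And>n. is_density M (r n)"
    and dq: "L2_tendsto M (\<lambda>n y. sqrt (real n) * (sqrt (q n y) - sqrt (p0 y))) (\<lambda>y. 1/2 * g y * sqrt (p0 y))"
    and dr: "L2_tendsto M (\<lambda>n y. sqrt (real n) * (sqrt (r n y) - sqrt (p0 y))) (\<lambda>y. 1/2 * f y * sqrt (p0 y))"
    and x: "\<And>n. x n \<in> borel_measurable M"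
    and xl: "L2_tendsto M (\<lambda>n y. x n y * sqrt (q n y)) (\<lambda>y. x0 y * sqrt (p0 y))"
    and x0: "\<And>n. (\<integral>y. x n y \<partial>density M (q n)) = 0"
    and meas: "f \<in> borel_measurable M" "g \<in> borel_measurable M" "x0 \<in> borel_measurable M"
  shows "(\<lambda>n. (\<integral>y. iexp (x n y / sqrt (real n)) \<partial>density M (r n)) ^ n)
    \<longlonglongrightarrow> exp (- complex_of_real (1/2 * (\<integral>y. (x0 y)\<^sup>2 \<partial>density M p0))
      + \<i> * complex_of_real (\<integral>y. x0 y * (f y - g y) \<partial>density M p0))"
proof -
  define a where "a n y = sqrt (q n y)" for n y
  define b where "b n y = sqrt (r n y)" for n y
  define c where "c y = sqrt (p0 y)" for y
  define X where "X n y = x n y / sqrt (real n)" for n y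
  \<comment> \<open>The common factor of the three \<open>iexp\<close> bounds; every remainder is
    dominated by its means against Y^2 and Z^2.\<close>
  define m where "m n y = min 1 \<bar>X n y\<bar>" for n y
  define Y where "Y n y = x n y * a n y" for n y
  \<comment> \<open>The scaled difference is taken between the alternative and \<open>q n\<close>,
    not \<open>p0\<close>, because the scores \<open>x n\<close> are centred under
    \<open>q n\<close>. Its limit carries the direction f - g.\<close>
  define Z where "Z n y = sqrt (real n) * (b n y - a n y)" for n y
  have aL: "a n \<in> L2 M" and bL: "b n \<in> L2 M" and cL: "c \<in> L2 M" for n
    using is_densityD(4)[OF q] is_densityD(4)[OF r] is_densityD(4)[OF p0]
    by (auto simp: a_def[abs_def] b_def[abs_def] c_def[abs_def])
  have Yl: "L2_tendsto M Y (\<lambda>y. x0 y * c y)" using xl by (simp add: Y_def[abs_def] a_def c_def)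
  have Zl: "L2_tendsto M Z (\<lambda>y. (1/2 * (f y - g y)) * c y)"
    using L2_tendsto_diff[OF dr dq] by (simp add: Z_def[abs_def] a_def b_def c_def algebra_simps diff_divide_distrib)
  note YL = L2_tendstoD[OF Yl] and ZL = L2_tendstoD[OF Zl]
  have Xm[measurable]: "X n \<in> borel_measurable M" for n unfolding X_def using x by auto
  have mm: "m n \<in> borel_measurable M" "0 \<le> m n y" "m n y \<le> 1" for n y
    unfolding m_def by auto
  have lim0: "(\<lambda>n. 1 / sqrt (real n)) \<longlonglongrightarrow> 0"
    by (intro tendsto_divide_0[OF tendsto_const] filterlim_at_top_imp_at_infinity
        filterlim_compose[OF sqrt_at_top] filterlim_real_sequentially)
  \<comment> \<open>The weight is at most |X|, and |X| a^2 = |Y a| / sqrt n, so Cauchy-Schwarz gives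
    the rate 1 / sqrt n.\<close>
  have ma: "(\<lambda>n. \<integral>y. m n y * (a n y)\<^sup>2 \<partial>M) \<longlonglongrightarrow> 0"
  proof (rule Lim_null_comparison)
    show "(\<lambda>n. 1 / sqrt (real n) * sqrt (\<integral>y. (Y n y)\<^sup>2 \<partial>M)) \<longlonglongrightarrow> 0"
      using tendsto_mult[OF lim0 tendsto_real_sqrt[OF L2_tendsto_square[OF Yl]]] by simp
    show "\<forall>\<^sub>F n in sequentially. norm (\<integral>y. m n y * (a n y)\<^sup>2 \<partial>M) \<le> 1 / sqrt (real n) * sqrt (\<integral>y. (Y n y)\<^sup>2 \<partial>M)"
    proof (rule always_eventually, rule allI)
      fix n
      have "(\<integral>y. m n y * (a n y)\<^sup>2 \<partial>M) \<le> (\<integral>y. 1 / sqrt (real n) * \<bar>Y n y * a n y\<bar> \<partial>M)"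
      proof (rule integral_mono)
        show "integrable M (\<lambda>y. m n y * (a n y)\<^sup>2)"
          by (intro integrable_mult_bounded L2_integrable_square aL mm)
        show "integrable M (\<lambda>y. 1 / sqrt (real n) * \<bar>Y n y * a n y\<bar>)"
          using L2_integrable_mult[OF YL(1) aL, of n n] by simp
        fix y
        have "m n y * (a n y)\<^sup>2 \<le> \<bar>X n y\<bar> * (a n y)\<^sup>2" unfolding m_def by (intro mult_right_mono) auto
        also have "\<dots> = 1 / sqrt (real n) * \<bar>Y n y * a n y\<bar>"
          by (simp add: X_def Y_def abs_mult power2_eq_square abs_divide)
        finally show "m n y * (a n y)\<^sup>2 \<le> 1 / sqrt (real n) * \<bar>Y n y * a n y\<bar>" .
      qed
      also have "\<dots> = 1 / sqrt (real n) * (\<integral>y. \<bar>Y n y * a n y\<bar> \<partial>M)" by simp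
      also have "\<dots> \<le> 1 / sqrt (real n) * (sqrt (\<integral>y. (Y n y)\<^sup>2 \<partial>M) * sqrt (\<integral>y. (a n y)\<^sup>2 \<partial>M))"
        by (intro mult_left_mono L2_Cauchy_Schwarz_abs YL aL) auto
      also have "(\<integral>y. (a n y)\<^sup>2 \<partial>M) = 1" unfolding a_def by (rule is_densityD(7)[OF q])
      finally show "norm (\<integral>y. m n y * (a n y)\<^sup>2 \<partial>M) \<le> 1 / sqrt (real n) * sqrt (\<integral>y. (Y n y)\<^sup>2 \<partial>M)"
        using mm by (subst real_norm_def, subst abs_of_nonneg) (auto intro!: Bochner_Integration.integral_nonneg)
    qed
  qed
  have ac: "L2_tendsto M (\<lambda>n y. c y - a n y) (\<lambda>_. 0)"
    unfolding L2_tendsto_zero_iff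
  proof (intro conjI allI L2_diff cL aL)
    let ?w = "\<lambda>n y. sqrt (real n) * (a n y - c y)"
    have "(\<lambda>n. 1 / real n * (\<integral>y. (?w n y)\<^sup>2 \<partial>M)) \<longlonglongrightarrow> 0 * (\<integral>y. (1/2 * g y * sqrt (p0 y))\<^sup>2 \<partial>M)"
      unfolding a_def c_def by (intro tendsto_mult lim_1_over_n L2_tendsto_square[OF dq])
    moreover have "\<forall>\<^sub>F n in sequentially. 1 / real n * (\<integral>y. (?w n y)\<^sup>2 \<partial>M) = (\<integral>y. (c y - a n y)\<^sup>2 \<partial>M)"
      using eventually_gt_at_top[of 0]
      by eventually_elim (simp add: power_mult_distrib power2_commute[of "c _"])
    ultimately show "(\<lambda>n. \<integral>y. (c y - a n y)\<^sup>2 \<partial>M) \<longlonglongrightarrow> 0" by (auto elim: Lim_transform_eventually)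
  qed
  \<comment> \<open>The uniform integrability argument refers to a fixed function, so the smallness
    of the weights is moved from the varying root \<open>a n\<close> to its limit
    \<open>c\<close>.\<close>
  have mc: "(\<lambda>n. \<integral>y. m n y * (c y)\<^sup>2 \<partial>M) \<longlonglongrightarrow> 0"
  proof (rule Lim_null_comparison)
    show "(\<lambda>n. 2 * (\<integral>y. (c y - a n y)\<^sup>2 \<partial>M) + 2 * (\<integral>y. m n y * (a n y)\<^sup>2 \<partial>M)) \<longlonglongrightarrow> 0"
      using tendsto_add[OF tendsto_mult_left[OF L2_tendsto_square[OF ac], of 2] tendsto_mult_left[OF ma, of 2]] by simp
    show "\<forall>\<^sub>F n in sequentially. norm (\<integral>y. m n y * (c y)\<^sup>2 \<partial>M)
      \<le> 2 * (\<integral>y. (c y - a n y)\<^sup>2 \<partial>M) + 2 * (\<integral>y. m n y * (a n y)\<^sup>2 \<partial>M)"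
    proof (rule always_eventually, rule allI)
      fix n
      have i: "integrable M (\<lambda>y. m n y * (c y)\<^sup>2)" "integrable M (\<lambda>y. m n y * (a n y)\<^sup>2)"
        by (intro integrable_mult_bounded L2_integrable_square aL cL mm)+
      have i2: "integrable M (\<lambda>y. (c y - a n y)\<^sup>2)" by (intro L2_integrable_square L2_diff aL cL)
      have "(\<integral>y. m n y * (c y)\<^sup>2 \<partial>M) \<le> (\<integral>y. 2 * (c y - a n y)\<^sup>2 + 2 * (m n y * (a n y)\<^sup>2) \<partial>M)"
      proof (rule integral_mono)
        fix y
        have "m n y * (c y)\<^sup>2 \<le> m n y * (2 * (c y - a n y)\<^sup>2 + 2 * (a n y)\<^sup>2)"
          using square_add_le[of "c y - a n y" "a n y"] mm(2) by (intro mult_left_mono) auto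
        also have "\<dots> = m n y * (2 * (c y - a n y)\<^sup>2) + 2 * (m n y * (a n y)\<^sup>2)" by (simp add: algebra_simps)
        also have "\<dots> \<le> 2 * (c y - a n y)\<^sup>2 + 2 * (m n y * (a n y)\<^sup>2)"
          using mm(2,3)[of n y] by (intro add_right_mono mult_left_le_one_le) auto
        finally show "m n y * (c y)\<^sup>2 \<le> 2 * (c y - a n y)\<^sup>2 + 2 * (m n y * (a n y)\<^sup>2)" .
      qed (use i i2 in auto)
      also have "\<dots> = 2 * (\<integral>y. (c y - a n y)\<^sup>2 \<partial>M) + 2 * (\<integral>y. m n y * (a n y)\<^sup>2 \<partial>M)"
        using i i2 by (subst Bochner_Integration.integral_add) auto
      finally show "norm (\<integral>y. m n y * (c y)\<^sup>2 \<partial>M)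
         \<le> 2 * (\<integral>y. (c y - a n y)\<^sup>2 \<partial>M) + 2 * (\<integral>y. m n y * (a n y)\<^sup>2 \<partial>M)"
        using mm by (subst real_norm_def, subst abs_of_nonneg) (auto intro!: Bochner_Integration.integral_nonneg)
    qed
  qed
  have mY: "(\<lambda>n. \<integral>y. m n y * (Y n y)\<^sup>2 \<partial>M) \<longlonglongrightarrow> 0"
    by (rule L2_tendsto_weighted_zero[OF Yl mm weighted_square_tendsto_zero[OF cL YL(2) mm mc]])
  have mZ: "(\<lambda>n. \<integral>y. m n y * (Z n y)\<^sup>2 \<partial>M) \<longlonglongrightarrow> 0"
    by (rule L2_tendsto_weighted_zero[OF Zl mm weighted_square_tendsto_zero[OF cL ZL(2) mm mc]])
  define R where "R n y = (sqrt (real n))\<^sup>2 * (iexp (X n y) - 1 - \<i> * X n y + (X n y)\<^sup>2 / 2) * (a n y)\<^sup>2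
     + 2 * sqrt (real n) * (iexp (X n y) - 1 - \<i> * X n y) * a n y * Z n y + (iexp (X n y) - 1) * (Z n y)\<^sup>2" for n y
  define z where "z n = (\<integral>y. iexp (X n y) \<partial>density M (r n))" for n
  \<comment> \<open>The three parts of R contribute (1, 0), (2, 2) and (0, 2) to the coefficients of
    the weighted Y^2 and Z^2; the mixed part is split by 2 |Y| |Z| \<le> Y^2 + Z^2.\<close>
  have Rb: "cmod (R n y) \<le> 3 * (m n y * (Y n y)\<^sup>2) + 4 * (m n y * (Z n y)\<^sup>2)" if n: "n > 0" for n y
  proof -
    let ?s = "sqrt (real n)"
    have sX: "?s * X n y = x n y" using n by (simp add: X_def)
    have "cmod ((?s)\<^sup>2 * (iexp (X n y) - 1 - \<i> * X n y + (X n y)\<^sup>2 / 2) * (a n y)\<^sup>2)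
        = ?s\<^sup>2 * cmod (iexp (X n y) - 1 - \<i> * X n y + (X n y)\<^sup>2 / 2) * (a n y)\<^sup>2"
      by (simp add: norm_mult norm_power)
    also have "\<dots> \<le> ?s\<^sup>2 * ((X n y)\<^sup>2 * m n y) * (a n y)\<^sup>2"
      unfolding m_def by (intro mult_right_mono mult_left_mono iexp_bound2) auto
    also have "\<dots> = m n y * (?s * X n y * a n y)\<^sup>2" by (simp add: power_mult_distrib)
    also have "\<dots> = m n y * (Y n y)\<^sup>2" unfolding sX Y_def ..
    finally have 1: "cmod ((?s)\<^sup>2 * (iexp (X n y) - 1 - \<i> * X n y + (X n y)\<^sup>2 / 2) * (a n y)\<^sup>2) \<le> m n y * (Y n y)\<^sup>2" .
    have "cmod (2 * ?s * (iexp (X n y) - 1 - \<i> * X n y) * a n y * Z n y)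
       = 2 * ?s * cmod (iexp (X n y) - 1 - \<i> * X n y) * \<bar>a n y\<bar> * \<bar>Z n y\<bar>"
      by (simp add: norm_mult)
    also have "\<dots> \<le> 2 * ?s * (2 * \<bar>X n y\<bar> * m n y) * \<bar>a n y\<bar> * \<bar>Z n y\<bar>"
      unfolding m_def by (intro mult_right_mono mult_left_mono iexp_bound1) auto
    also have "\<dots> = m n y * (4 * \<bar>?s * X n y * a n y\<bar> * \<bar>Z n y\<bar>)" by (simp add: abs_mult)
    also have "\<dots> = m n y * (2 * (2 * \<bar>Y n y\<bar> * \<bar>Z n y\<bar>))" unfolding sX Y_def by simp
    also have "\<dots> \<le> m n y * (2 * (\<bar>Y n y\<bar>\<^sup>2 + \<bar>Z n y\<bar>\<^sup>2))"
      by (intro mult_left_mono sum_squares_bound mm) auto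
    finally have 2: "cmod (2 * ?s * (iexp (X n y) - 1 - \<i> * X n y) * a n y * Z n y)
        \<le> 2 * (m n y * (Y n y)\<^sup>2) + 2 * (m n y * (Z n y)\<^sup>2)" by (simp add: algebra_simps)
    have "cmod ((iexp (X n y) - 1) * (Z n y)\<^sup>2) = cmod (iexp (X n y) - 1) * (Z n y)\<^sup>2"
      by (simp add: norm_mult norm_power)
    also have "\<dots> \<le> 2 * m n y * (Z n y)\<^sup>2"
      unfolding m_def by (intro mult_right_mono iexp_bound0) auto
    finally have 3: "cmod ((iexp (X n y) - 1) * (Z n y)\<^sup>2) \<le> 2 * (m n y * (Z n y)\<^sup>2)" by simp
    show ?thesis unfolding R_def
      by (rule order_trans[OF norm_triangle_ineq]) (use 1 2 3 norm_triangle_ineq in \<open>smt (verit)\<close>)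
  qed
  have Rm: "R n \<in> borel_measurable M" for n
  proof -
    have [measurable]: "a n \<in> borel_measurable M" "Z n \<in> borel_measurable M"
      by (auto intro: L2_measurable aL ZL)
    show ?thesis unfolding R_def by measurable
  qed
  have imY: "integrable M (\<lambda>y. m n y * (Y n y)\<^sup>2)" and imZ: "integrable M (\<lambda>y. m n y * (Z n y)\<^sup>2)" for n
    by (intro integrable_mult_bounded L2_integrable_square YL ZL mm)+
  have Ri: "integrable M (R n)" if "n > 0" for n
    by (rule Bochner_Integration.integrable_bound[where f="\<lambda>y. 3 * (m n y * (Y n y)\<^sup>2) + 4 * (m n y * (Z n y)\<^sup>2)"])
      (use imY imZ Rm order_trans[OF Rb[OF that] abs_ge_self] in auto)
  have R0: "(\<lambda>n. \<integral>y. R n y \<partial>M) \<longlonglongrightarrow> 0"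
  proof (rule Lim_null_comparison)
    show "(\<lambda>n. 3 * (\<integral>y. m n y * (Y n y)\<^sup>2 \<partial>M) + 4 * (\<integral>y. m n y * (Z n y)\<^sup>2 \<partial>M)) \<longlonglongrightarrow> 0"
      using tendsto_add[OF tendsto_mult_left[OF mY, of 3] tendsto_mult_left[OF mZ, of 4]] by simp
    show "\<forall>\<^sub>F n in sequentially. norm (\<integral>y. R n y \<partial>M) \<le> 3 * (\<integral>y. m n y * (Y n y)\<^sup>2 \<partial>M) + 4 * (\<integral>y. m n y * (Z n y)\<^sup>2 \<partial>M)"
      using eventually_gt_at_top[of 0]
    proof eventually_elim
      case (elim n)
      have "norm (\<integral>y. R n y \<partial>M) \<le> (\<integral>y. 3 * (m n y * (Y n y)\<^sup>2) + 4 * (m n y * (Z n y)\<^sup>2) \<partial>M)"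
        by (rule norm_integral_le_integral) (use Ri elim imY imZ Rb in auto)
      also have "\<dots> = 3 * (\<integral>y. m n y * (Y n y)\<^sup>2 \<partial>M) + 4 * (\<integral>y. m n y * (Z n y)\<^sup>2 \<partial>M)"
        using imY imZ by (subst Bochner_Integration.integral_add) auto
      finally show ?case .
    qed
  qed
  have zeq: "of_nat n * (z n - 1) = (\<integral>y. R n y \<partial>M) - complex_of_real (1/2 * (\<integral>y. (Y n y)\<^sup>2 \<partial>M))
     + \<i> * complex_of_real (2 * (\<integral>y. Y n y * Z n y \<partial>M))" if n: "n > 0" for n
  proof -
    let ?s = "sqrt (real n)"
    have sX: "?s * X n y = x n y" for y using n by (simp add: X_def)
    have [measurable]: "r n \<in> borel_measurable M" by (rule is_densityD[OF r])
    have rb: "AE y in M. 0 \<le> r n y" using is_densityD(2)[OF r] by auto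
    have bi: "integrable M (\<lambda>y. complex_of_real ((b n y)\<^sup>2))" by (intro integrable_of_real L2_integrable_square bL)
    have ebi: "integrable M (\<lambda>y. iexp (X n y) * complex_of_real ((b n y)\<^sup>2))"
      by (rule Bochner_Integration.integrable_bound[OF bi]) (use L2_measurable[OF bL] in \<open>auto simp: norm_mult\<close>)
    have "z n = (\<integral>y. r n y *\<^sub>R iexp (X n y) \<partial>M)"
      unfolding z_def by (rule integral_density) (use rb in auto)
    also have "\<dots> = (\<integral>y. iexp (X n y) * complex_of_real ((b n y)\<^sup>2) \<partial>M)"
      using is_densityD(2)[OF r] by (intro Bochner_Integration.integral_cong) (auto simp: b_def scaleR_conv_of_real)
    finally have z1: "z n = (\<integral>y. iexp (X n y) * complex_of_real ((b n y)\<^sup>2) \<partial>M)" .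
    have "(\<integral>y. complex_of_real ((b n y)\<^sup>2) \<partial>M) = 1"
      unfolding integral_complex_of_real b_def using is_densityD(7)[OF r] by simp
    then have "z n - 1 = (\<integral>y. iexp (X n y) * complex_of_real ((b n y)\<^sup>2) - complex_of_real ((b n y)\<^sup>2) \<partial>M)"
      unfolding z1 using bi ebi by (subst Bochner_Integration.integral_diff) auto
    then have "of_nat n * (z n - 1) = (\<integral>y. of_nat n * (iexp (X n y) * complex_of_real ((b n y)\<^sup>2) - complex_of_real ((b n y)\<^sup>2)) \<partial>M)"
      by simp
    also have "\<dots> = (\<integral>y. R n y + (\<i> * complex_of_real (?s * ((x n y * a n y) * a n y)) - complex_of_real (1/2 * (Y n y)\<^sup>2)
        + \<i> * complex_of_real (2 * (Y n y * Z n y))) \<partial>M)"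
    proof (rule Bochner_Integration.integral_cong[OF refl])
      fix y
      have sb: "?s * b n y = ?s * a n y + Z n y" by (simp add: Z_def algebra_simps)
      have "of_nat n * (iexp (X n y) * complex_of_real ((b n y)\<^sup>2) - complex_of_real ((b n y)\<^sup>2))
          = (iexp (X n y) - 1) * complex_of_real ((?s * b n y)\<^sup>2)"
      proof -
        have "(?s * b n y)\<^sup>2 = real n * (b n y)\<^sup>2" by (simp add: power_mult_distrib)
        then show ?thesis by (simp add: algebra_simps)
      qed
      also have "\<dots> = (iexp (X n y) - 1) * (complex_of_real ?s * a n y + Z n y)\<^sup>2"
        unfolding sb by simp
      also have "\<dots> = R n y + (\<i> * complex_of_real (?s\<^sup>2 * X n y * (a n y)\<^sup>2)
          - complex_of_real (1/2 * (?s * X n y * a n y)\<^sup>2) + \<i> * complex_of_real (2 * (?s * X n y * a n y * Z n y)))"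
      proof -
        have s2: "(complex_of_real ?s)\<^sup>2 = of_nat n" by (simp flip: of_real_power)
        show ?thesis
          unfolding iexp_square_expansion[where X="complex_of_real (X n y)"] R_def by (simp add: s2)
      qed
      also have "?s\<^sup>2 * X n y * (a n y)\<^sup>2 = ?s * ((?s * X n y * a n y) * a n y)"
        by (simp add: power2_eq_square)
      finally show "of_nat n * (iexp (X n y) * complex_of_real ((b n y)\<^sup>2) - complex_of_real ((b n y)\<^sup>2))
        = R n y + (\<i> * complex_of_real (?s * ((x n y * a n y) * a n y)) - complex_of_real (1/2 * (Y n y)\<^sup>2)
        + \<i> * complex_of_real (2 * (Y n y * Z n y)))"
        unfolding sX Y_def .
    qed
    also have "\<dots> = (\<integral>y. R n y \<partial>M) + (\<i> * complex_of_real (?s * (\<integral>y. (x n y * a n y) * a n y \<partial>M))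
       - complex_of_real (1/2 * (\<integral>y. (Y n y)\<^sup>2 \<partial>M)) + \<i> * complex_of_real (2 * (\<integral>y. Y n y * Z n y \<partial>M)))"
    proof -
      have i1: "integrable M (\<lambda>y. (x n y * a n y) * a n y)"
        using L2_integrable_mult[OF YL(1) aL, of n n] by (simp add: Y_def)
      have i2: "integrable M (\<lambda>y. (Y n y)\<^sup>2)" by (rule L2_integrable_square[OF YL(1)])
      have i3: "integrable M (\<lambda>y. Y n y * Z n y)" by (rule L2_integrable_mult[OF YL(1) ZL(1)])
      have j1: "integrable M (\<lambda>y. \<i> * complex_of_real (?s * ((x n y * a n y) * a n y)))"
        and j2: "integrable M (\<lambda>y. complex_of_real (1/2 * (Y n y)\<^sup>2))"
        and j3: "integrable M (\<lambda>y. \<i> * complex_of_real (2 * (Y n y * Z n y)))"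
        using i1 i2 i3 by (intro integrable_mult_right integrable_of_real; simp)+
      have k: "(\<integral>y. \<i> * complex_of_real (?s * ((x n y * a n y) * a n y)) \<partial>M) = \<i> * complex_of_real (?s * (\<integral>y. (x n y * a n y) * a n y \<partial>M))"
        "(\<integral>y. complex_of_real (1/2 * (Y n y)\<^sup>2) \<partial>M) = complex_of_real (1/2 * (\<integral>y. (Y n y)\<^sup>2 \<partial>M))"
        "(\<integral>y. \<i> * complex_of_real (2 * (Y n y * Z n y)) \<partial>M) = \<i> * complex_of_real (2 * (\<integral>y. Y n y * Z n y \<partial>M))"
        by (simp_all only: integral_mult_right_zero integral_complex_of_real)
      show ?thesis
        using Ri[OF n] j1 j2 j3 unfolding k[symmetric] by (simp only: Bochner_Integration.integral_add Bochner_Integration.integral_diff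
            Bochner_Integration.integrable_add Bochner_Integration.integrable_diff)
    qed
    \<comment> \<open>The only term multiplied by sqrt n is the mean of the score under
      \<open>q n\<close>, which vanishes exactly.\<close>
    also have "(\<integral>y. (x n y * a n y) * a n y \<partial>M) = 0"
      using x0[of n] integral_density_sqrt[OF q x, of n n] by (simp add: a_def)
    finally show ?thesis by simp
  qed
  have "(\<lambda>n. (\<integral>y. R n y \<partial>M) - complex_of_real (1/2 * (\<integral>y. (Y n y)\<^sup>2 \<partial>M))
     + \<i> * complex_of_real (2 * (\<integral>y. Y n y * Z n y \<partial>M)))
    \<longlonglongrightarrow> 0 - complex_of_real (1/2 * (\<integral>y. (x0 y * c y)\<^sup>2 \<partial>M))
     + \<i> * complex_of_real (2 * (\<integral>y. (x0 y * c y) * ((1/2 * (f y - g y)) * c y) \<partial>M))"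
    by (intro tendsto_intros R0 L2_tendsto_square[OF Yl] L2_tendsto_mult[OF Yl Zl])
  moreover have "(\<integral>y. (x0 y * c y)\<^sup>2 \<partial>M) = (\<integral>y. (x0 y)\<^sup>2 \<partial>density M p0)"
    unfolding c_def by (rule integral_density_square[OF p0 meas(3), symmetric])
  moreover have "2 * (\<integral>y. (x0 y * c y) * ((1/2 * (f y - g y)) * c y) \<partial>M) = (\<integral>y. x0 y * (f y - g y) \<partial>density M p0)"
    unfolding c_def using integral_density_mult[OF p0 meas(3), of "\<lambda>y. f y - g y"] meas by (simp add: mult_ac)
  moreover have "\<forall>\<^sub>F n in sequentially. (\<integral>y. R n y \<partial>M) - complex_of_real (1/2 * (\<integral>y. (Y n y)\<^sup>2 \<partial>M))
     + \<i> * complex_of_real (2 * (\<integral>y. Y n y * Z n y \<partial>M)) = of_nat n * (z n - 1)"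
    using eventually_gt_at_top[of 0] by eventually_elim (rule zeq[symmetric])
  ultimately have "(\<lambda>n. of_nat n * (z n - 1)) \<longlonglongrightarrow> - complex_of_real (1/2 * (\<integral>y. (x0 y)\<^sup>2 \<partial>density M p0))
     + \<i> * complex_of_real (\<integral>y. x0 y * (f y - g y) \<partial>density M p0)"
    by (auto elim: Lim_transform_eventually)
  then have "(\<lambda>n. z n ^ n) \<longlonglongrightarrow> exp (- complex_of_real (1/2 * (\<integral>y. (x0 y)\<^sup>2 \<partial>density M p0))
     + \<i> * complex_of_real (\<integral>y. x0 y * (f y - g y) \<partial>density M p0))"
  proof (rule tendsto_power_exp_complex)
    show "norm (z n) \<le> 1" for n
    proof -
      interpret prob_space "density M (r n)" by (rule is_densityD[OF r])
      have "norm (z n) \<le> (\<integral>y. 1 \<partial>density M (r n))"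
        unfolding z_def by (rule norm_integral_le_integral) (auto intro!: integrable_iexp)
      then show ?thesis using prob_space by simp
    qed
    have "0 \<le> (\<integral>y. (x0 y)\<^sup>2 \<partial>density M p0)" by (rule Bochner_Integration.integral_nonneg) simp
    then show "Re (- complex_of_real (1/2 * (\<integral>y. (x0 y)\<^sup>2 \<partial>density M p0))
     + \<i> * complex_of_real (\<integral>y. x0 y * (f y - g y) \<partial>density M p0)) \<le> 0" by simp
  qed
  then show ?thesis by (simp add: z_def X_def)
qed

section \<open>Maximisers of concave functions\<close>

lemma convex_ext_superlevel:
  assumes "ext_concave_on S f" shows "convex {h \<in> S. ereal r \<le> f h}"
proof (rule convexI)
  fix x y :: 'a and u v :: real
  assume xy: "x \<in> {h \<in> S. ereal r \<le> f h}" "y \<in> {h \<in> S. ereal r \<le> f h}" and uv: "0 \<le> u" "0 \<le> v" "u + v = 1"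
  have "u *\<^sub>R (x, r) + v *\<^sub>R (y, r) \<in> {(h, r). h \<in> S \<and> ereal r \<le> f h}"
    using assms xy uv unfolding ext_concave_on_def by (intro convexD) auto
  moreover have "u *\<^sub>R (x, r) + v *\<^sub>R (y, r) = (u *\<^sub>R x + v *\<^sub>R y, r)"
    using uv by (simp add: distrib_right[symmetric])
  ultimately show "u *\<^sub>R x + v *\<^sub>R y \<in> {h \<in> S. ereal r \<le> f h}" by simp
qed

lemma ext_concave_onD:
  assumes "ext_concave_on S f" "x \<in> S" "y \<in> S" "ereal a \<le> f x" "ereal b \<le> f y" "0 \<le> u" "0 \<le> v" "u + v = 1"
  shows "u *\<^sub>R x + v *\<^sub>R y \<in> S" "ereal (u * a + v * b) \<le> f (u *\<^sub>R x + v *\<^sub>R y)"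
proof -
  have "u *\<^sub>R (x, a) + v *\<^sub>R (y, b) \<in> {(h, r). h \<in> S \<and> ereal r \<le> f h}"
    using assms unfolding ext_concave_on_def by (intro convexD) auto
  then show "u *\<^sub>R x + v *\<^sub>R y \<in> S" "ereal (u * a + v * b) \<le> f (u *\<^sub>R x + v *\<^sub>R y)" by auto
qed

text \<open>The hypograph is translated by (-c, -k); keeping \<open>k\<close> real avoids
  subtracting infinities.\<close>

lemma ext_concave_on_shift:
  assumes "ext_concave_on S f"
  shows "ext_concave_on {z. c + z \<in> S} (\<lambda>z. f (c + z) - ereal k)"
proof -
  have *: "ereal (r + k) \<le> a \<longleftrightarrow> ereal r \<le> a - ereal k" for r a
    by (cases a) auto
  have "{(h, r). h \<in> {z. c + z \<in> S} \<and> ereal r \<le> f (c + h) - ereal k}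
     = (\<lambda>x. (- c, - k) + x) ` {(h, r). h \<in> S \<and> ereal r \<le> f h}" (is "?L = ?R")
  proof (rule set_eqI)
    fix x :: "'a \<times> real"
    obtain h r where x: "x = (h, r)" by (cases x)
    have "x \<in> ?R \<longleftrightarrow> c + h \<in> S \<and> ereal (r + k) \<le> f (c + h)"
      unfolding x by (force simp: image_iff add.commute intro!: bexI[of _ "(c + h, r + k)"])
    then show "x \<in> ?L \<longleftrightarrow> x \<in> ?R" unfolding x * by simp
  qed
  then show ?thesis using assms unfolding ext_concave_on_def by (simp add: convex_translation)
qed

text \<open>The net and the tolerance are fixed before the function and its domain. This order of
  quantifiers lets convergence in probability at finitely many points control a random
  maximiser.\<close>

definition argmax_net :: "('a::euclidean_space \<Rightarrow> real) \<Rightarrow> real \<Rightarrow> 'a set \<Rightarrow> real \<Rightarrow> bool" where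
  "argmax_net Q \<delta> G \<epsilon> \<longleftrightarrow> finite G \<and> 0 < \<epsilon> \<and> (\<forall>S f y. ext_concave_on S f \<longrightarrow> G \<subseteq> S
      \<longrightarrow> (\<forall>z\<in>G. \<bar>f z + ereal (Q z)\<bar> \<le> ereal \<epsilon>) \<longrightarrow> y \<in> S \<longrightarrow> (\<forall>z\<in>S. f z \<le> f y) \<longrightarrow> norm y \<le> \<delta>)"

lemma argmax_netD:
  assumes "argmax_net Q \<delta> G \<epsilon>"
  shows "finite G" "0 < \<epsilon>"
    "ext_concave_on S f \<Longrightarrow> G \<subseteq> S \<Longrightarrow> (\<And>z. z \<in> G \<Longrightarrow> \<bar>f z + ereal (Q z)\<bar> \<le> ereal \<epsilon>)
      \<Longrightarrow> y \<in> S \<Longrightarrow> (\<And>z. z \<in> S \<Longrightarrow> f z \<le> f y) \<Longrightarrow> norm y \<le> \<delta>"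
  using assms unfolding argmax_net_def by blast+

text \<open>A concave function that is close to \<open>- Q\<close> at finitely many points cannot be large far from
  the origin: a point \<open>y\<close> at distance \<open>\<delta>\<close> with \<open>f y \<ge> - \<epsilon>\<close>, averaged with a small cube around \<open>0\<close> on
  which \<open>f\<close> is bounded below, would make \<open>f\<close> too large at a point near \<open>y/2\<close> of the finite net.\<close>

lemma concave_argmax_near_zero:
  fixes Q :: "'a::euclidean_space \<Rightarrow> real"
  assumes Q: "continuous_on UNIV Q" "Q 0 = 0" "\<forall>x. x \<noteq> 0 \<longrightarrow> 0 < Q x" and \<delta>: "0 < \<delta>"
  shows "\<exists>G \<epsilon>. argmax_net Q \<delta> G \<epsilon>"
proof -
  let ?C = "sphere (0::'a) (\<delta> / 2)"
  have ne: "?C \<noteq> {}" using \<delta> by simp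
  obtain x0 where x0: "x0 \<in> ?C" "\<And>x. x \<in> ?C \<Longrightarrow> Q x0 \<le> Q x"
    using continuous_attains_inf[OF compact_sphere ne continuous_on_subset[OF Q(1) subset_UNIV]] by blast
  define lam where "lam = Q x0"
  have lam: "0 < lam" unfolding lam_def using x0 \<delta> by (intro Q(3)[rule_format]) auto
  \<comment> \<open>The final contradiction reads lam \<le> (5/2) \<epsilon>, which an eighth of lam
    rules out.\<close>
  define \<epsilon> where "\<epsilon> = lam / 8"
  have e: "0 < \<epsilon>" using lam by (simp add: \<epsilon>_def)
  have "isCont Q 0" using Q(1) by (simp add: continuous_on_eq_continuous_at)
  then obtain r where r: "0 < r" "\<And>x. norm x < r \<Longrightarrow> \<bar>Q x\<bar> < \<epsilon>"
    unfolding continuous_at_eps_delta using e Q(2) by (metis diff_zero dist_norm real_norm_def)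
  \<comment> \<open>A point of the cube with half side d has norm at most DIM d = r/2, so its
    vertices lie where Q is below \<epsilon>.\<close>
  define d where "d = r / (2 * real DIM('a))"
  have d: "0 < d" using r by (simp add: d_def)
  obtain V :: "'a set" where V: "finite V" "cbox (0 - (\<Sum>i\<in>Basis. d *\<^sub>R i)) (0 + (\<Sum>i\<in>Basis. d *\<^sub>R i)) = convex hull V"
    using cube_convex_hull[OF d] by metis
  have cb: "x \<in> convex hull V \<longleftrightarrow> (\<forall>i\<in>Basis. \<bar>x \<bullet> i\<bar> \<le> d)" for x
    unfolding V(2)[symmetric] by (auto simp: mem_box abs_le_iff)
  have Vn: "norm x < r" if "x \<in> V" for x
  proof -
    have "x \<in> convex hull V" using that by (rule hull_inc)
    then have "norm x \<le> (\<Sum>i\<in>(Basis::'a set). d)"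
      using cb norm_le_l1[of x] by (intro order_trans[OF norm_le_l1] sum_mono) auto
    also have "\<dots> < r" using r by (simp add: d_def)
    finally show ?thesis .
  qed
  obtain N where N: "finite N" "N \<subseteq> ?C" "?C \<subseteq> (\<Union>c\<in>N. ball c (d / 2))"
  proof -
    have "?C \<subseteq> (\<Union>c\<in>?C. ball c (d / 2))" using d by force
    then obtain N where "N \<subseteq> ?C" "finite N" "?C \<subseteq> (\<Union>c\<in>N. ball c (d / 2))"
      by (rule compactE_image[OF compact_sphere, rotated]) auto
    then show ?thesis by (intro that)
  qed
  define G where "G = insert 0 (V \<union> N)"
  show ?thesis
    unfolding argmax_net_def
  proof (intro exI[of _ G] exI[of _ \<epsilon>] conjI allI impI)
    show "finite G" using V N by (simp add: G_def)
    show "0 < \<epsilon>" by (rule e)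
    fix S f y
    assume conc: "ext_concave_on S f" and GS: "G \<subseteq> S"
      and cl': "\<forall>z\<in>G. \<bar>f z + ereal (Q z)\<bar> \<le> ereal \<epsilon>"
      and y: "y \<in> S" and max': "\<forall>z\<in>S. f z \<le> f y"
    note cl = bspec[OF cl'] and max = bspec[OF max']
    have lo: "ereal (- Q z - \<epsilon>) \<le> f z" and hi: "f z \<le> ereal (- Q z + \<epsilon>)" if "z \<in> G" for z
      using cl[OF that] by (cases "f z"; auto simp: abs_le_iff)+
    show "norm y \<le> \<delta>"
    proof (rule ccontr)
      assume "\<not> norm y \<le> \<delta>"
      then have ny: "\<delta> < norm y" by simp
      \<comment> \<open>By concavity the lower bound at y and at 0 persists along the segment
        between them, so y may be pulled back to norm exactly \<delta>.\<close>
      define t where "t = \<delta> / norm y"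
      have t: "0 \<le> t" "t \<le> 1" using ny \<delta> by (auto simp: t_def divide_le_eq)
      have z0: "0 \<in> G" by (simp add: G_def)
      have f0: "ereal (- \<epsilon>) \<le> f 0" using lo[OF z0] Q(2) by simp
      have "ereal (- \<epsilon>) \<le> f y" using f0 max[of 0] GS z0 by (meson order_trans subsetD)
      then have w: "t *\<^sub>R y + (1 - t) *\<^sub>R 0 \<in> S" "ereal (t * (- \<epsilon>) + (1 - t) * (- \<epsilon>)) \<le> f (t *\<^sub>R y + (1 - t) *\<^sub>R 0)"
        using ext_concave_onD[OF conc y, of 0 "- \<epsilon>" "- \<epsilon>" t "1 - t"] GS z0 f0 t by auto
      define w where "w = t *\<^sub>R y"
      have wS: "w \<in> S" and fw: "ereal (- \<epsilon>) \<le> f w" using w by (auto simp: w_def algebra_simps)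
      have "y \<noteq> 0"
      proof
        assume "y = 0" with ny \<delta> show False by simp
      qed
      then have "norm w = \<delta>" using \<delta> by (simp add: w_def t_def)
      then have "(1/2) *\<^sub>R w \<in> ?C" by simp
      then have "(1/2) *\<^sub>R w \<in> (\<Union>c\<in>N. ball c (d / 2))" by (rule subsetD[OF N(3)])
      then obtain c where c: "c \<in> N" "dist c ((1/2) *\<^sub>R w) < d / 2" by (metis UN_E mem_ball)
      \<comment> \<open>The reflection of w in the net point c, so that c is the midpoint of w and
        v. The mesh d/2 around w/2 places v inside the cube, where the hull of the vertices gives f
        v \<ge> -2 \<epsilon>.\<close>
      define v where "v = 2 *\<^sub>R c - w"
      have "norm v = 2 * dist c ((1/2) *\<^sub>R w)"
      proof -
        have "v = 2 *\<^sub>R (c - (1/2) *\<^sub>R w)" by (simp add: v_def algebra_simps)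
        then show ?thesis by (simp add: dist_norm)
      qed
      then have "norm v \<le> d" using c by simp
      then have "v \<in> convex hull V" unfolding cb using Basis_le_norm order_trans by blast
      moreover have "V \<subseteq> {h \<in> S. ereal (- 2 * \<epsilon>) \<le> f h}"
      proof safe
        fix x assume x: "x \<in> V"
        then have xG: "x \<in> G" by (simp add: G_def)
        then show "x \<in> S" using GS by auto
        have "- 2 * \<epsilon> \<le> - Q x - \<epsilon>" using r(2)[OF Vn[OF x]] by linarith
        then show "ereal (- 2 * \<epsilon>) \<le> f x" using lo[OF xG] by (meson ereal_less_eq(3) order_trans)
      qed
      then have "convex hull V \<subseteq> {h \<in> S. ereal (- 2 * \<epsilon>) \<le> f h}"
        by (rule hull_minimal) (rule convex_ext_superlevel[OF conc])
      ultimately have vS: "v \<in> S" "ereal (- 2 * \<epsilon>) \<le> f v" by auto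
      have "ereal (1/2 * (- \<epsilon>) + 1/2 * (- 2 * \<epsilon>)) \<le> f ((1/2) *\<^sub>R w + (1/2) *\<^sub>R v)"
        by (rule ext_concave_onD(2)[OF conc wS vS(1) fw vS(2)]) auto
      also have "(1/2) *\<^sub>R w + (1/2) *\<^sub>R v = c" by (simp add: v_def algebra_simps)
      also have "f c \<le> ereal (- Q c + \<epsilon>)" using c by (intro hi) (simp add: G_def)
      also have "\<dots> \<le> ereal (- lam + \<epsilon>)" using x0(2) N(2) c by (auto simp: lam_def)
      finally have "- (3/2) * \<epsilon> \<le> - lam + \<epsilon>" by simp
      then show False using lam by (simp add: \<epsilon>_def)
    qed
  qed
qed

section \<open>Convergence of characteristic functions implies weak convergence\<close>

text \<open>The phase s covers sines as well, so one kind of generator is enough and closure under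
  products is the product-to-sum formula.\<close>

inductive trig_poly :: "('a::euclidean_space \<Rightarrow> real) \<Rightarrow> bool" where
  cos: "trig_poly (\<lambda>x. c * cos (t \<bullet> x + s))"
| add: "trig_poly f \<Longrightarrow> trig_poly g \<Longrightarrow> trig_poly (\<lambda>x. f x + g x)"

lemma trig_poly_const: "trig_poly (\<lambda>x. c)"
  using trig_poly.cos[of c 0 0] by simp

lemma trig_poly_sin: "trig_poly (\<lambda>x. c * sin (t \<bullet> x))"
proof -
  have "cos (u - pi / 2) = sin u" for u :: real
    by (simp add: cos_diff)
  then show ?thesis using trig_poly.cos[of c t "- pi / 2"] by simp
qed

lemma trig_poly_sum: "(\<And>i. i \<in> I \<Longrightarrow> trig_poly (f i)) \<Longrightarrow> trig_poly (\<lambda>x. \<Sum>i\<in>I. f i x)"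
  by (induction I rule: infinite_finite_induct) (auto intro: trig_poly.add trig_poly_const)

lemma trig_poly_mult:
  assumes "trig_poly f" "trig_poly g" shows "trig_poly (\<lambda>x. f x * g x)"
  using assms(1)
proof induction
  case (cos c t s)
  show ?case using assms(2)
  proof induction
    case (cos c' t' s')
    have "(\<lambda>x. c * cos (t \<bullet> x + s) * (c' * cos (t' \<bullet> x + s')))
      = (\<lambda>x. c * c' / 2 * cos ((t - t') \<bullet> x + (s - s')) + c * c' / 2 * cos ((t + t') \<bullet> x + (s + s')))"
    proof
      fix x
      have "(t - t') \<bullet> x + (s - s') = (t \<bullet> x + s) - (t' \<bullet> x + s')"
        "(t + t') \<bullet> x + (s + s') = (t \<bullet> x + s) + (t' \<bullet> x + s')" by (simp_all add: inner_simps)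
      then show "c * cos (t \<bullet> x + s) * (c' * cos (t' \<bullet> x + s'))
        = c * c' / 2 * cos ((t - t') \<bullet> x + (s - s')) + c * c' / 2 * cos ((t + t') \<bullet> x + (s + s'))"
        by (simp only: cos_add cos_diff) (simp add: algebra_simps)
    qed
    then show ?case by (simp only: trig_poly.add[OF trig_poly.cos trig_poly.cos])
  next
    case (add f g)
    then show ?case by (simp add: distrib_left trig_poly.add)
  qed
next
  case (add f h)
  then show ?case by (simp add: distrib_right trig_poly.add)
qed

text \<open>Substituting sines for coordinates makes a polynomial bounded and periodic.
  Approximation by polynomials on a compact cube thereby becomes approximation by trigonometric
  polynomials uniformly on the whole space.\<close>

lemma trig_poly_sin_substitution:
  assumes "real_polynomial_function P"
  shows "trig_poly (\<lambda>x. P (\<Sum>i\<in>Basis. sin (c * (x \<bullet> i)) *\<^sub>R i))"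
  using assms
proof induction
  case (linear f)
  then have eq: "f (\<Sum>i\<in>Basis. sin (c * (x \<bullet> i)) *\<^sub>R i) = (\<Sum>i\<in>Basis. f i * sin ((c *\<^sub>R i) \<bullet> x))" for x
    by (simp add: linear_sum linear_cmul bounded_linear.linear inner_commute mult.commute)
  show ?case unfolding eq by (rule trig_poly_sum) (rule trig_poly_sin)
next
  case (const c)
  show ?case by (rule trig_poly_const)
next
  case (add f g)
  then show ?case by (intro trig_poly.add)
next
  case (mult f g)
  then show ?case by (intro trig_poly_mult)
qed

text \<open>The multivariate continuity theorem with a known limit law. Convergence of
  characteristic functions is convergence on trigonometric polynomials; from these it spreads to
  functions composed with a sine map, and tightness of the coordinates allows the sine map to be
  removed.\<close>

locale char_convergent =
  fixes Q :: "nat \<Rightarrow> 'a::euclidean_space measure" and L :: "'a measure"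
  assumes Q: "\<And>n. prob_space (Q n)" "\<And>n. sets (Q n) = sets borel"
    and L: "prob_space L" "sets L = sets borel"
    and char_conv: "\<And>t. (\<lambda>n. \<integral>x. iexp (t \<bullet> x) \<partial>Q n) \<longlonglongrightarrow> (\<integral>x. iexp (t \<bullet> x) \<partial>L)"
begin

definition conv :: "('a \<Rightarrow> real) \<Rightarrow> bool" where
  "conv f \<longleftrightarrow> (\<lambda>n. \<integral>x. f x \<partial>Q n) \<longlonglongrightarrow> (\<integral>x. f x \<partial>L)"

lemma measurable_eq: "f \<in> borel_measurable borel \<Longrightarrow> f \<in> borel_measurable (Q n)"
    "f \<in> borel_measurable borel \<Longrightarrow> f \<in> borel_measurable L"
  using Q(2) L(2) by (auto cong: measurable_cong_sets)

lemma integrable_bounded: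
  fixes f :: "'a \<Rightarrow> 'b::{banach, second_countable_topology}"
  assumes "f \<in> borel_measurable borel" "\<And>x. norm (f x) \<le> B"
  shows "integrable (Q n) f" "integrable L f"
  using assms Q L
  by (auto intro!: finite_measure.integrable_const_bound[where B=B] prob_space.finite_measure measurable_eq)

lemma trig_poly_conv:
  assumes "trig_poly f"
  shows "f \<in> borel_measurable borel \<and> (\<exists>B. \<forall>x. norm (f x) \<le> B) \<and> conv f"
  using assms
proof induction
  case (cos c t s)
  have m: "(\<lambda>x. iexp (t \<bullet> x)) \<in> borel_measurable borel" by measurable
  have i: "integrable (Q n) (\<lambda>x. iexp (t \<bullet> x))" "integrable L (\<lambda>x. iexp (t \<bullet> x))" for n
    by (rule integrable_bounded[OF m, of 1]; simp)+
  have eq: "(\<lambda>x. c * cos (t \<bullet> x + s)) = (\<lambda>x. Re ((c * iexp s) * iexp (t \<bullet> x)))"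
  proof
    fix x
    have eqc: "(c * iexp s) * iexp (t \<bullet> x) = complex_of_real c * cis (t \<bullet> x + s)"
      by (simp add: cis_conv_exp[symmetric] mult.assoc cis_mult add.commute)
    show "c * cos (t \<bullet> x + s) = Re ((c * iexp s) * iexp (t \<bullet> x))" unfolding eqc by simp
  qed
  have "(\<lambda>n. Re ((c * iexp s) * (\<integral>x. iexp (t \<bullet> x) \<partial>Q n))) \<longlonglongrightarrow> Re ((c * iexp s) * (\<integral>x. iexp (t \<bullet> x) \<partial>L))"
    by (intro tendsto_Re tendsto_mult_left char_conv)
  moreover have "Re ((c * iexp s) * (\<integral>x. iexp (t \<bullet> x) \<partial>N)) = (\<integral>x. c * cos (t \<bullet> x + s) \<partial>N)"
    if "integrable N (\<lambda>x. iexp (t \<bullet> x))" for N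
    unfolding eq using that
    by (subst integral_Re) (auto simp only: integral_mult_right_zero intro!: integrable_mult_right)
  ultimately have "conv (\<lambda>x. c * cos (t \<bullet> x + s))"
    using i by (simp add: conv_def)
  moreover have "norm (c * cos (t \<bullet> x + s)) \<le> \<bar>c\<bar>" for x
    by (simp add: abs_mult mult_left_le)
  ultimately show ?case by (auto intro!: exI[of _ "\<bar>c\<bar>"])
next
  case (add f g)
  then obtain B C where B: "\<And>x. norm (f x) \<le> B" and C: "\<And>x. norm (g x) \<le> C" by auto
  have m: "f \<in> borel_measurable borel" "g \<in> borel_measurable borel" using add by auto
  have "conv (\<lambda>x. f x + g x)"
    using add unfolding conv_def
    by (simp add: integrable_bounded[OF m(1) B] integrable_bounded[OF m(2) C] tendsto_add)
  moreover have "norm (f x + g x) \<le> B + C" for x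
    using norm_triangle_ineq[of "f x" "g x"] B[of x] C[of x] by linarith
  ultimately show ?case using m by auto
qed

text \<open>The error under \<open>Q n\<close> is bounded eventually rather than always, since tail
  bounds for \<open>Q n\<close> are themselves consequences of convergence.\<close>

lemma conv_approx:
  assumes f: "f \<in> borel_measurable borel" "\<And>x. norm (f x) \<le> B"
    and ap: "\<And>e. 0 < e \<Longrightarrow> \<exists>g. g \<in> borel_measurable borel \<and> (\<exists>C. \<forall>x. norm (g x) \<le> C) \<and> conv g
        \<and> (\<forall>\<^sub>F n in sequentially. \<bar>(\<integral>x. f x \<partial>Q n) - (\<integral>x. g x \<partial>Q n)\<bar> \<le> e)
        \<and> \<bar>(\<integral>x. f x \<partial>L) - (\<integral>x. g x \<partial>L)\<bar> \<le> e"
  shows "conv f"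
  unfolding conv_def
proof (rule LIMSEQ_I)
  fix e :: real assume "0 < e"
  then have "0 < e / 4" by simp
  from ap[OF this] obtain g where g: "conv g"
    "\<forall>\<^sub>F n in sequentially. \<bar>(\<integral>x. f x \<partial>Q n) - (\<integral>x. g x \<partial>Q n)\<bar> \<le> e / 4"
    "\<bar>(\<integral>x. f x \<partial>L) - (\<integral>x. g x \<partial>L)\<bar> \<le> e / 4" by auto
  have "\<forall>\<^sub>F n in sequentially. \<bar>(\<integral>x. g x \<partial>Q n) - (\<integral>x. g x \<partial>L)\<bar> < e / 4"
    using tendstoD[OF g(1)[unfolded conv_def] \<open>0 < e / 4\<close>] by (simp add: dist_real_def)
  with g(2) have "\<forall>\<^sub>F n in sequentially. norm ((\<integral>x. f x \<partial>Q n) - (\<integral>x. f x \<partial>L)) < e"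
  proof eventually_elim
    case (elim n)
    then show ?case using g(3) \<open>0 < e\<close> unfolding real_norm_def by linarith
  qed
  then show "\<exists>N. \<forall>n\<ge>N. norm ((\<integral>x. f x \<partial>Q n) - (\<integral>x. f x \<partial>L)) < e"
    by (simp add: eventually_sequentially)
qed

lemma integral_diff_le:
  fixes f g h :: "'a \<Rightarrow> real"
  assumes "integrable N f" "integrable N g" "integrable N h" "\<And>x. \<bar>f x - g x\<bar> \<le> h x"
  shows "\<bar>(\<integral>x. f x \<partial>N) - (\<integral>x. g x \<partial>N)\<bar> \<le> (\<integral>x. h x \<partial>N)"
proof -
  have "\<bar>(\<integral>x. f x \<partial>N) - (\<integral>x. g x \<partial>N)\<bar> = \<bar>\<integral>x. f x - g x \<partial>N\<bar>" using assms by simp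
  also have "\<dots> \<le> (\<integral>x. \<bar>f x - g x\<bar> \<partial>N)" by (rule integral_abs_bound)
  also have "\<dots> \<le> (\<integral>x. h x \<partial>N)" using assms by (intro integral_mono) auto
  finally show ?thesis .
qed

text \<open>All values of the vector of sines lie in one compact cube, where Stone-Weierstrass
  applies; hence the error is uniform over the whole space and no tail has to be controlled.\<close>

lemma conv_sin_substitution:
  assumes f: "continuous_on UNIV f" "\<And>x. \<bar>f x\<bar> \<le> B"
  shows "conv (\<lambda>x. f ((1 / c) *\<^sub>R (\<Sum>i\<in>Basis. sin (c * (x \<bullet> i)) *\<^sub>R i)))"
proof (rule conv_approx)
  let ?S = "\<lambda>x. \<Sum>i\<in>Basis. sin (c * (x \<bullet> i)) *\<^sub>R i"
  let ?F = "\<lambda>x. f ((1 / c) *\<^sub>R ?S x)"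
  have "continuous_on UNIV ?F"
    by (rule continuous_on_compose2[OF f(1)]) (auto intro!: continuous_intros)
  then show Fm: "?F \<in> borel_measurable borel" by (rule borel_measurable_continuous_onI)
  show Fb: "norm (?F x) \<le> B" for x using f(2) by simp
  fix e :: real assume e: "0 < e"
  let ?K = "cbox (- One) (One :: 'a)"
  have "continuous_on ?K (\<lambda>y. f ((1 / c) *\<^sub>R y))"
    by (rule continuous_on_compose2[OF f(1)]) (auto intro!: continuous_intros)
  then obtain P where P: "real_polynomial_function P" "\<And>y. y \<in> ?K \<Longrightarrow> \<bar>f ((1 / c) *\<^sub>R y) - P y\<bar> < e"
    using Stone_Weierstrass_real_polynomial_function[OF compact_cbox _ e] by metis
  have SK: "?S x \<in> ?K" for x by (auto simp: mem_box)
  have ap: "\<bar>?F x - P (?S x)\<bar> \<le> e" for x using P(2)[OF SK] by (simp add: less_imp_le)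
  note T = trig_poly_conv[OF trig_poly_sin_substitution[OF P(1), of c]]
  then obtain C where C: "\<And>x. norm (P (?S x)) \<le> C" by auto
  have Tm: "(\<lambda>x. P (?S x)) \<in> borel_measurable borel" using T by simp
  have "\<bar>(\<integral>x. ?F x \<partial>Q n) - (\<integral>x. P (?S x) \<partial>Q n)\<bar> \<le> (\<integral>x. e \<partial>Q n)" for n
    by (intro integral_diff_le ap integrable_bounded[OF Fm Fb] integrable_bounded[OF Tm C] integrable_bounded[of _ e]) (use e in auto)
  moreover have "\<bar>(\<integral>x. ?F x \<partial>L) - (\<integral>x. P (?S x) \<partial>L)\<bar> \<le> (\<integral>x. e \<partial>L)"
    by (intro integral_diff_le ap integrable_bounded[OF Fm Fb] integrable_bounded[OF Tm C] integrable_bounded[of _ e]) (use e in auto)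
  ultimately show "\<exists>g. g \<in> borel_measurable borel \<and> (\<exists>C. \<forall>x. norm (g x) \<le> C) \<and> conv g
        \<and> (\<forall>\<^sub>F n in sequentially. \<bar>(\<integral>x. ?F x \<partial>Q n) - (\<integral>x. g x \<partial>Q n)\<bar> \<le> e)
        \<and> \<bar>(\<integral>x. ?F x \<partial>L) - (\<integral>x. g x \<partial>L)\<bar> \<le> e"
    using T prob_space.prob_space[OF Q(1)] prob_space.prob_space[OF L(1)]
    by (intro exI[of _ "\<lambda>x. P (?S x)"]) auto
qed

text \<open>The one-dimensional continuity theorem of Levy applied to projections; it is the source
  of tightness below.\<close>

lemma marginal_conv:
  assumes h: "\<And>u. isCont h u" "\<And>u. norm (h u) \<le> B"
  shows "conv (\<lambda>x. h (x \<bullet> i))"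
proof -
  have mi[measurable]: "(\<lambda>x. x \<bullet> i) \<in> borel_measurable (Q n)" "(\<lambda>x. x \<bullet> i) \<in> borel_measurable L" for n
    by (auto intro!: measurable_eq)
  have hm: "h \<in> borel_measurable borel"
    using h(1) by (intro borel_measurable_continuous_onI) (simp add: continuous_on_eq_continuous_at)
  let ?Q = "\<lambda>n. distr (Q n) borel (\<lambda>x. x \<bullet> i)" and ?L = "distr L borel (\<lambda>x. x \<bullet> i)"
  have rQ: "real_distribution (?Q n)" for n
    using prob_space.prob_space_distr[OF Q(1) mi(1)] by (simp add: real_distribution_def real_distribution_axioms_def)
  have rL: "real_distribution ?L"
    using prob_space.prob_space_distr[OF L(1) mi(2)] by (simp add: real_distribution_def real_distribution_axioms_def)
  have ch: "char (?Q n) t = (\<integral>x. iexp ((t *\<^sub>R i) \<bullet> x) \<partial>Q n)" "char ?L t = (\<integral>x. iexp ((t *\<^sub>R i) \<bullet> x) \<partial>L)" for n t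
    unfolding char_def by (subst integral_distr; simp add: inner_commute)+
  have "weak_conv_m ?Q ?L"
    by (rule levy_continuity[OF rQ rL]) (simp only: ch char_conv)
  from weak_conv_imp_integral_bdd_continuous_conv[OF rQ rL this h]
  show ?thesis unfolding conv_def
    using hm by (subst (asm) (1 2) integral_distr) auto
qed

theorem weak_convergence: "weakly_converges Q L"
  unfolding weakly_converges_def
proof (intro allI impI)
  fix f :: "'a \<Rightarrow> real" assume f: "continuous_on UNIV f" "bounded (range f)"
  obtain B where B: "\<And>x. \<bar>f x\<bar> \<le> B" using f(2) by (auto simp: bounded_iff)
  have B0: "0 \<le> B" using B[of 0] by linarith
  have fm: "f \<in> borel_measurable borel" using f(1) by (rule borel_measurable_continuous_onI)
  have "conv f"
  proof (rule conv_approx[OF fm])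
    show "norm (f x) \<le> B" for x using B by simp
    fix e :: real assume e: "0 < e"
    \<comment> \<open>A continuous substitute for the tail indicator: the sum \<open>h K\<close> is
      at least 1 outside the cube of half side K, and as a sum of functions of single coordinates
      its integrals converge.\<close>
    define psi where "psi K u = min 1 (\<bar>u\<bar> / K)" for K u :: real
    define h where "h K x = (\<Sum>i\<in>Basis. psi K (x \<bullet> i))" for K and x :: 'a
    have psib: "0 \<le> psi K u" "psi K u \<le> 1" if "K > 0" for K u using that by (auto simp: psi_def)
    have psic: "isCont (psi K) u" for K u unfolding psi_def divide_inverse by (intro continuous_intros)
    have hc: "continuous_on UNIV (h K)" for K
      unfolding h_def psi_def divide_inverse by (intro continuous_intros)
    have hm: "h K \<in> borel_measurable borel" for K by (rule borel_measurable_continuous_onI[OF hc])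
    have h0: "0 \<le> h K x" and hb: "norm (h K x) \<le> DIM('a)" if "K > 0" for K x
    proof -
      show "0 \<le> h K x" unfolding h_def by (intro sum_nonneg psib that)
      moreover have "h K x \<le> (\<Sum>i\<in>(Basis::'a set). 1)" unfolding h_def by (intro sum_mono psib that)
      ultimately show "norm (h K x) \<le> DIM('a)" by simp
    qed
    have "(\<lambda>k. \<integral>x. h (real (Suc k)) x \<partial>L) \<longlonglongrightarrow> (\<integral>x. 0 \<partial>L)"
    proof (rule integral_dominated_convergence[where w="\<lambda>_. DIM('a)"])
      show "integrable L (\<lambda>_. real DIM('a))" by (rule integrable_bounded(2)[of _ "DIM('a)"]) auto
      have "(\<lambda>k. h (real (Suc k)) x) \<longlonglongrightarrow> (\<Sum>i\<in>(Basis::'a set). 0)" for x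
        unfolding h_def
      proof (rule tendsto_sum)
        fix i :: 'a
        have "(\<lambda>k. \<bar>x \<bullet> i\<bar> * (1 / real (Suc k))) \<longlonglongrightarrow> \<bar>x \<bullet> i\<bar> * 0"
          by (intro tendsto_mult tendsto_const LIMSEQ_Suc[OF lim_1_over_n])
        then have "(\<lambda>k. min 1 (\<bar>x \<bullet> i\<bar> / real (Suc k))) \<longlonglongrightarrow> min 1 0"
          by (intro tendsto_min tendsto_const) simp
        then show "(\<lambda>k. psi (real (Suc k)) (x \<bullet> i)) \<longlonglongrightarrow> 0" by (simp add: psi_def)
      qed
      then show "AE x in L. (\<lambda>k. h (real (Suc k)) x) \<longlonglongrightarrow> 0" by simp
      show "AE x in L. norm (h (real (Suc k)) x) \<le> real DIM('a)" for k using hb[of "real (Suc k)"] by auto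
    qed (use measurable_eq(2)[OF hm] in auto)
    then have l0: "(\<lambda>k. \<integral>x. h (real (Suc k)) x \<partial>L) \<longlonglongrightarrow> 0" by simp
    \<comment> \<open>Chosen so that 2 B d \<le> e/2; the summand 1 keeps the denominator positive
      when B = 0.\<close>
    define d where "d = e / (2 * (2 * B + 1))"
    have d: "0 < d" using e B0 by (simp add: d_def)
    have "\<forall>\<^sub>F k in sequentially. (\<integral>x. h (real (Suc k)) x \<partial>L) < d"
      by (rule order_tendstoD(2)[OF l0 d])
    then obtain k where k: "(\<integral>x. h (real (Suc k)) x \<partial>L) < d" by (auto simp: eventually_sequentially)
    define K where "K = real (Suc k)"
    have K: "0 < K" by (simp add: K_def)
    have "conv (\<lambda>x. psi K (x \<bullet> i))" for i
      by (rule marginal_conv[where B=1, OF psic]) (use psib[OF K] in auto)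
    then have "(\<lambda>n. \<Sum>i\<in>Basis. \<integral>x. psi K (x \<bullet> i) \<partial>Q n) \<longlonglongrightarrow> (\<Sum>i\<in>Basis. \<integral>x. psi K (x \<bullet> i) \<partial>L)"
      unfolding conv_def by (intro tendsto_sum)
    moreover have "integrable (Q n) (\<lambda>x. psi K (x \<bullet> i))" "integrable L (\<lambda>x. psi K (x \<bullet> i))" for n i
      by (rule integrable_bounded[of _ 1]; use psib[OF K] in \<open>auto simp: psi_def\<close>)+
    ultimately have "conv (h K)" unfolding conv_def h_def by (simp add: Bochner_Integration.integral_sum)
    then have ev: "\<forall>\<^sub>F n in sequentially. (\<integral>x. h K x \<partial>Q n) < d"
      unfolding conv_def by (rule order_tendstoD) (use k in \<open>simp add: K_def\<close>)
    let ?K = "cbox (- (K *\<^sub>R One)) (K *\<^sub>R One :: 'a)"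
    have mK: "x \<in> ?K \<longleftrightarrow> (\<forall>i\<in>Basis. \<bar>x \<bullet> i\<bar> \<le> K)" for x
      by (auto simp: mem_box abs_le_iff)
    have hK: "1 \<le> h K x" if "x \<notin> ?K" for x
    proof -
      have "\<exists>i\<in>Basis. K < \<bar>x \<bullet> i\<bar>" using that unfolding mK by (simp add: not_le)
      then obtain i where i: "i \<in> Basis" "K < \<bar>x \<bullet> i\<bar>" by blast
      have "psi K (x \<bullet> i) = 1" using i K by (simp add: psi_def)
      moreover have "psi K (x \<bullet> i) \<le> h K x" unfolding h_def by (rule member_le_sum) (use i psib[OF K] in auto)
      ultimately show ?thesis by simp
    qed
    have "uniformly_continuous_on ?K f"
      by (rule compact_uniformly_continuous[OF continuous_on_subset[OF f(1)]]) auto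
    then obtain r where r: "0 < r" "\<And>x y. x \<in> ?K \<Longrightarrow> y \<in> ?K \<Longrightarrow> dist y x < r \<Longrightarrow> dist (f y) (f x) < e / 2"
      using e unfolding uniformly_continuous_on_def by (metis half_gt_zero)
    \<comment> \<open>On the cube sin (c u) / c differs from u by at most c K^2 / 2, so this c makes
      the sum over the coordinates r/2.\<close>
    define c where "c = r / (DIM('a) * K\<^sup>2)"
    have c: "0 < c" using r K by (simp add: c_def)
    let ?G = "\<lambda>x. (1 / c) *\<^sub>R (\<Sum>i\<in>Basis. sin (c * (x \<bullet> i)) *\<^sub>R (i::'a))"
    have Gi: "?G x \<bullet> i = sin (c * (x \<bullet> i)) / c" if "i \<in> Basis" for x i
      using that by (simp add: inner_sum_left inner_Basis if_distrib sum.delta cong: if_cong)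
    have GK: "?G x \<in> ?K" if "x \<in> ?K" for x
      unfolding mK
    proof
      fix i :: 'a assume i: "i \<in> Basis"
      have "\<bar>sin (c * (x \<bullet> i)) / c\<bar> \<le> \<bar>c * (x \<bullet> i)\<bar> / c"
        using c by (simp add: abs_divide divide_right_mono abs_sin_x_le_abs_x)
      also have "\<dots> = \<bar>x \<bullet> i\<bar>" using c by (simp add: abs_mult)
      finally show "\<bar>?G x \<bullet> i\<bar> \<le> K" unfolding Gi[OF i] using that i mK by (meson order_trans)
    qed
    have Gd: "dist (?G x) x < r" if "x \<in> ?K" for x
    proof -
      have "norm (?G x - x) \<le> (\<Sum>i\<in>Basis. \<bar>(?G x - x) \<bullet> i\<bar>)" by (rule norm_le_l1)
      also have "\<dots> \<le> (\<Sum>i\<in>(Basis::'a set). c * K\<^sup>2 / 2)"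
      proof (rule sum_mono)
        fix i :: 'a assume i: "i \<in> Basis"
        let ?u = "x \<bullet> i"
        have "\<bar>sin (c * ?u) - (\<Sum>m<2. sin_coeff m * (c * ?u) ^ m)\<bar> \<le> inverse (fact 2) * \<bar>c * ?u\<bar> ^ 2"
          by (rule Maclaurin_sin_bound)
        then have sb: "\<bar>sin (c * ?u) - c * ?u\<bar> \<le> (c * ?u)\<^sup>2 / 2"
          by (simp add: eval_nat_numeral sin_coeff_def)
        have "(?G x - x) \<bullet> i = (sin (c * ?u) - c * ?u) / c"
          unfolding inner_diff_left Gi[OF i] using c by (simp add: diff_divide_distrib)
        then have "\<bar>(?G x - x) \<bullet> i\<bar> = \<bar>sin (c * ?u) - c * ?u\<bar> / c"
          using c by (simp only: abs_divide abs_of_pos)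
        also have "\<dots> \<le> (c * ?u)\<^sup>2 / 2 / c"
          using sb c by (intro divide_right_mono) auto
        also have "\<dots> = c * ?u\<^sup>2 / 2" using c by (simp add: power2_eq_square)
        also have "\<dots> \<le> c * K\<^sup>2 / 2"
        proof -
          have "\<bar>?u\<bar> \<le> K" using that i mK by blast
          then have "?u\<^sup>2 \<le> K\<^sup>2" by (metis abs_ge_zero power2_abs power_mono)
          then show ?thesis using c by simp
        qed
        finally show "\<bar>(?G x - x) \<bullet> i\<bar> \<le> c * K\<^sup>2 / 2" .
      qed
      also have "\<dots> < r" using r K by (simp add: c_def)
      finally show ?thesis by (simp add: dist_norm)
    qed
    \<comment> \<open>Inside the cube uniform continuity applies, because the sine map keeps the
      cube invariant; outside, the trivial bound 2 B is charged to the tail function.\<close>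
    have ap: "\<bar>f x - f (?G x)\<bar> \<le> e / 2 + 2 * B * h K x" for x
    proof (cases "x \<in> ?K")
      case True
      have "dist (f (?G x)) (f x) < e / 2" by (rule r(2)[OF True GK[OF True] Gd[OF True]])
      moreover have "0 \<le> 2 * B * h K x" using B0 h0[OF K] by simp
      ultimately show ?thesis by (simp add: dist_real_def abs_minus_commute)
    next
      case False
      have "\<bar>f x - f (?G x)\<bar> \<le> 2 * B" using B[of x] B[of "?G x"] by linarith
      also have "\<dots> \<le> 2 * B * h K x" using mult_left_mono[OF hK[OF False], of "2 * B"] B0 by simp
      finally show ?thesis using e by simp
    qed
    have Gc: "continuous_on UNIV (\<lambda>x. f (?G x))"
      by (rule continuous_on_compose2[OF f(1)]) (auto intro!: continuous_intros)
    have Gm: "(\<lambda>x. f (?G x)) \<in> borel_measurable borel" by (rule borel_measurable_continuous_onI[OF Gc])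
    have Bn: "norm (f x) \<le> B" for x using B by simp
    have bnd: "e / 2 + 2 * B * d \<le> e"
    proof -
      have "2 * B * d \<le> (2 * B + 1) * d" using d by simp
      also have "\<dots> = e / 2"
      proof -
        have "k * (e / (2 * k)) = e / 2" if "0 < k" for k :: real using that by simp
        from this[of "2 * B + 1"] show ?thesis using B0 unfolding d_def by linarith
      qed
      finally show ?thesis by simp
    qed
    have main: "\<bar>(\<integral>x. f x \<partial>N) - (\<integral>x. f (?G x) \<partial>N)\<bar> \<le> e"
      if N: "prob_space N" "integrable N f" "integrable N (\<lambda>x. f (?G x))" "integrable N (h K)" "(\<integral>x. h K x \<partial>N) < d" for N
    proof -
      interpret N: prob_space N by fact
      have "\<bar>(\<integral>x. f x \<partial>N) - (\<integral>x. f (?G x) \<partial>N)\<bar> \<le> (\<integral>x. e / 2 + 2 * B * h K x \<partial>N)"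
        by (rule integral_diff_le[OF N(2,3) _ ap]) (use N(4) in auto)
      also have "\<dots> = e / 2 + 2 * B * (\<integral>x. h K x \<partial>N)"
        using N(4) by (simp add: N.prob_space)
      also have "\<dots> \<le> e / 2 + 2 * B * d" using N(5) B0 by (intro add_left_mono mult_left_mono) auto
      finally show ?thesis using bnd by linarith
    qed
    show "\<exists>g. g \<in> borel_measurable borel \<and> (\<exists>C. \<forall>x. norm (g x) \<le> C) \<and> conv g
        \<and> (\<forall>\<^sub>F n in sequentially. \<bar>(\<integral>x. f x \<partial>Q n) - (\<integral>x. g x \<partial>Q n)\<bar> \<le> e)
        \<and> \<bar>(\<integral>x. f x \<partial>L) - (\<integral>x. g x \<partial>L)\<bar> \<le> e"
    proof (intro exI conjI allI)
      show "(\<lambda>x. f (?G x)) \<in> borel_measurable borel" by (rule Gm)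
      show "norm (f (?G x)) \<le> B" for x by (rule Bn)
      show "conv (\<lambda>x. f (?G x))" by (rule conv_sin_substitution[OF f(1) B])
      show "\<forall>\<^sub>F n in sequentially. \<bar>(\<integral>x. f x \<partial>Q n) - (\<integral>x. f (?G x) \<partial>Q n)\<bar> \<le> e"
        using ev by eventually_elim
          (intro main Q integrable_bounded(1)[OF fm Bn] integrable_bounded(1)[OF Gm Bn] integrable_bounded(1)[OF hm hb[OF K]])
      show "\<bar>(\<integral>x. f x \<partial>L) - (\<integral>x. f (?G x) \<partial>L)\<bar> \<le> e"
        by (intro main L integrable_bounded(2)[OF fm Bn] integrable_bounded(2)[OF Gm Bn] integrable_bounded(2)[OF hm hb[OF K]])
          (use k in \<open>simp add: K_def\<close>)
    qed
  qed
  then show "(\<lambda>n. \<integral>x. f x \<partial>Q n) \<longlonglongrightarrow> (\<integral>x. f x \<partial>L)" by (simp add: conv_def)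
qed

end

section \<open>Gaussian laws\<close>

lemma linear_borel_measurable:
  fixes f :: "'a::euclidean_space \<Rightarrow> 'b::euclidean_space"
  assumes "linear f" shows "f \<in> borel_measurable borel"
  using assms by (metis borel_measurable_continuous_onI linear_continuous_on linear_conv_bounded_linear)

text \<open>With all coordinates but the m-th held fixed, the shear translates that coordinate by
  the constant x$n, and Lebesgue measure on the line is translation invariant. Fubini in the m-th
  coordinate does the rest.\<close>

lemma nn_integral_lborel_shear:
  fixes h :: "real^'n \<Rightarrow> ennreal"
  assumes [measurable]: "h \<in> borel_measurable borel" and mn: "m \<noteq> n"
  shows "(\<integral>\<^sup>+x. h (\<chi> i. if i = m then x$m + x$n else x$i) \<partial>lborel) = (\<integral>\<^sup>+x. h x \<partial>lborel)"
proof -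
  let ?em = "axis m 1 :: real^'n" and ?en = "axis n 1 :: real^'n"
  let ?I = "Basis - {?em}"
  let ?S = "\<lambda>f. \<Sum>b\<in>Basis. f b *\<^sub>R (b::real^'n)"
  let ?F = "\<lambda>x::real^'n. \<chi> i. if i = m then x$m + x$n else x$i"
  have em: "?em \<in> Basis" by (simp add: axis_in_Basis_iff)
  interpret product_sigma_finite "\<lambda>_::real^'n. lborel :: real measure" ..
  have ins: "insert ?em ?I = Basis" using em by auto
  have comp: "?S f $ i = f (axis i 1)" for f i
    using inner_sum_left_Basis[of "axis i 1" f] by (simp add: axis_in_Basis_iff inner_axis)
  have "linear ?F"
    by (rule linearI) (auto simp: vec_eq_iff algebra_simps)
  then have Fm[measurable]: "?F \<in> borel_measurable borel"
    by (rule linear_borel_measurable)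
  have Sm[measurable]: "?S \<in> borel_measurable (Pi\<^sub>M Basis (\<lambda>_. lborel))" by measurable
  have red: "(\<integral>\<^sup>+x. g x \<partial>lborel) = (\<integral>\<^sup>+f. (\<integral>\<^sup>+y. g (?S (f(?em := y))) \<partial>lborel) \<partial>Pi\<^sub>M ?I (\<lambda>_. lborel))"
    if [measurable]: "g \<in> borel_measurable borel" for g :: "real^'n \<Rightarrow> ennreal"
  proof -
    have "(\<integral>\<^sup>+x. g x \<partial>lborel) = (\<integral>\<^sup>+f. g (?S f) \<partial>Pi\<^sub>M (insert ?em ?I) (\<lambda>_. lborel))"
      unfolding ins by (subst lborel_eq) (subst nn_integral_distr, auto)
    also have "\<dots> = (\<integral>\<^sup>+f. (\<integral>\<^sup>+y. g (?S (f(?em := y))) \<partial>lborel) \<partial>Pi\<^sub>M ?I (\<lambda>_. lborel))"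
      by (rule product_nn_integral_insert) (auto simp: ins)
    finally show ?thesis .
  qed
  have sh: "?F (?S (f(?em := y))) = ?S (f(?em := f ?en + 1 * y))" for f y
  proof (rule vec_eq_iff[THEN iffD2], rule allI)
    fix i
    show "?F (?S (f(?em := y))) $ i = ?S (f(?em := f ?en + 1 * y)) $ i"
      by (simp only: vec_lambda_beta comp fun_upd_apply axis_eq_axis) (use mn in auto)
  qed
  have "(\<integral>\<^sup>+x. h (?F x) \<partial>lborel) = (\<integral>\<^sup>+f. (\<integral>\<^sup>+y. h (?F (?S (f(?em := y)))) \<partial>lborel) \<partial>Pi\<^sub>M ?I (\<lambda>_. lborel))"
    by (rule red) measurable
  also have "\<dots> = (\<integral>\<^sup>+f. (\<integral>\<^sup>+y. h (?S (f(?em := y))) \<partial>lborel) \<partial>Pi\<^sub>M ?I (\<lambda>_. lborel))"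
  proof (rule nn_integral_cong)
    fix f
    have m: "(\<lambda>y. h (?S (f(?em := y)))) \<in> borel_measurable borel"
    proof -
      have "(\<lambda>y. ?S (f(?em := y))) \<in> borel_measurable borel"
        unfolding fun_upd_def by measurable
      then show ?thesis by measurable
    qed
    show "(\<integral>\<^sup>+y. h (?F (?S (f(?em := y)))) \<partial>lborel) = (\<integral>\<^sup>+y. h (?S (f(?em := y))) \<partial>lborel)"
      unfolding sh using nn_integral_real_affine[OF m, of 1 "f ?en"] by simp
  qed
  also have "\<dots> = (\<integral>\<^sup>+x. h x \<partial>lborel)" by (rule red[symmetric]) measurable
  finally show ?thesis .
qed

lemma bij_betw_axis: "bij_betw (\<lambda>i. axis i (1::real)) UNIV (Basis :: (real^'n) set)"
  by (rule bij_betwI[where g=axis_index]) (auto simp: axis_in_Basis_iff axis_index[symmetric])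

text \<open>Lebesgue measure is determined by its values on boxes, and exchanging coordinates only
  permutes the side lengths in the product.\<close>

lemma nn_integral_lborel_swap:
  fixes h :: "real^'n \<Rightarrow> ennreal"
  assumes [measurable]: "h \<in> borel_measurable borel"
  shows "(\<integral>\<^sup>+x. h (\<chi> i. x $ Transposition.transpose m n i) \<partial>lborel) = (\<integral>\<^sup>+x. h x \<partial>lborel)"
proof -
  let ?F = "\<lambda>x::real^'n. \<chi> i. x $ Transposition.transpose m n i"
  have "linear ?F"
    by (rule linearI) (auto simp: vec_eq_iff)
  then have Fm[measurable]: "?F \<in> borel_measurable borel"
    by (rule linear_borel_measurable)
  have "lborel = distr lborel borel ?F"
  proof (rule lborel_eqI)
    fix l u :: "real^'n" assume lu: "\<And>b. b \<in> Basis \<Longrightarrow> l \<bullet> b \<le> u \<bullet> b"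
    have lu': "l $ i \<le> u $ i" for i using lu[of "axis i 1"] by (simp add: axis_in_Basis_iff inner_axis)
    have vim: "?F -` box l u = box (?F l) (?F u)"
    proof -
      have "(\<forall>i. l $ i < x $ Transposition.transpose m n i \<and> x $ Transposition.transpose m n i < u $ i)
        \<longleftrightarrow> (\<forall>i. l $ Transposition.transpose m n i < x $ i \<and> x $ i < u $ Transposition.transpose m n i)" for x :: "real^'n"
        by (metis transpose_involutory)
      then show ?thesis by (auto simp: set_eq_iff mem_box_cart)
    qed
    have "emeasure (distr lborel borel ?F) (box l u) = emeasure lborel (box (?F l) (?F u))"
      by (subst emeasure_distr) (auto simp: vim)
    also have "\<dots> = (\<Prod>b\<in>Basis. (?F u - ?F l) \<bullet> b)"
      by (subst emeasure_lborel_box) (auto simp: bij_betw_imp_surj_on[OF bij_betw_axis, symmetric] inner_axis lu' prod_ennreal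
        simp flip: inner_diff_left intro!: prod_nonneg)
    also have "(\<Prod>b\<in>Basis. (?F u - ?F l) \<bullet> b) = (\<Prod>i\<in>UNIV. (u - l) $ Transposition.transpose m n i)"
      by (subst prod.reindex_bij_betw[OF bij_betw_axis, symmetric]) (simp add: inner_axis)
    also have "\<dots> = (\<Prod>i\<in>UNIV. (u - l) $ i)"
      by (rule prod.permute[OF permutes_swap_id, symmetric, unfolded o_def]) auto
    also have "\<dots> = (\<Prod>b\<in>Basis. (u - l) \<bullet> b)"
      by (subst prod.reindex_bij_betw[OF bij_betw_axis, symmetric]) (simp add: inner_axis)
    finally show "emeasure (distr lborel borel ?F) (box l u) = (\<Prod>b\<in>Basis. (u - l) \<bullet> b)" .
  qed simp
  then have "(\<integral>\<^sup>+x. h x \<partial>lborel) = (\<integral>\<^sup>+x. h x \<partial>distr lborel borel ?F)" by simp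
  also have "\<dots> = (\<integral>\<^sup>+x. h (?F x) \<partial>lborel)" by (rule nn_integral_distr) auto
  finally show ?thesis by simp
qed

lemma nn_integral_lborel_diagonal:
  fixes h :: "real^'n \<Rightarrow> ennreal"
  assumes [measurable]: "h \<in> borel_measurable borel" and c: "\<And>i. c i \<noteq> 0"
  shows "ennreal \<bar>\<Prod>i\<in>UNIV. c i\<bar> * (\<integral>\<^sup>+x. h (\<chi> i. c i * x $ i) \<partial>lborel) = (\<integral>\<^sup>+x. h x \<partial>lborel)"
proof -
  let ?F = "\<lambda>x::real^'n. \<chi> i. c i * x $ i"
  have "linear ?F"
    by (rule linearI) (auto simp: vec_eq_iff algebra_simps)
  then have Fm[measurable]: "?F \<in> borel_measurable borel"
    by (rule linear_borel_measurable)
  have F: "?F x = 0 + (\<Sum>j\<in>Basis. (c (axis_index j) * (x \<bullet> j)) *\<^sub>R j)" for x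
  proof (rule vec_eq_iff[THEN iffD2], rule allI)
    fix i
    have "(\<Sum>j\<in>Basis. (c (axis_index j) * (x \<bullet> j)) *\<^sub>R j) \<bullet> axis i 1 = c i * (x \<bullet> axis i 1)"
      by (subst inner_sum_left_Basis) (auto simp: axis_in_Basis_iff)
    then show "?F x $ i = (0 + (\<Sum>j\<in>Basis. (c (axis_index j) * (x \<bullet> j)) *\<^sub>R j)) $ i"
      by (simp add: inner_axis)
  qed
  have "lborel = density (distr lborel borel ?F) (\<lambda>_. ennreal (\<Prod>j\<in>Basis. \<bar>c (axis_index (j::real^'n))\<bar>))"
    unfolding F by (rule lborel_affine_euclidean) (rule c)
  also have "(\<Prod>j\<in>Basis. \<bar>c (axis_index (j::real^'n))\<bar>) = \<bar>\<Prod>i\<in>UNIV. c i\<bar>"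
    by (subst prod.reindex_bij_betw[OF bij_betw_axis, symmetric]) (simp add: abs_prod)
  finally have "(\<integral>\<^sup>+x. h x \<partial>lborel) = (\<integral>\<^sup>+x. h x \<partial>density (distr lborel borel ?F) (\<lambda>_. ennreal \<bar>\<Prod>i\<in>UNIV. c i\<bar>))"
    by simp
  also have "\<dots> = ennreal \<bar>\<Prod>i\<in>UNIV. c i\<bar> * (\<integral>\<^sup>+x. h (?F x) \<partial>lborel)"
    by (simp add: nn_integral_density nn_integral_distr nn_integral_cmult)
  finally show ?thesis by simp
qed

text \<open>Linear maps are compositions of shears, coordinate swaps, diagonal maps and maps that
  annihilate a coordinate; determinants multiply along compositions.\<close>

proposition nn_integral_lborel_linear:
  fixes f :: "real^'n \<Rightarrow> real^'n" and h :: "real^'n \<Rightarrow> ennreal"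
  assumes "linear f" "det (matrix f) \<noteq> 0" "h \<in> borel_measurable borel"
  shows "ennreal \<bar>det (matrix f)\<bar> * (\<integral>\<^sup>+x. h (f x) \<partial>lborel) = (\<integral>\<^sup>+x. h x \<partial>lborel)"
proof -
  \<comment> \<open>The integrand is quantified inside the induction predicate because the step for
    a composition applies the hypothesis for the inner map to \<open>h\<close> composed with the
    outer map.\<close>
  have "det (matrix f) \<noteq> 0 \<longrightarrow> (\<forall>h::real^'n \<Rightarrow> ennreal. h \<in> borel_measurable borel \<longrightarrow>
     ennreal \<bar>det (matrix f)\<bar> * (\<integral>\<^sup>+x. h (f x) \<partial>lborel) = (\<integral>\<^sup>+x. h x \<partial>lborel))" (is "?P f")
  proof (rule induct_linear_elementary[OF assms(1)])
    fix f g :: "real^'n \<Rightarrow> real^'n" assume lin: "linear f" "linear g" and P: "?P f" "?P g"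
    have d: "det (matrix (f \<circ> g)) = det (matrix f) * det (matrix g)"
      by (simp add: matrix_compose[OF lin(2,1)] det_mul)
    have fm: "f \<in> borel_measurable borel"
      using lin(1) by (rule linear_borel_measurable)
    show "?P (f \<circ> g)"
    proof (intro impI allI)
      fix h :: "real^'n \<Rightarrow> ennreal" assume nz: "det (matrix (f \<circ> g)) \<noteq> 0" and h: "h \<in> borel_measurable borel"
      have hf: "(\<lambda>x. h (f x)) \<in> borel_measurable borel" using h fm by measurable
      have "ennreal \<bar>det (matrix (f \<circ> g))\<bar> * (\<integral>\<^sup>+x. h ((f \<circ> g) x) \<partial>lborel)
        = ennreal \<bar>det (matrix f)\<bar> * (ennreal \<bar>det (matrix g)\<bar> * (\<integral>\<^sup>+x. h (f (g x)) \<partial>lborel))"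
        by (simp add: d abs_mult ennreal_mult mult.assoc)
      also have "ennreal \<bar>det (matrix g)\<bar> * (\<integral>\<^sup>+x. h (f (g x)) \<partial>lborel) = (\<integral>\<^sup>+x. h (f x) \<partial>lborel)"
        using nz by (intro P(2)[rule_format] hf) (simp add: d)
      also have "ennreal \<bar>det (matrix f)\<bar> * \<dots> = (\<integral>\<^sup>+x. h x \<partial>lborel)"
        using nz by (intro P(1)[rule_format] h) (simp add: d)
      finally show "ennreal \<bar>det (matrix (f \<circ> g))\<bar> * (\<integral>\<^sup>+x. h ((f \<circ> g) x) \<partial>lborel) = (\<integral>\<^sup>+x. h x \<partial>lborel)" .
    qed
  next
    fix f :: "real^'n \<Rightarrow> real^'n" and i assume lin: "linear f" and z: "\<And>x. f x $ i = 0"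
    \<comment> \<open>A map with a vanishing coordinate is not onto, hence not injective, so its
      determinant is 0 and the implication is vacuous.\<close>
    have "\<not> inj f"
      using lin z by (metis (full_types) linear_injective_imp_surjective one_neq_zero surjE vec_component)
    then show "?P f" using det_nz_iff_inj[OF lin] by blast
  next
    fix c :: "'n \<Rightarrow> real"
    have "det (matrix (\<lambda>x. \<chi> i. c i * x $ i)) = (\<Prod>i\<in>UNIV. c i)"
      by (subst det_diagonal) (auto simp: matrix_def axis_def)
    then show "?P (\<lambda>x. \<chi> i. c i * x $ i)"
      using nn_integral_lborel_diagonal[of _ c] by (auto simp: prod_zero_iff)
  next
    fix m n :: 'n assume "m \<noteq> n"
    have "matrix (\<lambda>x::real^'n. \<chi> i. x $ Transposition.transpose m n i) = transpose (\<chi> i j. mat 1 $ i $ Transposition.transpose m n j)"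
      by (auto simp: vec_eq_iff transpose_def axis_def mat_def matrix_def)
    then have "\<bar>det (matrix (\<lambda>x::real^'n. \<chi> i. x $ Transposition.transpose m n i))\<bar> = 1"
      by (simp add: det_permute_columns permutes_swap_id sign_swap_id abs_mult)
    then show "?P (\<lambda>x. \<chi> i. x $ Transposition.transpose m n i)"
      using nn_integral_lborel_swap[of _ m n] by simp
  next
    fix m n :: 'n assume mn: "m \<noteq> n"
    have "matrix (\<lambda>x::real^'n. \<chi> i. if i = m then x$m + x$n else x$i)
       = (\<chi> k. if k = m then row m (mat 1) + 1 *s row n (mat 1) else row k (mat 1))"
      by (auto simp: vec_eq_iff matrix_def axis_def mat_def row_def)
    then have "det (matrix (\<lambda>x::real^'n. \<chi> i. if i = m then x$m + x$n else x$i)) = 1"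
      using det_row_operation[OF mn, of "mat 1 :: real^'n^'n" 1] by simp
    then show "?P (\<lambda>x. \<chi> i. if i = m then x$m + x$n else x$i)"
      using nn_integral_lborel_shear[OF _ mn] by simp
  qed
  then show ?thesis using assms by simp
qed

text \<open>Gram-Schmidt for the inner product x \<bullet> (J *v y). The columns of B are
  orthonormal for it, so B times its transpose is the inverse of J; this square root of the
  covariance is obtained without diagonalising.\<close>

lemma ex_conjugate_basis:
  fixes J :: "real^'n^'n"
  assumes sym: "transpose J = J" and pos: "\<And>x. x \<noteq> 0 \<Longrightarrow> 0 < x \<bullet> (J *v x)"
  obtains B :: "real^'n^'n" where "transpose B ** (J ** B) = mat 1"
proof -
  define orth where "orth E \<longleftrightarrow> (\<forall>x\<in>E. \<forall>y\<in>E. x \<bullet> (J *v y) = (if x = y then 1 else 0))" for E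
  have symD: "x \<bullet> (J *v y) = y \<bullet> (J *v x)" for x y
    using dot_lmul_matrix[of x J y] by (simp add: transpose_matrix_vector[symmetric] sym inner_commute del: transpose_matrix_vector)
  have "\<exists>E. finite E \<and> card E = k \<and> orth E" if "k \<le> CARD('n)" for k
    using that
  proof (induction k)
    case 0
    then show ?case by (intro exI[of _ "{}"]) (simp add: orth_def)
  next
    case (Suc k)
    then obtain E where E: "finite E" "card E = k" "orth E" by auto
    \<comment> \<open>Orthogonality to E with respect to J is Euclidean orthogonality to the image
      of E under J, and that image spans a proper subspace as long as E is too small.\<close>
    have "dim ((*v) J ` E) \<le> card ((*v) J ` E)" using E by (intro dim_le_card') auto
    also have "\<dots> \<le> k" using card_image_le[OF E(1)] E(2) by metis
    finally have "dim ((*v) J ` E) < DIM(real^'n)" using Suc.prems by simp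
    from orthogonal_to_subspace_exists[OF this]
    obtain x where x: "x \<noteq> 0" "\<And>y. y \<in> span ((*v) J ` E) \<Longrightarrow> orthogonal x y" by blast
    define x' where "x' = (1 / sqrt (x \<bullet> (J *v x))) *\<^sub>R x"
    have p: "0 < x \<bullet> (J *v x)" by (rule pos[OF x(1)])
    have x1: "x' \<bullet> (J *v x') = 1" using p
      by (simp add: x'_def matrix_vector_mult_scaleR)
    have x0: "x' \<bullet> (J *v e) = 0" if "e \<in> E" for e
      using x(2)[of "J *v e"] that by (simp add: x'_def orthogonal_def span_base)
    have "x' \<notin> E" using x0[of x'] x1 by auto
    have x0': "e \<bullet> (J *v x') = 0" if "e \<in> E" for e
      unfolding symD[of e x'] by (rule x0[OF that])
    have "orth (insert x' E)"
      using E(3) x0 x0' x1 \<open>x' \<notin> E\<close> unfolding orth_def by auto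
    moreover have "finite (insert x' E)" "card (insert x' E) = Suc k"
      using E \<open>x' \<notin> E\<close> by auto
    ultimately show ?case by blast
  qed
  from this[of "CARD('n)"] obtain E where E: "finite E" "card E = card (UNIV :: 'n set)" "orth E" by auto
  obtain \<beta> :: "'n \<Rightarrow> real^'n" where \<beta>: "bij_betw \<beta> UNIV E"
    using finite_same_card_bij[OF finite E(1), of "UNIV :: 'n set"] E(2) by auto
  define B :: "real^'n^'n" where "B = (\<chi> i j. \<beta> j $ i)"
  have "transpose B ** (J ** B) = mat 1"
  proof (rule vec_eq_iff[THEN iffD2], rule allI, rule vec_eq_iff[THEN iffD2], rule allI)
    fix i j
    have "(transpose B ** (J ** B)) $ i $ j = \<beta> i \<bullet> (J *v \<beta> j)"
      by (simp add: matrix_matrix_mult_def matrix_vector_mult_def inner_vec_def transpose_def B_def)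
    also have "\<dots> = (if i = j then 1 else 0)"
      using E(3) \<beta> unfolding orth_def bij_betw_def inj_on_def by auto
    finally show "(transpose B ** (J ** B)) $ i $ j = mat 1 $ i $ j" by (simp add: mat_def)
  qed
  then show ?thesis by (rule that)
qed

section \<open>Standard and general Gaussian laws\<close>

definition std_normal_prod :: "'a::euclidean_space \<Rightarrow> real" where
  "std_normal_prod x = (\<Prod>b\<in>Basis. std_normal_density (x \<bullet> b))"

lemma std_normal_prod_measurable [measurable]: "std_normal_prod \<in> borel_measurable borel"
  unfolding std_normal_prod_def by measurable

lemma std_normal_prod_nonneg: "0 \<le> std_normal_prod x"
  unfolding std_normal_prod_def by (intro prod_nonneg) auto

lemma prob_space_std_normal_prod: "prob_space (density lborel (\<lambda>x::'a::euclidean_space. ennreal (std_normal_prod x)))"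
proof (rule prob_spaceI)
  interpret N: prob_space std_normal_distribution by (rule prob_space_normal_density) simp
  have 1: "(\<integral>\<^sup>+u. ennreal (std_normal_density u) \<partial>lborel) = 1"
    using N.emeasure_space_1 by (simp add: emeasure_density)
  have "(\<integral>\<^sup>+x. ennreal (std_normal_prod (x::'a)) \<partial>lborel)
    = (\<integral>\<^sup>+x. (\<Prod>b\<in>Basis. ennreal (std_normal_density ((x::'a) \<bullet> b))) \<partial>lborel)"
    unfolding std_normal_prod_def by (simp add: prod_ennreal)
  also have "\<dots> = (\<Prod>b\<in>(Basis::'a set). (\<integral>\<^sup>+u. ennreal (std_normal_density u) \<partial>lborel))"
    by (rule nn_integral_lborel_prod) auto
  finally show "emeasure (density lborel (\<lambda>x::'a. ennreal (std_normal_prod x)))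
     (space (density lborel (\<lambda>x::'a. ennreal (std_normal_prod x)))) = 1"
    by (simp add: emeasure_density 1)
qed

lemma char_std_normal_prod:
  fixes t :: "'a::euclidean_space"
  shows "(\<integral>x. iexp (t \<bullet> x) \<partial>density lborel (\<lambda>x. ennreal (std_normal_prod x))) = complex_of_real (exp (- ((norm t)\<^sup>2 / 2)))"
proof -
  interpret product_sigma_finite "\<lambda>_::'a. lborel :: real measure" ..
  interpret N: prob_space std_normal_distribution by (rule prob_space_normal_density) simp
  let ?S = "\<lambda>f. \<Sum>b\<in>Basis. f b *\<^sub>R (b::'a)"
  have Sm[measurable]: "?S \<in> borel_measurable (Pi\<^sub>M Basis (\<lambda>_. lborel))" by measurable
  let ?g = "\<lambda>s u. std_normal_density u *\<^sub>R iexp (s * u)"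
  have gm: "(\<lambda>u. iexp (s * u)) \<in> borel_measurable lborel" for s by measurable
  have gi: "integrable lborel (?g s)" for s
  proof -
    have "integrable std_normal_distribution (\<lambda>u. iexp (s * u))" by (rule N.integrable_iexp) auto
    then show ?thesis by (subst (asm) integrable_density) (auto simp: gm)
  qed
  have gv: "(\<integral>u. ?g s u \<partial>lborel) = complex_of_real (exp (- (s\<^sup>2 / 2)))" for s
  proof -
    have "char std_normal_distribution s = (\<integral>u. ?g s u \<partial>lborel)"
      unfolding char_def by (rule integral_density) (auto simp: gm)
    then show ?thesis by (simp add: char_std_normal_distribution)
  qed
  have comp: "?S f \<bullet> b = f b" if "b \<in> Basis" for f b
    by (rule inner_sum_left_Basis[OF that])
  have "(\<integral>x. iexp (t \<bullet> x) \<partial>density lborel (\<lambda>x. ennreal (std_normal_prod x)))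
     = (\<integral>x. std_normal_prod x *\<^sub>R iexp (t \<bullet> x) \<partial>lborel)"
    by (rule integral_density) (auto simp: std_normal_prod_nonneg)
  also have "\<dots> = (\<integral>f. std_normal_prod (?S f) *\<^sub>R iexp (t \<bullet> ?S f) \<partial>Pi\<^sub>M Basis (\<lambda>_. lborel))"
    by (subst lborel_eq) (rule integral_distr, measurable)
  also have "\<dots> = (\<integral>f. (\<Prod>b\<in>Basis. ?g (t \<bullet> b) (f b)) \<partial>Pi\<^sub>M Basis (\<lambda>_. lborel))"
  proof (rule Bochner_Integration.integral_cong[OF refl])
    fix f
    have "iexp (t \<bullet> ?S f) = (\<Prod>b\<in>Basis. iexp ((t \<bullet> b) * f b))"
      by (simp add: inner_sum_right exp_sum[symmetric] sum_distrib_left mult.commute)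
    moreover have "std_normal_prod (?S f) = (\<Prod>b\<in>Basis. std_normal_density (f b))"
      unfolding std_normal_prod_def by (intro prod.cong) (auto simp: comp)
    ultimately show "std_normal_prod (?S f) *\<^sub>R iexp (t \<bullet> ?S f) = (\<Prod>b\<in>Basis. ?g (t \<bullet> b) (f b))"
      by (simp add: scaleR_conv_of_real prod.distrib)
  qed
  also have "\<dots> = (\<Prod>b\<in>Basis. (\<integral>u. ?g (t \<bullet> b) u \<partial>lborel))"
    by (rule product_integral_prod, simp) (rule gi)
  also have "\<dots> = complex_of_real (exp (\<Sum>b\<in>Basis. - ((t \<bullet> b)\<^sup>2 / 2)))"
    unfolding gv by (simp add: exp_sum)
  also have "(\<Sum>b\<in>Basis. - ((t \<bullet> b)\<^sup>2 / 2)) = - ((norm t)\<^sup>2 / 2)"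
    unfolding power2_norm_eq_inner euclidean_inner[of t t]
    by (simp add: sum_negf sum_divide_distrib power2_eq_square)
  finally show ?thesis .
qed

lemma std_normal_prod_eq:
  fixes x :: "real^'n"
  shows "std_normal_prod x = exp (- (x \<bullet> x) / 2) / sqrt (2 * pi) ^ CARD('n)"
proof -
  have "std_normal_prod x = (\<Prod>b\<in>(Basis::(real^'n) set). 1 / sqrt (2 * pi)) * (\<Prod>b\<in>(Basis::(real^'n) set). exp (- (x \<bullet> b)\<^sup>2 / 2))"
    unfolding std_normal_prod_def prod.distrib[symmetric] by (simp add: std_normal_density_def)
  also have "(\<Prod>b\<in>(Basis::(real^'n) set). exp (- (x \<bullet> b)\<^sup>2 / 2)) = exp (\<Sum>b\<in>Basis. - (x \<bullet> b)\<^sup>2 / 2)"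
    by (simp add: exp_sum)
  also have "(\<Sum>b\<in>Basis. - (x \<bullet> b)\<^sup>2 / 2) = - (x \<bullet> x) / 2"
    unfolding euclidean_inner[of x x] by (simp add: sum_negf sum_divide_distrib power2_eq_square)
  finally show ?thesis by (simp add: power_divide)
qed

lemma matrix_inv_eqI:
  fixes A A' :: "real^'n^'n"
  assumes "A ** A' = mat 1" shows "matrix_inv A = A'"
proof -
  have "A' ** A = mat 1" using assms by (simp add: matrix_left_right_inverse)
  then have "A ** matrix_inv A = mat 1 \<and> matrix_inv A ** A = mat 1"
    unfolding matrix_inv_def by (rule_tac someI_ex) (use assms in blast)
  then have "matrix_inv A = (A' ** A) ** matrix_inv A" using \<open>A' ** A = mat 1\<close> by simp
  also have "\<dots> = A'" using \<open>A ** matrix_inv A = mat 1 \<and> _\<close> by (simp add: matrix_mul_assoc[symmetric])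
  finally show ?thesis .
qed

text \<open>A standard normal vector mapped by B has covariance B times its transpose, which is the
  inverse of J when B is conjugate for J. The density of \<open>normal_law\<close> is identified
  with this image law by the linear change of variables.\<close>

theorem normal_law_matrix_inv:
  fixes J :: "real^'n^'n"
  assumes sym: "transpose J = J" and pos: "\<And>x. x \<noteq> 0 \<Longrightarrow> 0 < x \<bullet> (J *v x)"
  shows "prob_space (normal_law (matrix_inv J))" "sets (normal_law (matrix_inv J)) = sets borel"
    "(\<integral>x. iexp (t \<bullet> x) \<partial>normal_law (matrix_inv J)) = complex_of_real (exp (- ((t \<bullet> (matrix_inv J *v t)) / 2)))"
proof -
  obtain B :: "real^'n^'n" where B: "transpose B ** (J ** B) = mat 1"
    using ex_conjugate_basis[OF sym pos] by blast
  have "(J ** B) ** transpose B = mat 1" using B by (simp add: matrix_left_right_inverse)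
  then have JS: "J ** (B ** transpose B) = mat 1" by (simp add: matrix_mul_assoc)
  define S where "S = B ** transpose B"
  have inv: "matrix_inv J = S" "matrix_inv S = J"
    using matrix_inv_eqI[OF JS] matrix_inv_eqI[of S J] JS matrix_left_right_inverse[of S J] by (auto simp: S_def)
  have detS: "det S = (det B)\<^sup>2" by (simp add: S_def det_mul power2_eq_square)
  have "det B * (det J * det B) = 1"
    using arg_cong[OF B, of det] by (simp add: det_mul)
  then have dB: "det B \<noteq> 0" by auto
  let ?f = "\<lambda>z. B *v z"
  have lin: "linear ?f" by (rule matrix_vector_mul_linear)
  have fm[measurable]: "?f \<in> borel_measurable borel" by (rule linear_borel_measurable[OF lin])
  let ?n = "\<lambda>x. exp (- (x \<bullet> (J *v x)) / 2) / sqrt ((2 * pi) ^ CARD('n) * det S)"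
  let ?G = "density lborel (\<lambda>x::real^'n. ennreal (std_normal_prod x))"
  have "(\<lambda>x. J *v x) \<in> borel_measurable borel" by (rule linear_borel_measurable[OF matrix_vector_mul_linear])
  then have nm[measurable]: "?n \<in> borel_measurable borel" by measurable
  have nm': "(\<lambda>x. ennreal (?n x)) \<in> borel_measurable borel"
    by (rule measurable_compose[OF nm measurable_ennreal])
  have quad: "(B *v z) \<bullet> (J *v (B *v z)) = z \<bullet> z" for z
  proof -
    have adj: "(B *v z) \<bullet> w = z \<bullet> (transpose B *v w)" for w
      using dot_lmul_matrix[of w B z] by (simp add: inner_commute)
    have "(B *v z) \<bullet> (J *v (B *v z)) = z \<bullet> ((transpose B ** (J ** B)) *v z)"
      unfolding adj by (simp only: matrix_vector_mul_assoc)
    then show ?thesis by (simp add: B)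
  qed
  \<comment> \<open>Conjugacy turns the quadratic form at B z into z \<bullet> z, and det S = (det
    B)^2 makes the Jacobian cancel against the normalising constant.\<close>
  have dens: "\<bar>det B\<bar> * ?n (B *v z) = std_normal_prod z" for z
  proof -
    have "sqrt ((2 * pi) ^ CARD('n) * (det B)\<^sup>2) = sqrt (2 * pi) ^ CARD('n) * \<bar>det B\<bar>"
      by (subst real_sqrt_mult) (simp only: real_sqrt_abs real_sqrt_power[of "2 * pi"])
    moreover have "\<bar>det B\<bar> * (u / (v * \<bar>det B\<bar>)) = u / v" for u v using dB by simp
    ultimately show ?thesis unfolding quad std_normal_prod_eq detS by presburger
  qed
  have eq: "normal_law S = distr ?G borel ?f"
  proof (rule measure_eqI)
    show "sets (normal_law S) = sets (distr ?G borel ?f)" by (simp add: normal_law_def)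
    fix A assume "A \<in> sets (normal_law S)"
    then have A[measurable]: "A \<in> sets borel" by (simp add: normal_law_def)
    have "emeasure (normal_law S) A = (\<integral>\<^sup>+x. ennreal (?n x) * indicator A x \<partial>lborel)"
      unfolding normal_law_def inv
      by (rule emeasure_density) (use nm' A in \<open>simp_all only: measurable_lborel2 sets_lborel\<close>)
    also have "\<dots> = ennreal \<bar>det (matrix ?f)\<bar> * (\<integral>\<^sup>+z. ennreal (?n (?f z)) * indicator A (?f z) \<partial>lborel)"
    proof (rule nn_integral_lborel_linear[OF lin, symmetric])
      show "det (matrix ?f) \<noteq> 0" using dB by simp
      show "(\<lambda>x. ennreal (?n x) * indicator A x) \<in> borel_measurable borel"
        by (rule borel_measurable_times_ennreal[OF nm']) measurable
    qed
    also have "\<dots> = (\<integral>\<^sup>+z. ennreal \<bar>det B\<bar> * (ennreal (?n (?f z)) * indicator A (?f z)) \<partial>lborel)"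
    proof -
      have "(\<lambda>z. ennreal (?n (?f z)) * indicator A (?f z)) \<in> borel_measurable lborel"
        unfolding measurable_lborel2
        by (rule borel_measurable_times_ennreal[OF measurable_compose[OF fm nm']]) measurable
      then show ?thesis by (simp only: nn_integral_cmult matrix_of_matrix_vector_mul)
    qed
    also have "\<dots> = (\<integral>\<^sup>+z. ennreal (std_normal_prod z) * indicator (?f -` A) z \<partial>lborel)"
      by (intro nn_integral_cong) (simp only: mult.assoc[symmetric] ennreal_mult'[symmetric] abs_ge_zero dens indicator_vimage[symmetric])
    also have "\<dots> = emeasure (distr ?G borel ?f) A"
      using measurable_sets_borel[OF fm A] by (subst emeasure_distr) (auto simp: emeasure_density)
    finally show "emeasure (normal_law S) A = emeasure (distr ?G borel ?f) A" .
  qed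
  interpret G: prob_space ?G by (rule prob_space_std_normal_prod)
  show "prob_space (normal_law (matrix_inv J))"
    unfolding inv eq by (rule G.prob_space_distr) auto
  show "sets (normal_law (matrix_inv J)) = sets borel" by (simp add: normal_law_def)
  have "(\<integral>x. iexp (t \<bullet> x) \<partial>normal_law S) = (\<integral>z. iexp (t \<bullet> (B *v z)) \<partial>?G)"
    unfolding eq by (rule integral_distr) auto
  also have "\<dots> = (\<integral>z. iexp ((transpose B *v t) \<bullet> z) \<partial>?G)"
    by (simp add: dot_lmul_matrix)
  also have "\<dots> = complex_of_real (exp (- ((norm (transpose B *v t))\<^sup>2 / 2)))" by (rule char_std_normal_prod)
  also have "(norm (transpose B *v t))\<^sup>2 = t \<bullet> (S *v t)"
  proof -
    have "(norm (transpose B *v t))\<^sup>2 = (t v* B) \<bullet> (transpose B *v t)"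
      by (simp add: power2_norm_eq_inner)
    also have "\<dots> = t \<bullet> (B *v (transpose B *v t))" by (rule dot_lmul_matrix)
    finally show ?thesis by (simp only: S_def matrix_vector_mul_assoc)
  qed
  finally show "(\<integral>x. iexp (t \<bullet> x) \<partial>normal_law (matrix_inv J)) = complex_of_real (exp (- ((t \<bullet> (matrix_inv J *v t)) / 2)))"
    by (simp only: inv)
qed

section \<open>Maximisers of concave functions with a quadratic approximation\<close>

lemma norm_matrix_vector_mult_le:
  fixes M :: "real^'n^'m"
  shows "norm (M *v x) \<le> (\<Sum>a\<in>UNIV. \<Sum>b\<in>UNIV. \<bar>M $ a $ b\<bar>) * norm x"
proof -
  have "norm (M *v x) \<le> (\<Sum>a\<in>UNIV. \<bar>(M *v x) $ a\<bar>)" by (rule norm_le_l1_cart)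
  also have "\<dots> \<le> (\<Sum>a\<in>UNIV. (\<Sum>b\<in>UNIV. \<bar>M $ a $ b\<bar>) * norm x)"
  proof (rule sum_mono)
    fix a
    have "\<bar>(M *v x) $ a\<bar> \<le> (\<Sum>b\<in>UNIV. \<bar>M $ a $ b * x $ b\<bar>)"
      unfolding matrix_vector_mult_def by simp
    also have "\<dots> \<le> (\<Sum>b\<in>UNIV. \<bar>M $ a $ b\<bar> * norm x)"
      by (intro sum_mono) (simp add: abs_mult component_le_norm_cart mult_left_mono)
    finally show "\<bar>(M *v x) $ a\<bar> \<le> (\<Sum>b\<in>UNIV. \<bar>M $ a $ b\<bar>) * norm x"
      by (simp add: sum_distrib_right)
  qed
  finally show ?thesis by (simp add: sum_distrib_right)
qed

lemma positive_definite_lower_bound: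
  fixes J :: "real^'n^'n"
  assumes pos: "\<And>x. x \<noteq> 0 \<Longrightarrow> 0 < x \<bullet> (J *v x)"
  obtains l where "0 < l" "\<And>x. l * (norm x)\<^sup>2 \<le> x \<bullet> (J *v x)"
proof -
  have "compact (sphere (0::real^'n) 1)" "sphere (0::real^'n) 1 \<noteq> {}" by auto
  moreover have "continuous_on (sphere 0 1) (\<lambda>x::real^'n. x \<bullet> (J *v x))"
    by (intro continuous_on_inner continuous_on_id matrix_vector_mult_linear_continuous_on)
  ultimately have "\<exists>x0\<in>sphere 0 1. \<forall>x\<in>sphere 0 1. x0 \<bullet> (J *v x0) \<le> x \<bullet> (J *v x)"
    by (rule continuous_attains_inf)
  then obtain x0 where x0: "x0 \<in> sphere 0 1" "\<And>x. x \<in> sphere 0 1 \<Longrightarrow> x0 \<bullet> (J *v x0) \<le> x \<bullet> (J *v x)"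
    by blast
  show ?thesis
  proof (rule that)
    show "0 < x0 \<bullet> (J *v x0)" using x0(1) by (intro pos) auto
    fix x :: "real^'n"
    show "(x0 \<bullet> (J *v x0)) * (norm x)\<^sup>2 \<le> x \<bullet> (J *v x)"
    proof (cases "x = 0")
      case False
      define u where "u = (1 / norm x) *\<^sub>R x"
      have "u \<in> sphere 0 1" using False by (simp add: u_def)
      then have "x0 \<bullet> (J *v x0) \<le> u \<bullet> (J *v u)" by (rule x0(2))
      also have "\<dots> = (x \<bullet> (J *v x)) / (norm x)\<^sup>2"
        by (simp add: u_def matrix_vector_mult_scaleR power2_eq_square)
      finally show ?thesis using False by (simp add: pos_le_divide_eq)
    qed simp
  qed
qed

lemma positive_definite_inverse:
  fixes J :: "real^'n^'n"
  assumes pos: "\<And>x. x \<noteq> 0 \<Longrightarrow> 0 < x \<bullet> (J *v x)"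
  shows "J ** matrix_inv J = mat 1" "matrix_inv J ** J = mat 1"
proof -
  have "x = 0" if "J *v x = 0" for x
    using pos[of x] that by (cases "x = 0") auto
  then obtain B where "B ** J = mat 1" by (metis matrix_left_invertible_ker)
  then have "J ** B = mat 1" by (simp add: matrix_left_right_inverse)
  with matrix_inv_eqI[OF this] \<open>B ** J = mat 1\<close>
  show "J ** matrix_inv J = mat 1" "matrix_inv J ** J = mat 1" by auto
qed

text \<open>With w the image of v under the inverse of K n, the difference of the two images of v is
  the inverse of J applied to J w - K n w. The bound holds for all v from one index on, because it
  is applied to random score sums.\<close>

lemma matrix_inv_uniformly_tendsto:
  fixes J :: "real^'n^'n" and K :: "nat \<Rightarrow> real^'n^'n"
  assumes pos: "\<And>x. x \<noteq> 0 \<Longrightarrow> 0 < x \<bullet> (J *v x)"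
    and K: "\<And>a b. (\<lambda>n. K n $ a $ b) \<longlonglongrightarrow> J $ a $ b" and e: "0 < e"
  shows "\<forall>\<^sub>F n in sequentially. \<forall>v. norm (matrix_inv (K n) *v v - matrix_inv J *v v) \<le> e * norm v"
proof -
  obtain l where l: "0 < l" "\<And>x. l * (norm x)\<^sup>2 \<le> x \<bullet> (J *v x)"
    using positive_definite_lower_bound[OF pos] by blast
  define d where "d n = (\<Sum>a\<in>UNIV. \<Sum>b\<in>UNIV. \<bar>(K n - J) $ a $ b\<bar>)" for n
  define k where "k = (\<Sum>a\<in>UNIV. \<Sum>b\<in>UNIV. \<bar>(matrix_inv J) $ a $ b\<bar>)"
  have k0: "0 \<le> k" unfolding k_def by (intro sum_nonneg) auto
  have d0: "0 \<le> d n" for n unfolding d_def by (intro sum_nonneg) auto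
  have "d \<longlonglongrightarrow> (\<Sum>a\<in>(UNIV::'n set). \<Sum>b\<in>(UNIV::'n set). \<bar>0\<bar>)"
    unfolding d_def
    by (intro tendsto_sum tendsto_rabs) (use K in \<open>simp add: LIM_zero\<close>)
  then have dl: "d \<longlonglongrightarrow> 0" by simp
  have "\<forall>\<^sub>F n in sequentially. d n < l / 2" by (rule order_tendstoD[OF dl]) (use l in simp)
  moreover have "(\<lambda>n. k * (d n * (2 / l))) \<longlonglongrightarrow> k * (0 * (2 / l))" by (intro tendsto_intros dl)
  then have "\<forall>\<^sub>F n in sequentially. k * (d n * (2 / l)) < e" by (rule order_tendstoD) (use e in simp)
  ultimately show ?thesis
  proof eventually_elim
    case (elim n)
    have dn: "norm ((K n - J) *v x) \<le> d n * norm x" for x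
      unfolding d_def by (rule norm_matrix_vector_mult_le)
    \<comment> \<open>A perturbation below l/2 leaves half of the lower bound l. This makes
      \<open>K n\<close> invertible and bounds its inverse by 2/l.\<close>
    have low: "l / 2 * (norm x)\<^sup>2 \<le> x \<bullet> (K n *v x)" for x
    proof -
      have "\<bar>x \<bullet> ((K n - J) *v x)\<bar> \<le> norm x * (d n * norm x)"
        by (rule order_trans[OF Cauchy_Schwarz_ineq2 mult_left_mono[OF dn norm_ge_zero]])
      also have "\<dots> \<le> l / 2 * (norm x)\<^sup>2"
      proof -
        have "norm x * norm x * d n \<le> norm x * norm x * (l / 2)"
          using elim(1) by (intro mult_left_mono) auto
        then show ?thesis by (simp add: power2_eq_square mult_ac)
      qed
      finally have "- (l / 2 * (norm x)\<^sup>2) \<le> x \<bullet> ((K n - J) *v x)" by linarith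
      moreover have "x \<bullet> (K n *v x) = x \<bullet> (J *v x) + x \<bullet> ((K n - J) *v x)"
        by (simp add: matrix_vector_mult_diff_rdistrib inner_diff_right)
      ultimately show ?thesis using l(2)[of x] by linarith
    qed
    have "0 < x \<bullet> (K n *v x)" if "x \<noteq> 0" for x
      by (rule less_le_trans[OF _ low]) (use l that in simp)
    note Ki = positive_definite_inverse[OF this]
    show ?case
    proof
      fix v
      define w where "w = matrix_inv (K n) *v v"
      have Kw: "K n *v w = v" by (simp add: w_def matrix_vector_mul_assoc Ki)
      have "l / 2 * (norm w)\<^sup>2 \<le> norm w * norm v"
        using low[of w] norm_cauchy_schwarz[of w v] unfolding Kw by linarith
      then have wv: "norm w \<le> 2 / l * norm v"
        using l(1) by (cases "w = 0") (auto simp: power2_eq_square field_simps)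
      have "matrix_inv J *v (J *v w) = w"
        by (simp add: matrix_vector_mul_assoc positive_definite_inverse[OF pos])
      then have "matrix_inv (K n) *v v - matrix_inv J *v v = matrix_inv J *v (J *v w - K n *v w)"
        unfolding matrix_vector_mult_diff_distrib Kw by (simp add: w_def)
      also have "J *v w - K n *v w = - ((K n - J) *v w)"
        by (simp add: matrix_vector_mult_diff_rdistrib)
      also have "norm (matrix_inv J *v (- ((K n - J) *v w))) \<le> k * norm (- ((K n - J) *v w))"
        unfolding k_def by (rule norm_matrix_vector_mult_le)
      also have "\<dots> \<le> k * (d n * norm w)"
        unfolding norm_minus_cancel by (intro mult_left_mono dn k0)
      also have "\<dots> \<le> k * (d n * (2 / l * norm v))"
        by (intro mult_left_mono wv k0 d0)
      also have "\<dots> = k * (d n * (2 / l)) * norm v" by simp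
      also have "\<dots> \<le> e * norm v" using elim(2) by (intro mult_right_mono) auto
      finally show "norm (matrix_inv (K n) *v v - matrix_inv J *v v) \<le> e * norm v" .
    qed
  qed
qed

lemma ereal_abs_diff_le_add:
  assumes "\<bar>a - ereal u\<bar> \<le> ereal e" "\<bar>u - v\<bar> \<le> d"
  shows "\<bar>a - ereal v\<bar> \<le> ereal (e + d)"
proof (cases a)
  case (real r)
  then have "\<bar>r - u\<bar> \<le> e" using assms(1) by simp
  then have "\<bar>r - v\<bar> \<le> e + d" using assms(2) by linarith
  then show ?thesis using real by simp
qed (use assms in auto)

text \<open>The centre s of the quadratic is random, so the net has to serve all centres in a ball
  at once; this is the reason for the bound \<rho>.\<close>

definition quadratic_argmax_net :: "real^'n^'n \<Rightarrow> real \<Rightarrow> real \<Rightarrow> (real^'n) set \<Rightarrow> real \<Rightarrow> bool" where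
  "quadratic_argmax_net J \<rho> \<delta> G \<epsilon> \<longleftrightarrow> finite G \<and> 0 < \<epsilon> \<and> (\<forall>S f s y. norm s \<le> \<rho> \<longrightarrow> ext_concave_on S f \<longrightarrow> G \<subseteq> S
      \<longrightarrow> (\<forall>z\<in>G. \<bar>f z - ereal (z \<bullet> (J *v s) - 1/2 * (z \<bullet> (J *v z)))\<bar> \<le> ereal \<epsilon>)
      \<longrightarrow> y \<in> S \<longrightarrow> (\<forall>z\<in>S. f z \<le> f y) \<longrightarrow> norm (y - s) \<le> \<delta>)"

lemma quadratic_argmax_netD:
  assumes "quadratic_argmax_net J \<rho> \<delta> G \<epsilon>"
  shows "finite G" "0 < \<epsilon>"
    "norm s \<le> \<rho> \<Longrightarrow> ext_concave_on S f \<Longrightarrow> G \<subseteq> S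
      \<Longrightarrow> (\<And>z. z \<in> G \<Longrightarrow> \<bar>f z - ereal (z \<bullet> (J *v s) - 1/2 * (z \<bullet> (J *v z)))\<bar> \<le> ereal \<epsilon>)
      \<Longrightarrow> y \<in> S \<Longrightarrow> (\<And>z. z \<in> S \<Longrightarrow> f z \<le> f y) \<Longrightarrow> norm (y - s) \<le> \<delta>"
  using assms unfolding quadratic_argmax_net_def by blast+

text \<open>Finitely many centres c form an r-net of the ball, and the net for the origin is copied
  to each of them. Seen from a nearby c, the quadratic centred at s is -Q plus a constant and a
  linear term of size at most r times the norm of J z.\<close>

lemma concave_argmax_near:
  fixes J :: "real^'n^'n"
  assumes sym: "transpose J = J" and pos: "\<forall>x. x \<noteq> 0 \<longrightarrow> 0 < x \<bullet> (J *v x)" and \<delta>: "0 < \<delta>"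
  shows "\<exists>G \<epsilon>. quadratic_argmax_net J \<rho> \<delta> G \<epsilon>"
proof -
  define Q where "Q z = 1/2 * (z \<bullet> (J *v z))" for z
  have Qc: "continuous_on UNIV Q" unfolding Q_def
    by (intro continuous_on_mult continuous_on_const continuous_on_inner continuous_on_id matrix_vector_mult_linear_continuous_on)
  have Q0: "Q 0 = 0" by (simp add: Q_def)
  have Qp: "\<forall>x. x \<noteq> 0 \<longrightarrow> 0 < Q x" using pos by (simp add: Q_def)
  have "0 < \<delta> / 2" using \<delta> by simp
  from concave_argmax_near_zero[OF Qc Q0 Qp this]
  obtain G0 \<epsilon>0 where net: "argmax_net Q (\<delta> / 2) G0 \<epsilon>0" by blast
  note G0 = argmax_netD(1,2)[OF net] and arg = argmax_netD(3)[OF net]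
  define K where "K = (\<Sum>z\<in>G0. norm (J *v z)) + 1"
  have K: "0 < K" "\<And>z. z \<in> G0 \<Longrightarrow> norm (J *v z) \<le> K"
  proof -
    show "0 < K" unfolding K_def by (intro add_nonneg_pos sum_nonneg) auto
    show "norm (J *v z) \<le> K" if "z \<in> G0" for z
      using member_le_sum[OF that, of "\<lambda>z. norm (J *v z)"] G0(1) unfolding K_def by simp
  qed
  \<comment> \<open>One half of \<delta> pays for the distance from c to s, one half of \<epsilon>0
    for the linear term on the net; K bounds the norm of J z there.\<close>
  define r where "r = min (\<delta> / 2) (\<epsilon>0 / (2 * K))"
  have r: "0 < r" "r \<le> \<delta> / 2" "r * K \<le> \<epsilon>0 / 2"
  proof -
    show "0 < r" "r \<le> \<delta> / 2" using \<delta> G0(2) K(1) by (auto simp: r_def)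
    have "r * K \<le> \<epsilon>0 / (2 * K) * K" using K(1) by (intro mult_right_mono) (auto simp: r_def)
    then show "r * K \<le> \<epsilon>0 / 2" using K(1) by simp
  qed
  obtain C where C: "finite C" "cball (0::real^'n) \<rho> \<subseteq> (\<Union>c\<in>C. ball c r)"
  proof -
    have "cball (0::real^'n) \<rho> \<subseteq> (\<Union>c\<in>cball 0 \<rho>. ball c r)" using r(1) by force
    then obtain C where "C \<subseteq> cball 0 \<rho>" "finite C" "cball (0::real^'n) \<rho> \<subseteq> (\<Union>c\<in>C. ball c r)"
      by (rule compactE_image[OF compact_cball, rotated]) auto
    then show ?thesis by (intro that)
  qed
  define G where "G = (\<Union>c\<in>C. (\<lambda>z. c + z) ` G0)"
  have symD: "x \<bullet> (J *v y) = y \<bullet> (J *v x)" for x y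
    using dot_lmul_matrix[of x J y] transpose_matrix_vector[of J x] by (simp add: sym inner_commute)
  show ?thesis
    unfolding quadratic_argmax_net_def
  proof (intro exI[of _ G] exI[of _ "\<epsilon>0 / 2"] conjI allI impI)
    show "finite G" using C G0 by (simp add: G_def)
    show "0 < \<epsilon>0 / 2" using G0 by simp
    fix S :: "(real^'n) set" and f s y
    assume s: "norm s \<le> \<rho>" and conc: "ext_concave_on S f" and GS: "G \<subseteq> S"
      and cl: "\<forall>z\<in>G. \<bar>f z - ereal (z \<bullet> (J *v s) - 1/2 * (z \<bullet> (J *v z)))\<bar> \<le> ereal (\<epsilon>0 / 2)"
      and y: "y \<in> S" and max: "\<forall>z\<in>S. f z \<le> f y"
    have "s \<in> (\<Union>c\<in>C. ball c r)" by (rule subsetD[OF C(2)]) (use s in simp)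
    then obtain c where c: "c \<in> C" "dist c s < r" by (metis UN_E mem_ball)
    \<comment> \<open>The value at c of the quadratic centred at s. Subtracting it makes the
      recentred function comparable with -Q, which vanishes at 0.\<close>
    define k where "k = c \<bullet> (J *v s) - 1/2 * (c \<bullet> (J *v c))"
    have "norm (y - c) \<le> \<delta> / 2"
    proof (rule arg[OF ext_concave_on_shift[OF conc, of c k]])
      show "G0 \<subseteq> {z. c + z \<in> S}" using GS c(1) by (auto simp: G_def)
      show "y - c \<in> {z. c + z \<in> S}" using y by simp
      show "f (c + z) - ereal k \<le> f (c + (y - c)) - ereal k" if "z \<in> {z. c + z \<in> S}" for z
        using max that by (auto intro: ereal_minus_mono)
      fix z assume z: "z \<in> G0"
      let ?q = "(c + z) \<bullet> (J *v s) - 1/2 * ((c + z) \<bullet> (J *v (c + z)))"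
      have "?q = k - Q z + (s - c) \<bullet> (J *v z)"
        using symD[of z s] symD[of z c]
        by (simp add: k_def Q_def matrix_vector_right_distrib inner_add_left inner_add_right inner_diff_left algebra_simps)
      moreover have "\<bar>(s - c) \<bullet> (J *v z)\<bar> \<le> \<epsilon>0 / 2"
      proof -
        have "\<bar>(s - c) \<bullet> (J *v z)\<bar> \<le> norm (s - c) * norm (J *v z)" by (rule Cauchy_Schwarz_ineq2)
        also have "\<dots> \<le> r * K" using c(2) K(2)[OF z] r(1) by (intro mult_mono) (auto simp: dist_norm norm_minus_commute)
        finally show ?thesis using r(3) by linarith
      qed
      moreover have "\<bar>f (c + z) - ereal ?q\<bar> \<le> ereal (\<epsilon>0 / 2)"
        by (rule bspec[OF cl]) (use c(1) z in \<open>auto simp: G_def\<close>)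
      ultimately have "\<bar>f (c + z) - ereal (k - Q z)\<bar> \<le> ereal (\<epsilon>0 / 2 + \<epsilon>0 / 2)"
        by (intro ereal_abs_diff_le_add[where u="?q"]) auto
      moreover have "f (c + z) - ereal k + ereal (Q z) = f (c + z) - ereal (k - Q z)"
        by (cases "f (c + z)") auto
      ultimately show "\<bar>f (c + z) - ereal k + ereal (Q z)\<bar> \<le> ereal \<epsilon>0" by simp
    qed
    moreover have "norm (y - s) \<le> norm (y - c) + norm (c - s)"
      using norm_triangle_ineq[of "y - c" "c - s"] by simp
    ultimately show "norm (y - s) \<le> \<delta>" using c(2) r(2) by (simp add: dist_norm)
  qed
qed

section \<open>Outer measure bounds and the expansion of the maximiser\<close>

lemma outer_measure_of_Un_le:
  assumes "A \<subseteq> space M" "B \<subseteq> space M"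
  shows "outer_measure_of M (A \<union> B) \<le> outer_measure_of M A + outer_measure_of M B"
proof -
  obtain E where E: "E \<in> sets M" "A \<subseteq> E" "outer_measure_of M A = emeasure M E"
    using outer_measure_of_attain[OF assms(1)] by blast
  obtain F where F: "F \<in> sets M" "B \<subseteq> F" "outer_measure_of M B = emeasure M F"
    using outer_measure_of_attain[OF assms(2)] by blast
  have "outer_measure_of M (A \<union> B) \<le> outer_measure_of M (E \<union> F)"
    using E F by (intro outer_measure_of_mono) auto
  also have "\<dots> \<le> emeasure M E + emeasure M F"
    using E F by (simp add: emeasure_subadditive)
  finally show ?thesis using E F by simp
qed

lemma outer_measure_of_UN_le:
  assumes "finite I" "\<And>i. i \<in> I \<Longrightarrow> A i \<subseteq> space M"
  shows "outer_measure_of M (\<Union>i\<in>I. A i) \<le> (\<Sum>i\<in>I. outer_measure_of M (A i))"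
  using assms
proof (induction I rule: finite_induct)
  case (insert i I)
  have "outer_measure_of M (\<Union>i\<in>insert i I. A i) \<le> outer_measure_of M (A i) + outer_measure_of M (\<Union>i\<in>I. A i)"
    unfolding UN_insert using insert by (intro outer_measure_of_Un_le) auto
  also have "\<dots> \<le> outer_measure_of M (A i) + (\<Sum>i\<in>I. outer_measure_of M (A i))"
    using insert by (intro add_left_mono) auto
  finally show ?case using insert by simp
qed simp

lemma outer_measure_of_AE:
  assumes "AE x in M. P x" shows "outer_measure_of M {x \<in> space M. \<not> P x} = 0"
proof -
  from assms obtain N where N: "{x \<in> space M. \<not> P x} \<subseteq> N" "emeasure M N = 0" "N \<in> sets M"
    by (rule AE_E)
  then have "outer_measure_of M {x \<in> space M. \<not> P x} \<le> emeasure M N"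
    using outer_measure_of_mono[OF N(1), of M] by simp
  then show ?thesis using N by simp
qed

text \<open>Off the union of the null sets \<open>N1\<close> and \<open>N2\<close>, the event
  \<open>N3\<close> of a large score sum and the events \<open>T n z\<close> of a failed expansion
  at a net point, the net places the maximiser within \<delta>/2 of the inverse of J applied to the
  score sum. As none of these sets need be measurable, they are added up by subadditivity of outer
  measure.\<close>

lemma concave_argmax_expansion:
  fixes A :: "nat \<Rightarrow> 's \<Rightarrow> real^'p \<Rightarrow> ereal" and J :: "real^'p^'p" and K :: "nat \<Rightarrow> real^'p^'p"
  assumes sym: "transpose J = J" and pos: "\<And>x. x \<noteq> 0 \<Longrightarrow> 0 < x \<bullet> (J *v x)"
    and K: "\<And>a b. (\<lambda>n. K n $ a $ b) \<longlonglongrightarrow> J $ a $ b"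
    and expansion: "\<And>h. oP1 P (\<lambda>n x. A n x h - ereal (h \<bullet> S n x - 1/2 * (h \<bullet> (K n *v h))))"
    and tight: "\<And>e. 0 < e \<Longrightarrow> \<exists>R. \<forall>\<^sub>F n in sequentially. outer_measure_of (P n) {x \<in> space (P n). R < norm (S n x)} \<le> e"
    and dom: "\<And>h. \<forall>\<^sub>F n in sequentially. h \<in> D n"
    and conc: "\<forall>\<^sub>F n in sequentially. AE x in P n. ext_concave_on (D n) (A n x)"
    and argmax: "\<forall>\<^sub>F n in sequentially. AE x in P n. \<bar>A n x 0\<bar> \<noteq> \<infinity> \<longrightarrow> h n x \<in> D n \<and> (\<forall>z\<in>D n. A n x z \<le> A n x (h n x))"
  shows "oP1 P (\<lambda>n x. ereal (norm (h n x - matrix_inv (K n) *v S n x)))"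
  unfolding oP1_def
proof (intro allI impI)
  fix \<delta> :: real assume \<delta>: "0 < \<delta>"
  then have \<delta>2: "0 < \<delta> / 2" by simp
  show "(\<lambda>n. outer_measure_of (P n) {x \<in> space (P n). ereal \<delta> < \<bar>ereal (norm (h n x - matrix_inv (K n) *v S n x))\<bar>}) \<longlonglongrightarrow> 0"
  proof (rule order_tendstoI)
    fix e :: ennreal assume "0 < e"
    \<comment> \<open>The tightness event may use up e'; the strict gap to e absorbs the vanishing
      sum over the net.\<close>
    then obtain e' where e': "0 < e'" "e' < e" using dense by blast
    obtain R where R: "\<forall>\<^sub>F n in sequentially. outer_measure_of (P n) {x \<in> space (P n). R < norm (S n x)} \<le> e'"
      using tight[OF e'(1)] by blast
    define \<rho> where "\<rho> = (\<Sum>a\<in>UNIV. \<Sum>b\<in>UNIV. \<bar>(matrix_inv J) $ a $ b\<bar>) * R"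
    have "\<forall>x. x \<noteq> 0 \<longrightarrow> 0 < x \<bullet> (J *v x)" using pos by blast
    from concave_argmax_near[OF sym this \<delta>2, of \<rho>]
    obtain G \<epsilon> where net: "quadratic_argmax_net J \<rho> (\<delta> / 2) G \<epsilon>" by blast
    note G = quadratic_argmax_netD(1,2)[OF net] and arg = quadratic_argmax_netD(3)[OF net]
    \<comment> \<open>The origin is added because closeness of \<open>A n x 0\<close> to 0 makes it
      finite, which is the guard in the assumption on the maximiser.\<close>
    let ?G = "insert 0 G"
    \<comment> \<open>Half the tolerance goes to the expansion with \<open>K n\<close>; the other
      half pays for replacing \<open>K n\<close> by J at the net points.\<close>
    define T where "T n z = {x \<in> space (P n). ereal (\<epsilon> / 2) < \<bar>A n x z - ereal (z \<bullet> S n x - 1/2 * (z \<bullet> (K n *v z)))\<bar>}" for n z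
    have "(\<lambda>n. outer_measure_of (P n) (T n z)) \<longlonglongrightarrow> 0" for z
      unfolding T_def using G(2) by (intro expansion[of z, unfolded oP1_def, rule_format]) simp
    then have "(\<lambda>n. \<Sum>z\<in>?G. outer_measure_of (P n) (T n z)) \<longlonglongrightarrow> (\<Sum>z\<in>?G. 0)"
      by (rule tendsto_sum)
    then have T0: "(\<lambda>n. e' + (\<Sum>z\<in>?G. outer_measure_of (P n) (T n z))) \<longlonglongrightarrow> e' + 0"
      by (intro tendsto_add tendsto_const) simp
    have evT: "\<forall>\<^sub>F n in sequentially. e' + (\<Sum>z\<in>?G. outer_measure_of (P n) (T n z)) < e"
      by (rule order_tendstoD(2)[OF T0]) (use e' in simp)
    have evD: "\<forall>\<^sub>F n in sequentially. \<forall>z\<in>?G. z \<in> D n"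
      using G(1) dom by (intro eventually_ball_finite) auto
    have evK: "\<forall>\<^sub>F n in sequentially. \<forall>z\<in>?G. \<bar>z \<bullet> (K n *v z) - z \<bullet> (J *v z)\<bar> < \<epsilon>"
    proof (intro eventually_ball_finite ballI)
      fix z
      have "(\<lambda>n. z \<bullet> (K n *v z)) \<longlonglongrightarrow> z \<bullet> (J *v z)"
        unfolding inner_vec_def matrix_vector_mult_def by (simp, intro tendsto_intros K)
      from tendstoD[OF this G(2)] show "\<forall>\<^sub>F n in sequentially. \<bar>z \<bullet> (K n *v z) - z \<bullet> (J *v z)\<bar> < \<epsilon>"
        by (simp add: dist_real_def)
    qed (use G in simp)
    \<comment> \<open>With a score sum of norm at most R, this accuracy of the inverse matrix costs
      at most \<delta>/2. The form |R| + 1 keeps the divisor positive for every real R.\<close>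
    have "0 < \<delta> / 2 / (\<bar>R\<bar> + 1)" using \<delta> by (intro divide_pos_pos) auto
    from matrix_inv_uniformly_tendsto[OF pos K this]
    have evI: "\<forall>\<^sub>F n in sequentially. \<forall>v. norm (matrix_inv (K n) *v v - matrix_inv J *v v) \<le> \<delta> / 2 / (\<bar>R\<bar> + 1) * norm v" .
    show "\<forall>\<^sub>F n in sequentially. outer_measure_of (P n) {x \<in> space (P n). ereal \<delta> < \<bar>ereal (norm (h n x - matrix_inv (K n) *v S n x))\<bar>} < e"
      using evT evD evK evI R conc argmax
    proof eventually_elim
      case (elim n)
      define N1 where "N1 = {x \<in> space (P n). \<not> ext_concave_on (D n) (A n x)}"
      define N2 where "N2 = {x \<in> space (P n). \<not> (\<bar>A n x 0\<bar> \<noteq> \<infinity> \<longrightarrow> h n x \<in> D n \<and> (\<forall>z\<in>D n. A n x z \<le> A n x (h n x)))}"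
      define N3 where "N3 = {x \<in> space (P n). R < norm (S n x)}"
      have sub: "{x \<in> space (P n). ereal \<delta> < \<bar>ereal (norm (h n x - matrix_inv (K n) *v S n x))\<bar>}
        \<subseteq> N1 \<union> (N2 \<union> (N3 \<union> (\<Union>z\<in>?G. T n z)))" (is "?E \<subseteq> ?U")
      proof (rule subsetI, rule ccontr)
        fix x assume xE: "x \<in> ?E" and xU: "x \<notin> ?U"
        from xE have xs: "x \<in> space (P n)" by simp
        have c1: "ext_concave_on (D n) (A n x)" using xU xs by (simp add: N1_def)
        have c3: "norm (S n x) \<le> R" using xU xs by (simp add: N3_def)
        have cT: "\<bar>A n x z - ereal (z \<bullet> S n x - 1/2 * (z \<bullet> (K n *v z)))\<bar> \<le> ereal (\<epsilon> / 2)" if "z \<in> ?G" for z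
          using xU xs that unfolding T_def by (auto simp: not_less)
        have "\<bar>A n x 0\<bar> \<noteq> \<infinity>" using cT[of 0] by auto
        then have c2: "h n x \<in> D n" "\<And>z. z \<in> D n \<Longrightarrow> A n x z \<le> A n x (h n x)"
          using xU xs by (auto simp: N2_def)
        define s where "s = matrix_inv J *v S n x"
        have Js: "J *v s = S n x" by (simp add: s_def matrix_vector_mul_assoc positive_definite_inverse[OF pos])
        have "norm s \<le> (\<Sum>a\<in>UNIV. \<Sum>b\<in>UNIV. \<bar>(matrix_inv J) $ a $ b\<bar>) * norm (S n x)"
          unfolding s_def by (rule norm_matrix_vector_mult_le)
        also have "\<dots> \<le> \<rho>" unfolding \<rho>_def by (intro mult_left_mono c3 sum_nonneg) auto
        finally have sr: "norm s \<le> \<rho>" .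
        have "norm (h n x - s) \<le> \<delta> / 2"
        proof (rule arg[OF sr c1 _ _ c2])
          show "G \<subseteq> D n" using elim(2) by auto
          fix z assume z: "z \<in> G"
          have "\<bar>z \<bullet> (K n *v z) - z \<bullet> (J *v z)\<bar> < \<epsilon>" using elim(3) z by blast
          then have "\<bar>(z \<bullet> S n x - 1/2 * (z \<bullet> (K n *v z))) - (z \<bullet> S n x - 1/2 * (z \<bullet> (J *v z)))\<bar> \<le> \<epsilon> / 2"
            by linarith
          from ereal_abs_diff_le_add[OF cT this] z
          show "\<bar>A n x z - ereal (z \<bullet> (J *v s) - 1/2 * (z \<bullet> (J *v z)))\<bar> \<le> ereal \<epsilon>"
            unfolding Js by simp
        qed
        moreover have "norm (s - matrix_inv (K n) *v S n x) \<le> \<delta> / 2"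
        proof -
          have "norm (s - matrix_inv (K n) *v S n x) \<le> \<delta> / 2 / (\<bar>R\<bar> + 1) * norm (S n x)"
            using elim(4) by (simp add: s_def norm_minus_commute)
          also have "\<dots> \<le> \<delta> / 2 / (\<bar>R\<bar> + 1) * (\<bar>R\<bar> + 1)" using c3 \<delta> by (intro mult_left_mono) auto
          also have "\<dots> = \<delta> / 2"
          proof -
            have "\<delta> / 2 / k * k = \<delta> / 2" if "0 < k" for k :: real using that by simp
            from this[of "\<bar>R\<bar> + 1"] show ?thesis by linarith
          qed
          finally show ?thesis .
        qed
        moreover have "norm (h n x - matrix_inv (K n) *v S n x) \<le> norm (h n x - s) + norm (s - matrix_inv (K n) *v S n x)"
          using norm_triangle_ineq[of "h n x - s" "s - matrix_inv (K n) *v S n x"] by simp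
        ultimately show False using xE by simp
      qed
      have "outer_measure_of (P n) ?E \<le> outer_measure_of (P n) ?U" by (rule outer_measure_of_mono[OF sub])
      also have "\<dots> \<le> outer_measure_of (P n) N1 + (outer_measure_of (P n) N2 + (outer_measure_of (P n) N3
          + (\<Sum>z\<in>?G. outer_measure_of (P n) (T n z))))"
        using G(1) by (intro order_trans[OF outer_measure_of_Un_le] add_left_mono outer_measure_of_UN_le)
          (auto simp: N1_def N2_def N3_def T_def)
      also have "outer_measure_of (P n) N1 = 0" unfolding N1_def by (rule outer_measure_of_AE[OF elim(6)])
      also have "outer_measure_of (P n) N2 = 0" unfolding N2_def by (rule outer_measure_of_AE[OF elim(7)])
      also have "0 + (0 + (outer_measure_of (P n) N3 + (\<Sum>z\<in>?G. outer_measure_of (P n) (T n z))))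
        \<le> e' + (\<Sum>z\<in>?G. outer_measure_of (P n) (T n z))"
        using elim(5) by (simp add: N3_def add_right_mono)
      also have "\<dots> < e" by (rule elim(1))
      finally show ?case .
    qed
  qed simp
qed

section \<open>Efficient scores\<close>

lemma vec_eq_sum_axis: "(x :: real^'n) = (\<Sum>a\<in>UNIV. (x $ a) *\<^sub>R axis a 1)"
  using basis_expansion[of x] by (simp add: scalar_mult_eq_scaleR)

lemma borel_measurable_vecI:
  fixes f :: "'a \<Rightarrow> real^'n"
  assumes "\<And>a. (\<lambda>x. f x $ a) \<in> borel_measurable M" shows "f \<in> borel_measurable M"
proof -
  have "(\<lambda>x. \<Sum>a\<in>UNIV. (f x $ a) *\<^sub>R (axis a 1 :: real^'n)) \<in> borel_measurable M"
    by (rule borel_measurable_sum, rule borel_measurable_scaleR[OF assms borel_measurable_const])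
  then show ?thesis using vec_eq_sum_axis[of "f _"] by simp
qed

lemma integrable_vecI:
  fixes f :: "'a \<Rightarrow> real^'n"
  assumes "\<And>a. integrable M (\<lambda>x. f x $ a)" shows "integrable M f"
proof -
  have "integrable M (\<lambda>x. \<Sum>a\<in>UNIV. (f x $ a) *\<^sub>R (axis a 1 :: real^'n))"
    by (rule Bochner_Integration.integrable_sum, rule integrable_scaleR_left, rule assms)
  then show ?thesis using vec_eq_sum_axis[of "f _"] by simp
qed

lemma integral_vec_nth:
  fixes f :: "'a \<Rightarrow> real^'n"
  assumes "integrable M f" shows "(\<integral>x. f x \<partial>M) $ a = (\<integral>x. f x $ a \<partial>M)"
  using integral_bounded_linear[OF bounded_linear_vec_nth assms] by simp

lemma inner_L2:
  fixes f :: "'a \<Rightarrow> real^'n"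
  assumes "\<And>a. (\<lambda>x. f x $ a) \<in> L2 M" shows "(\<lambda>x. u \<bullet> f x) \<in> L2 M"
  unfolding inner_vec_def inner_real_def by (intro L2_sum L2_scale assms)

lemma second_moment_bilinear:
  fixes f :: "'a \<Rightarrow> real^'n"
  assumes f: "\<And>a. (\<lambda>x. f x $ a) \<in> L2 M"
  shows "(\<integral>x. (u \<bullet> f x) * (v \<bullet> f x) \<partial>M) = u \<bullet> (second_moment M f *v v)"
proof -
  have i: "integrable M (\<lambda>x. f x $ a * f x $ b)" for a b by (intro L2_integrable_mult f)
  have "(\<lambda>x. (u \<bullet> f x) * (v \<bullet> f x)) = (\<lambda>x. \<Sum>a\<in>UNIV. \<Sum>b\<in>UNIV. (u $ a * v $ b) * (f x $ a * f x $ b))"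
    by (simp add: inner_vec_def sum_product mult_ac)
  then have "(\<integral>x. (u \<bullet> f x) * (v \<bullet> f x) \<partial>M) = (\<Sum>a\<in>UNIV. \<Sum>b\<in>UNIV. (u $ a * v $ b) * (\<integral>x. f x $ a * f x $ b \<partial>M))"
    using i by (simp add: Bochner_Integration.integral_sum)
  also have "\<dots> = u \<bullet> (second_moment M f *v v)"
    by (simp add: inner_vec_def matrix_vector_mult_def second_moment_def sum_distrib_left mult_ac)
  finally show ?thesis .
qed

lemma second_moment_symmetric: "transpose (second_moment M f) = second_moment M f"
  by (simp add: vec_eq_iff transpose_def second_moment_def mult.commute)

text \<open>A Gram matrix is positive semidefinite, and by Cauchy-Schwarz x \<bullet> (J *v x) = 0
  forces J x to be orthogonal to every u, hence 0. Invertibility excludes this for x \<noteq>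
  0.\<close>

lemma second_moment_positive_definite:
  fixes f :: "'a \<Rightarrow> real^'n"
  assumes f: "\<And>a. (\<lambda>x. f x $ a) \<in> L2 M" and inv: "invertible (second_moment M f)" and x: "x \<noteq> 0"
  shows "0 < x \<bullet> (second_moment M f *v x)"
proof -
  let ?J = "second_moment M f"
  have L: "(\<lambda>y. u \<bullet> f y) \<in> L2 M" for u by (rule inner_L2[OF f])
  have sq: "(\<integral>y. (x \<bullet> f y)\<^sup>2 \<partial>M) = x \<bullet> (?J *v x)"
    using second_moment_bilinear[OF f, of x x] by (simp add: power2_eq_square)
  have "0 \<le> x \<bullet> (?J *v x)" unfolding sq[symmetric] by (rule Bochner_Integration.integral_nonneg) simp
  moreover have "x \<bullet> (?J *v x) \<noteq> 0"
  proof
    assume "x \<bullet> (?J *v x) = 0"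
    then have "u \<bullet> (?J *v x) = 0" for u
      using L2_Cauchy_Schwarz[OF L[of u] L[of x]] unfolding sq second_moment_bilinear[OF f] by simp
    then have "?J *v x = 0" by (metis inner_eq_zero_iff)
    moreover obtain B where "B ** ?J = mat 1" using inv unfolding invertible_def by blast
    ultimately have "x = 0"
      by (metis matrix_vector_mul_assoc matrix_vector_mul_lid matrix_vector_mult_0_right)
    with x show False by simp
  qed
  ultimately show ?thesis by simp
qed

lemma parametric_efficient_score_L2:
  assumes "is_parametric_efficient_score M \<Theta> k \<Gamma> q \<theta>0 \<gamma>0 eff"
  shows "(\<lambda>x. eff x $ a) \<in> L2 (law M q \<theta>0 \<gamma>0)"
proof -
  obtain ldot vdot i01 W where s: "parametric_scores M \<Theta> k \<Gamma> q \<theta>0 \<gamma>0 ldot vdot"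
    and e: "eff = (\<lambda>x. ldot x - (\<chi> a. \<Sum>i<k. \<Sum>j<k. i01 a i * W i j * vdot x j))"
    using assms unfolding is_parametric_efficient_score_def by blast
  have "(\<lambda>x. eff x $ a) = (\<lambda>x. ldot x $ a - (\<Sum>i<k. \<Sum>j<k. (i01 a i * W i j) * vdot x j))"
    by (simp add: e)
  then show ?thesis
    using s unfolding parametric_scores_def by (simp only:) (intro L2_diff L2_sum L2_scale; simp)
qed

lemma parametric_efficient_score_mean:
  assumes "is_parametric_efficient_score M \<Theta> k \<Gamma> q \<theta>0 \<gamma>0 eff" "prob_space (law M q \<theta>0 \<gamma>0)"
  shows "(\<integral>x. eff x $ a \<partial>law M q \<theta>0 \<gamma>0) = 0"
proof -
  interpret prob_space "law M q \<theta>0 \<gamma>0" by fact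
  have "integrable (law M q \<theta>0 \<gamma>0) eff"
    by (intro integrable_vecI L2_integrable parametric_efficient_score_L2[OF assms(1)])
  from integral_vec_nth[OF this, of a] show ?thesis
    using assms(1) unfolding is_parametric_efficient_score_def by auto
qed

lemma efficient_score_L2:
  assumes "is_efficient_score P score D eff" "\<And>a. (\<lambda>x. score x $ a) \<in> L2 P"
  shows "(\<lambda>x. eff x $ a) \<in> L2 P"
  using assms unfolding is_efficient_score_def is_L2_projection_def L2_closure_def
  by (auto intro!: L2_diff)

text \<open>The efficient score is orthogonal to the closed span of the nuisance scores, which
  contains both D b and the projection of the score. Of f only \<tau> \<bullet> eff survives, so the
  value does not depend on b; this is the source of regularity.\<close>

lemma efficient_score_inner:
  fixes score eff :: "'x \<Rightarrow> real^'p"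
  assumes eff: "is_efficient_score P score D eff" and score: "\<And>a. (\<lambda>x. score x $ a) \<in> L2 P"
    and D: "\<And>b. D b \<in> L2 P" and f: "f \<in> borel_measurable P" "AE x in P. f x = \<tau> \<bullet> score x + D b x"
  shows "(\<integral>x. (u \<bullet> eff x) * f x \<partial>P) = u \<bullet> (second_moment P eff *v \<tau>)"
proof -
  obtain \<Pi>s :: "'x \<Rightarrow> real^'p" where pr: "\<And>a. is_L2_projection P (L2_closure P (range D)) (\<lambda>x. score x $ a) (\<lambda>x. \<Pi>s x $ a)"
    and e: "eff = (\<lambda>x. score x - \<Pi>s x)"
    using eff unfolding is_efficient_score_def by blast
  have L: "(\<lambda>x. eff x $ a) \<in> L2 P" for a by (rule efficient_score_L2[OF eff score])
  have orth: "(\<integral>x. eff x $ a * v x \<partial>P) = 0" if "v \<in> L2_closure P (range D)" for a v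
    using pr[of a] that unfolding is_L2_projection_def e by simp
  have cl: "v \<in> L2 P" if "v \<in> L2_closure P (range D)" for v
    using that by (simp add: L2_closure_def)
  have Pc: "(\<lambda>x. \<Pi>s x $ a) \<in> L2_closure P (range D)" for a
    using pr[of a] by (simp add: is_L2_projection_def)
  have Dc: "D b \<in> L2_closure P (range D)"
    unfolding L2_closure_def using D[of b] by (auto intro!: exI[of _ b])
  have u0: "(\<integral>x. (u \<bullet> eff x) * v x \<partial>P) = 0" if v: "v \<in> L2_closure P (range D)" for v
  proof -
    have "(\<lambda>x. (u \<bullet> eff x) * v x) = (\<lambda>x. \<Sum>a\<in>UNIV. u $ a * (eff x $ a * v x))"
      by (simp add: inner_vec_def sum_distrib_right mult.assoc)
    then show ?thesis
      using L2_integrable_mult[OF L cl[OF v]] by (simp add: Bochner_Integration.integral_sum orth[OF v])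
  qed
  have uE: "(\<lambda>x. u \<bullet> eff x) \<in> L2 P" "(\<lambda>x. \<tau> \<bullet> eff x) \<in> L2 P" by (rule inner_L2[OF L])+
  have "(\<integral>x. (u \<bullet> eff x) * f x \<partial>P) = (\<integral>x. (u \<bullet> eff x) * (\<tau> \<bullet> eff x)
      + ((\<Sum>a\<in>UNIV. \<tau> $ a * ((u \<bullet> eff x) * \<Pi>s x $ a)) + (u \<bullet> eff x) * D b x) \<partial>P)"
  proof (rule Bochner_Integration.integral_cong_AE)
    show "(\<lambda>x. (u \<bullet> eff x) * f x) \<in> borel_measurable P"
      using L2_measurable[OF uE(1)] f(1) by (rule borel_measurable_times)
    show "(\<lambda>x. (u \<bullet> eff x) * (\<tau> \<bullet> eff x)
      + ((\<Sum>a\<in>UNIV. \<tau> $ a * ((u \<bullet> eff x) * \<Pi>s x $ a)) + (u \<bullet> eff x) * D b x)) \<in> borel_measurable P"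
      by (intro borel_measurable_add borel_measurable_times borel_measurable_sum borel_measurable_const
          L2_measurable uE D cl[OF Pc])
    have eq: "\<tau> \<bullet> score x = \<tau> \<bullet> eff x + (\<Sum>a\<in>UNIV. \<tau> $ a * \<Pi>s x $ a)" for x
      by (simp add: e inner_diff_right) (simp add: inner_vec_def)
    show "AE x in P. (u \<bullet> eff x) * f x = (u \<bullet> eff x) * (\<tau> \<bullet> eff x)
      + ((\<Sum>a\<in>UNIV. \<tau> $ a * ((u \<bullet> eff x) * \<Pi>s x $ a)) + (u \<bullet> eff x) * D b x)"
      using f(2) by eventually_elim (simp add: eq distrib_left sum_distrib_left mult_ac)
  qed
  also have "\<dots> = (\<integral>x. (u \<bullet> eff x) * (\<tau> \<bullet> eff x) \<partial>P)"
    using L2_integrable_mult[OF uE] L2_integrable_mult[OF uE(1) cl[OF Pc]] L2_integrable_mult[OF uE(1) D]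
    by (simp add: Bochner_Integration.integral_sum u0[OF Pc] u0[OF Dc])
  also have "\<dots> = u \<bullet> (second_moment P eff *v \<tau>)" by (rule second_moment_bilinear[OF L])
  finally show ?thesis .
qed

section \<open>Limit of the characteristic function of the estimator\<close>

lemma L2_tendsto_scale_tendsto:
  assumes F: "L2_tendsto M F f" and c: "c \<longlonglongrightarrow> d"
  shows "L2_tendsto M (\<lambda>n x. c n * F n x) (\<lambda>x. d * f x)"
proof -
  note F' = L2_tendstoD[OF F]
  have "L2_tendsto M (\<lambda>n x. (c n - d) * F n x) (\<lambda>_. 0)"
    unfolding L2_tendsto_zero_iff
  proof (intro conjI allI)
    show "(\<lambda>x. (c n - d) * F n x) \<in> L2 M" for n by (rule L2_scale[OF F'(1)])
    have "(\<lambda>n. (c n - d)\<^sup>2 * (\<integral>x. (F n x)\<^sup>2 \<partial>M)) \<longlonglongrightarrow> (d - d)\<^sup>2 * (\<integral>x. (f x)\<^sup>2 \<partial>M)"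
      by (intro tendsto_intros c L2_tendsto_square[OF F])
    then show "(\<lambda>n. \<integral>x. ((c n - d) * F n x)\<^sup>2 \<partial>M) \<longlonglongrightarrow> 0"
      by (simp add: power_mult_distrib)
  qed
  from L2_tendsto_add[OF this L2_tendsto_scale[OF F, of d]] show ?thesis
    by (simp add: algebra_simps)
qed

lemma L2_tendsto_sum:
  assumes "\<And>i. i \<in> I \<Longrightarrow> L2_tendsto M (F i) (f i)"
  shows "L2_tendsto M (\<lambda>n x. \<Sum>i\<in>I. F i n x) (\<lambda>x. \<Sum>i\<in>I. f i x)"
  using assms
proof (induction I rule: infinite_finite_induct)
  case (insert i I)
  then have "L2_tendsto M (\<lambda>n x. F i n x + (\<Sum>i\<in>I. F i n x)) (\<lambda>x. f i x + (\<Sum>i\<in>I. f i x))"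
    by (intro L2_tendsto_add) auto
  then show ?case using insert by simp
qed (auto simp: L2_tendsto_def)

lemma integral_prod_law_iexp:
  fixes u :: "'a \<Rightarrow> real"
  assumes P: "prob_space P" and u: "u \<in> borel_measurable P"
  shows "(\<integral>x. iexp ((1 / sqrt (real n)) * (\<Sum>i<n. u (x i))) \<partial>prod_law n P) = (\<integral>y. iexp (u y / sqrt (real n)) \<partial>P) ^ n"
proof -
  interpret prob_space P by fact
  have "(\<integral>x. iexp ((1 / sqrt (real n)) * (\<Sum>i<n. u (x i))) \<partial>prod_law n P)
      = (\<integral>x. (\<Prod>i<n. iexp (u (x i) / sqrt (real n))) \<partial>prod_law n P)"
    by (simp add: exp_sum[symmetric] sum_distrib_left sum_divide_distrib)
  also have "\<dots> = (\<Prod>i<n. \<integral>y. iexp (u y / sqrt (real n)) \<partial>P)"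
    by (rule integral_prod_law_prod(1)[OF sigma_finite_measure_axioms], rule integrable_iexp) (use u in measurable)
  finally show ?thesis by simp
qed

lemma iexp_diff_bound: "cmod (iexp a - iexp b) \<le> 2" "cmod (iexp a - iexp b) \<le> 2 * \<bar>a - b\<bar>"
proof -
  have "iexp a - iexp b = iexp b * (iexp (a - b) - 1)"
    by (simp add: algebra_simps flip: exp_add)
  then have "cmod (iexp a - iexp b) = cmod (iexp (a - b) - 1)" by (simp add: norm_mult)
  then have b: "cmod (iexp a - iexp b) \<le> 2 * min 1 \<bar>a - b\<bar>"
    using iexp_bound0[of "a - b"] by simp
  also have "\<dots> \<le> 2 * 1" by (intro mult_left_mono) auto
  finally show "cmod (iexp a - iexp b) \<le> 2" by simp
  note b
  also have "2 * min 1 \<bar>a - b\<bar> \<le> 2 * \<bar>a - b\<bar>" by (intro mult_left_mono) auto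
  finally show "cmod (iexp a - iexp b) \<le> 2 * \<bar>a - b\<bar>" .
qed

text \<open>Slutsky's lemma for characteristic functions: where U and V are within e, the integrands
  differ by at most 2 e times the norm of t; elsewhere they differ by at most 2 on a set of
  vanishing probability.\<close>

lemma iexp_integral_diff_tendsto_zero:
  fixes U V :: "nat \<Rightarrow> 's \<Rightarrow> 'v::euclidean_space"
  assumes P: "\<And>n. prob_space (P n)" and U: "\<And>n. U n \<in> borel_measurable (P n)" and V: "\<And>n. V n \<in> borel_measurable (P n)"
    and l: "\<And>e. 0 < e \<Longrightarrow> (\<lambda>n. measure (P n) {x \<in> space (P n). e < norm (U n x - V n x)}) \<longlonglongrightarrow> 0"
  shows "(\<lambda>n. (\<integral>x. iexp (t \<bullet> U n x) \<partial>P n) - (\<integral>x. iexp (t \<bullet> V n x) \<partial>P n)) \<longlonglongrightarrow> 0"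
proof (rule LIMSEQ_I)
  fix r :: real assume r: "0 < r"
  define e where "e = r / (4 * (norm t + 1))"
  have e: "0 < e" using r by (auto simp: e_def intro!: divide_pos_pos add_nonneg_pos)
  \<comment> \<open>The right-hand side is 3 r / 4; the remaining r / 4 covers the exceptional set,
    whose probability is below r / 8.\<close>
  have te: "2 * (norm t * e) < r / 2 + r / 2 - r / 4"
  proof -
    have "(norm t + 1) * e = r / 4"
    proof -
      have "k * (r / (4 * k)) = r / 4" if "0 < k" for k using that by simp
      from this[of "norm t + 1"] show ?thesis by (simp add: e_def add_nonneg_pos)
    qed
    then have "norm t * e + e = r / 4" by (simp add: distrib_right)
    then show ?thesis using e r by linarith
  qed
  let ?B = "\<lambda>n. {x \<in> space (P n). e < norm (U n x - V n x)}"
  have "\<forall>\<^sub>F n in sequentially. measure (P n) (?B n) < r / 8"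
    by (rule order_tendstoD[OF l[OF e]]) (use r in simp)
  then have "\<forall>\<^sub>F n in sequentially. norm ((\<integral>x. iexp (t \<bullet> U n x) \<partial>P n) - (\<integral>x. iexp (t \<bullet> V n x) \<partial>P n) - 0) < r"
  proof eventually_elim
    case (elim n)
    interpret prob_space "P n" by (rule P)
    have [measurable]: "U n \<in> borel_measurable (P n)" "V n \<in> borel_measurable (P n)" by (fact U V)+
    have B: "?B n \<in> sets (P n)" by measurable
    have iU: "integrable (P n) (\<lambda>x. iexp (t \<bullet> U n x))" and iV: "integrable (P n) (\<lambda>x. iexp (t \<bullet> V n x))"
      by (rule integrable_iexp; measurable)+
    have iB: "integrable (P n) (\<lambda>x. indicator (?B n) x :: real)"
      using B by (simp add: integrable_real_indicator emeasure_eq_measure)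
    have b: "cmod (iexp (t \<bullet> U n x) - iexp (t \<bullet> V n x)) \<le> 2 * (norm t * e) + 2 * indicator (?B n) x" if "x \<in> space (P n)" for x
    proof (cases "x \<in> ?B n")
      case True
      have "cmod (iexp (t \<bullet> U n x) - iexp (t \<bullet> V n x)) \<le> 2"
        by (rule iexp_diff_bound)
      moreover have "0 \<le> norm t * e" using e by simp
      moreover have "indicator (?B n) x = (1::real)" using True by simp
      ultimately show ?thesis by linarith
    next
      case False
      then have nb: "norm (U n x - V n x) \<le> e" using that by simp
      have "\<bar>t \<bullet> U n x - t \<bullet> V n x\<bar> \<le> norm t * norm (U n x - V n x)"
        unfolding inner_diff_right[symmetric] by (rule Cauchy_Schwarz_ineq2)
      also have "\<dots> \<le> norm t * e" by (intro mult_left_mono nb) simp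
      finally have le: "2 * \<bar>t \<bullet> U n x - t \<bullet> V n x\<bar> \<le> 2 * (norm t * e)" by simp
      have "indicator (?B n) x = (0::real)" using False by simp
      then show ?thesis using order_trans[OF iexp_diff_bound(2) le] by simp
    qed
    have "norm ((\<integral>x. iexp (t \<bullet> U n x) \<partial>P n) - (\<integral>x. iexp (t \<bullet> V n x) \<partial>P n))
       = norm (\<integral>x. iexp (t \<bullet> U n x) - iexp (t \<bullet> V n x) \<partial>P n)"
      using iU iV by simp
    also have "\<dots> \<le> (\<integral>x. norm (iexp (t \<bullet> U n x) - iexp (t \<bullet> V n x)) \<partial>P n)" by (rule integral_norm_bound)
    also have "\<dots> \<le> (\<integral>x. 2 * (norm t * e) + 2 * indicator (?B n) x \<partial>P n)"
      by (rule integral_mono) (use iU iV iB b in auto)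
    also have "\<dots> = 2 * (norm t * e) + 2 * measure (P n) (?B n)"
      using iB B by (simp add: prob_space)
    finally show ?case using te elim by simp
  qed
  then show "\<exists>N. \<forall>n\<ge>N. norm ((\<integral>x. iexp (t \<bullet> U n x) \<partial>P n) - (\<integral>x. iexp (t \<bullet> V n x) \<partial>P n) - 0) < r"
    by (simp add: eventually_sequentially)
qed

lemma matrix_vector_mult_sum_right:
  fixes A :: "real^'n^'m"
  shows "A *v (\<Sum>i\<in>I. f i) = (\<Sum>i\<in>I. A *v f i)"
  by (rule linear_sum[OF matrix_vector_mul_linear])

text \<open>Pairing with t turns the linear part of the estimator into a normalised sum of one
  scalar function, a combination of the scores with convergent coefficients
  \<open>t v* matrix_inv (K n)\<close>. For the limit coefficients s0 the variance s0 \<bullet> (J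
  *v s0) becomes the quadratic form of the inverse of J at t, and the drift s0 \<bullet> (J *v
  \<tau>) becomes t \<bullet> \<tau>, which cancels the centring at \<tau>.\<close>

lemma char_limit_estimator:
  fixes sc :: "nat \<Rightarrow> 'x \<Rightarrow> real^'p" and eff :: "'x \<Rightarrow> real^'p" and J :: "real^'p^'p"
  assumes p0: "is_density M p0" and q: "\<And>n. is_density M (q n)" and r: "\<And>n. is_density M (r n)"
    and dq: "L2_tendsto M (\<lambda>n y. sqrt (real n) * (sqrt (q n y) - sqrt (p0 y))) (\<lambda>y. 1/2 * g y * sqrt (p0 y))"
    and dr: "L2_tendsto M (\<lambda>n y. sqrt (real n) * (sqrt (r n y) - sqrt (p0 y))) (\<lambda>y. 1/2 * f y * sqrt (p0 y))"
    and fL: "f \<in> L2 (density M p0)" and gL: "g \<in> L2 (density M p0)"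
    and lm: "\<And>n. sc n \<in> borel_measurable M" and em: "\<And>a. (\<lambda>y. eff y $ a) \<in> L2 (density M p0)"
    and ll: "\<And>a. L2_tendsto M (\<lambda>n y. sc n y $ a * sqrt (q n y)) (\<lambda>y. eff y $ a * sqrt (p0 y))"
    and l0: "\<And>n a. (\<integral>y. sc n y $ a \<partial>density M (q n)) = 0"
    and li: "\<And>n a. integrable (density M (q n)) (\<lambda>y. sc n y $ a)"
    and pos: "\<And>x. x \<noteq> 0 \<Longrightarrow> 0 < x \<bullet> (J *v x)" and J: "J = second_moment (density M p0) eff"
    and K: "\<And>a b. (\<lambda>n. K n $ a $ b) \<longlonglongrightarrow> J $ a $ b"
    and ef: "\<And>u. (\<integral>y. (u \<bullet> eff y) * f y \<partial>density M p0) = u \<bullet> (J *v \<tau>)"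
    and eg: "\<And>u. (\<integral>y. (u \<bullet> eff y) * g y \<partial>density M p0) = 0"
    and hm: "\<And>n. h n \<in> borel_measurable (prod_law n M)"
    and hl: "\<And>e. 0 < e \<Longrightarrow> (\<lambda>n. measure (prod_law n (density M (r n))) {x \<in> space (prod_law n (density M (r n))).
         e < norm (h n x - matrix_inv (K n) *v ((1 / sqrt (real n)) *\<^sub>R (\<Sum>i<n. sc n (x i))))}) \<longlonglongrightarrow> 0"
  shows "(\<lambda>n. \<integral>x. iexp (t \<bullet> (h n x - \<tau>)) \<partial>prod_law n (density M (r n)))
     \<longlonglongrightarrow> complex_of_real (exp (- ((t \<bullet> (matrix_inv J *v t)) / 2)))"
proof -
  let ?P = "\<lambda>n. prod_law n (density M (r n))" and ?N = "density M p0"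
  define s where "s n = t v* matrix_inv (K n)" for n
  define s0 where "s0 = t v* matrix_inv J"
  define u where "u n y = s n \<bullet> sc n y" for n y
  define u0 where "u0 y = s0 \<bullet> eff y" for y
  define Z where "Z n x = matrix_inv (K n) *v ((1 / sqrt (real n)) *\<^sub>R (\<Sum>i<n. sc n (x i)))" for n x
  have tZ: "t \<bullet> Z n x = (1 / sqrt (real n)) * (\<Sum>i<n. u n (x i))" for n x
    by (simp add: Z_def u_def s_def dot_lmul_matrix[symmetric] inner_sum_right)
  have s_lim: "(\<lambda>n. s n $ a) \<longlonglongrightarrow> s0 $ a" for a
  proof -
    have "(\<lambda>n. matrix_inv (K n) *v axis a 1) \<longlonglongrightarrow> matrix_inv J *v axis a 1"
    proof (rule tendstoI)
      fix e :: real assume e: "0 < e"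
      then have "0 < e / 2" by simp
      have "\<forall>\<^sub>F n in sequentially. \<forall>v. norm (matrix_inv (K n) *v v - matrix_inv J *v v) \<le> e / 2 * norm v"
        by (rule matrix_inv_uniformly_tendsto[OF pos K \<open>0 < e / 2\<close>])
      then show "\<forall>\<^sub>F n in sequentially. dist (matrix_inv (K n) *v axis a 1) (matrix_inv J *v axis a 1) < e"
      proof eventually_elim
        case (elim n)
        have "norm (matrix_inv (K n) *v axis a 1 - matrix_inv J *v axis a 1) \<le> e / 2 * norm (axis a (1::real))"
          using elim by blast
        then show ?case using e by (simp add: dist_norm)
      qed
    qed
    then have "(\<lambda>n. t \<bullet> (matrix_inv (K n) *v axis a 1)) \<longlonglongrightarrow> t \<bullet> (matrix_inv J *v axis a 1)"
      by (intro tendsto_intros)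
    then show ?thesis unfolding s_def s0_def dot_lmul_matrix[symmetric] by (simp add: inner_axis)
  qed
  have um: "u n \<in> borel_measurable M" for n
    unfolding u_def using lm by (intro borel_measurable_inner) auto
  have ul: "L2_tendsto M (\<lambda>n y. u n y * sqrt (q n y)) (\<lambda>y. u0 y * sqrt (p0 y))"
  proof -
    have "L2_tendsto M (\<lambda>n y. \<Sum>a\<in>UNIV. s n $ a * (sc n y $ a * sqrt (q n y))) (\<lambda>y. \<Sum>a\<in>UNIV. s0 $ a * (eff y $ a * sqrt (p0 y)))"
      by (intro L2_tendsto_sum L2_tendsto_scale_tendsto ll s_lim)
    then show ?thesis by (simp add: u_def u0_def inner_vec_def sum_distrib_right mult.assoc)
  qed
  have un: "(\<integral>y. u n y \<partial>density M (q n)) = 0" for n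
    unfolding u_def inner_vec_def inner_real_def
    using li l0 by (subst Bochner_Integration.integral_sum) auto
  have u0L: "u0 \<in> L2 ?N" unfolding u0_def by (rule inner_L2[OF em])
  have meas: "f \<in> borel_measurable M" "g \<in> borel_measurable M" "u0 \<in> borel_measurable M"
    using L2_measurable[OF fL] L2_measurable[OF gL] L2_measurable[OF u0L] by simp_all
  have c: "(\<lambda>n. (\<integral>y. iexp (u n y / sqrt (real n)) \<partial>density M (r n)) ^ n)
    \<longlonglongrightarrow> exp (- complex_of_real (1/2 * (\<integral>y. (u0 y)\<^sup>2 \<partial>?N)) + \<i> * complex_of_real (\<integral>y. u0 y * (f y - g y) \<partial>?N))"
    by (rule char_limit_local_alternatives[OF p0 q r dq dr um ul un meas])
  note Ji = positive_definite_inverse[OF pos]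
  have v2: "(\<integral>y. (u0 y)\<^sup>2 \<partial>?N) = t \<bullet> (matrix_inv J *v t)"
  proof -
    have "(\<integral>y. (u0 y)\<^sup>2 \<partial>?N) = s0 \<bullet> (J *v s0)"
      using second_moment_bilinear[OF em, of s0 s0] by (simp add: u0_def power2_eq_square J)
    also have "\<dots> = t \<bullet> (matrix_inv J *v (J *v s0))" unfolding s0_def by (rule dot_lmul_matrix)
    also have "matrix_inv J *v (J *v s0) = s0" by (simp add: matrix_vector_mul_assoc Ji)
    also have "t \<bullet> s0 = t \<bullet> (matrix_inv J *v t)"
      unfolding s0_def by (subst inner_commute) (rule dot_lmul_matrix)
    finally show ?thesis .
  qed
  have v1: "(\<integral>y. u0 y * (f y - g y) \<partial>?N) = t \<bullet> \<tau>"
  proof -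
    have "(\<integral>y. u0 y * (f y - g y) \<partial>?N) = (\<integral>y. u0 y * f y \<partial>?N) - (\<integral>y. u0 y * g y \<partial>?N)"
      using L2_integrable_mult[OF u0L fL] L2_integrable_mult[OF u0L gL] by (simp add: right_diff_distrib)
    also have "\<dots> = s0 \<bullet> (J *v \<tau>)" unfolding u0_def ef eg by simp
    also have "\<dots> = t \<bullet> (matrix_inv J *v (J *v \<tau>))" unfolding s0_def by (rule dot_lmul_matrix)
    also have "matrix_inv J *v (J *v \<tau>) = \<tau>" by (simp add: matrix_vector_mul_assoc Ji)
    finally show ?thesis .
  qed
  have eq: "(\<integral>x. iexp (t \<bullet> (Z n x - \<tau>)) \<partial>?P n) = iexp (- (t \<bullet> \<tau>)) * (\<integral>y. iexp (u n y / sqrt (real n)) \<partial>density M (r n)) ^ n" for n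
  proof -
    have "iexp (t \<bullet> (Z n x - \<tau>)) = iexp (- (t \<bullet> \<tau>)) * iexp ((1 / sqrt (real n)) * (\<Sum>i<n. u n (x i)))" for x
      unfolding inner_diff_right tZ exp_add[symmetric] by (simp add: algebra_simps)
    then have "(\<integral>x. iexp (t \<bullet> (Z n x - \<tau>)) \<partial>?P n) = iexp (- (t \<bullet> \<tau>)) * (\<integral>x. iexp ((1 / sqrt (real n)) * (\<Sum>i<n. u n (x i))) \<partial>?P n)"
      by (simp only: integral_mult_right_zero)
    also have "(\<integral>x. iexp ((1 / sqrt (real n)) * (\<Sum>i<n. u n (x i))) \<partial>?P n) = (\<integral>y. iexp (u n y / sqrt (real n)) \<partial>density M (r n)) ^ n"
      by (rule integral_prod_law_iexp[OF is_densityD(3)[OF r]]) (use um in simp)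
    finally show ?thesis .
  qed
  have Zl: "(\<lambda>n. \<integral>x. iexp (t \<bullet> (Z n x - \<tau>)) \<partial>?P n) \<longlonglongrightarrow> complex_of_real (exp (- ((t \<bullet> (matrix_inv J *v t)) / 2)))"
  proof -
    have e: "iexp (- (t \<bullet> \<tau>)) * exp (- complex_of_real (1/2 * (t \<bullet> (matrix_inv J *v t))) + \<i> * complex_of_real (t \<bullet> \<tau>))
       = complex_of_real (exp (- ((t \<bullet> (matrix_inv J *v t)) / 2)))"
      unfolding exp_add[symmetric] exp_of_real[symmetric] by simp
    show ?thesis
      using tendsto_mult_left[OF c, of "iexp (- (t \<bullet> \<tau>))"] unfolding eq v1 v2 e .
  qed
  have sets_eq: "sets (?P n) = sets (prod_law n M)" for n by (rule sets_prod_law_cong) simp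
  have hm': "h n \<in> borel_measurable (?P n)" for n
    using hm[of n] by (simp add: measurable_cong_sets[OF sets_eq refl])
  have Zm: "Z n \<in> borel_measurable (?P n)" for n
  proof -
    have "(\<lambda>x. \<Sum>i<n. sc n (x i)) \<in> borel_measurable (?P n)"
      by (rule borel_measurable_prod_law_sum) (use lm in simp)
    then have "(\<lambda>x. (1 / sqrt (real n)) *\<^sub>R (\<Sum>i<n. sc n (x i))) \<in> borel_measurable (?P n)" by measurable
    from measurable_compose[OF this linear_borel_measurable[OF matrix_vector_mul_linear]]
    show ?thesis unfolding Z_def .
  qed
  have d: "(\<lambda>n. (\<integral>x. iexp (t \<bullet> (h n x - \<tau>)) \<partial>?P n) - (\<integral>x. iexp (t \<bullet> (Z n x - \<tau>)) \<partial>?P n)) \<longlonglongrightarrow> 0"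
  proof (rule iexp_integral_diff_tendsto_zero)
    show "prob_space (?P n)" for n by (rule prob_space_prod_law[OF is_densityD(3)[OF r]])
    show "(\<lambda>x. h n x - \<tau>) \<in> borel_measurable (?P n)" "(\<lambda>x. Z n x - \<tau>) \<in> borel_measurable (?P n)" for n
      using hm' Zm by measurable
    show "(\<lambda>n. measure (?P n) {x \<in> space (?P n). e < norm (h n x - \<tau> - (Z n x - \<tau>))}) \<longlonglongrightarrow> 0" if "0 < e" for e
      using hl[OF that] by (simp add: Z_def)
  qed
  from tendsto_add[OF d Zl] show ?thesis by simp
qed

section \<open>Best regularity of the maximum likelihood estimator\<close>

lemma oP1_cong:
  assumes "oP1 P Y" "\<forall>\<^sub>F n in sequentially. P n = P' n \<and> (\<forall>x\<in>space (P n). Y n x = Y' n x)"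
  shows "oP1 P' Y'"
  unfolding oP1_def
proof (intro allI impI)
  fix e :: real assume "0 < e"
  then have "(\<lambda>n. outer_measure_of (P n) {x \<in> space (P n). ereal e < \<bar>Y n x\<bar>}) \<longlonglongrightarrow> 0"
    using assms(1) by (simp add: oP1_def)
  moreover have "\<forall>\<^sub>F n in sequentially. outer_measure_of (P n) {x \<in> space (P n). ereal e < \<bar>Y n x\<bar>}
      = outer_measure_of (P' n) {x \<in> space (P' n). ereal e < \<bar>Y' n x\<bar>}"
    using assms(2)
  proof eventually_elim
    case (elim n)
    then have "{x \<in> space (P n). ereal e < \<bar>Y n x\<bar>} = {x \<in> space (P' n). ereal e < \<bar>Y' n x\<bar>}" by auto
    then show ?case using elim by simp
  qed
  ultimately show "(\<lambda>n. outer_measure_of (P' n) {x \<in> space (P' n). ereal e < \<bar>Y' n x\<bar>}) \<longlonglongrightarrow> 0"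
    by (rule Lim_transform_eventually)
qed

lemma oP1_imp_measure:
  assumes Y: "oP1 P (\<lambda>n x. ereal (Y n x))" and P: "\<And>n. prob_space (P n)"
    and m: "\<And>n. Y n \<in> borel_measurable (P n)" and nn: "\<And>n x. 0 \<le> Y n x" and e: "0 < e"
  shows "(\<lambda>n. measure (P n) {x \<in> space (P n). e < Y n x}) \<longlonglongrightarrow> 0"
proof -
  have s: "{x \<in> space (P n). e < Y n x} \<in> sets (P n)" for n using m[of n] by measurable
  have "outer_measure_of (P n) {x \<in> space (P n). ereal e < \<bar>ereal (Y n x)\<bar>} = ennreal (measure (P n) {x \<in> space (P n). e < Y n x})" for n
    using nn s[of n] by (simp add: finite_measure.emeasure_eq_measure prob_space.finite_measure P)
  moreover have "(\<lambda>n. outer_measure_of (P n) {x \<in> space (P n). ereal e < \<bar>ereal (Y n x)\<bar>}) \<longlonglongrightarrow> 0"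
    using Y e unfolding oP1_def by blast
  ultimately have "(\<lambda>n. ennreal (measure (P n) {x \<in> space (P n). e < Y n x})) \<longlonglongrightarrow> ennreal 0" by simp
  then show ?thesis by (subst (asm) tendsto_ennreal_iff) auto
qed

lemma weakly_converges_cong:
  assumes "weakly_converges Q L" "\<forall>\<^sub>F n in sequentially. Q n = Q' n"
  shows "weakly_converges Q' L"
  unfolding weakly_converges_def
proof (intro allI impI)
  fix f :: "'a \<Rightarrow> real" assume "continuous_on UNIV f" "bounded (range f)"
  then have "(\<lambda>n. \<integral>x. f x \<partial>Q n) \<longlonglongrightarrow> (\<integral>x. f x \<partial>L)" using assms(1) by (simp add: weakly_converges_def)
  moreover have "\<forall>\<^sub>F n in sequentially. (\<integral>x. f x \<partial>Q n) = (\<integral>x. f x \<partial>Q' n)"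
    using assms(2) by eventually_elim simp
  ultimately show "(\<lambda>n. \<integral>x. f x \<partial>Q' n) \<longlonglongrightarrow> (\<integral>x. f x \<partial>L)" by (rule Lim_transform_eventually)
qed

text \<open>Chebyshev's inequality in each coordinate and a union bound; the variances stay bounded
  because they converge.\<close>

lemma score_sum_tight:
  fixes sc :: "nat \<Rightarrow> 'x \<Rightarrow> real^'p"
  assumes P: "\<And>n. prob_space (P n)" and L: "\<And>n a. (\<lambda>y. sc n y $ a) \<in> L2 (P n)"
    and z: "\<And>n a. (\<integral>y. sc n y $ a \<partial>P n) = 0"
    and v: "\<And>a. (\<lambda>n. \<integral>y. (sc n y $ a)\<^sup>2 \<partial>P n) \<longlonglongrightarrow> v a" and e: "0 < (e::ennreal)"
  shows "\<exists>R. \<forall>\<^sub>F n in sequentially. outer_measure_of (prod_law n (P n))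
     {x \<in> space (prod_law n (P n)). R < norm ((1 / sqrt (real n)) *\<^sub>R (\<Sum>i<n. sc n (x i)))} \<le> e"
proof (cases e)
  case top
  then show ?thesis by simp
next
  case (real r)
  then have r: "0 < r" using e by simp
  define V where "V = (\<Sum>a\<in>(UNIV::'p set). \<bar>v a\<bar> + 1)"
  have V: "0 < V" unfolding V_def by (intro sum_pos) (auto intro: add_nonneg_pos)
  \<comment> \<open>V bounds the sum of the coordinate variances for large n, so the union bound V /
    c^2 equals r.\<close>
  define c where "c = sqrt (V / r)"
  have c: "0 < c" "c\<^sup>2 = V / r" using V r by (auto simp: c_def)
  let ?S = "\<lambda>n x. (1 / sqrt (real n)) *\<^sub>R (\<Sum>i<n. sc n (x i))"
  have "\<forall>\<^sub>F n in sequentially. \<forall>a\<in>UNIV. (\<integral>y. (sc n y $ a)\<^sup>2 \<partial>P n) < \<bar>v a\<bar> + 1"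
    by (intro eventually_ball_finite ballI order_tendstoD[OF v]) auto
  then have "\<forall>\<^sub>F n in sequentially. outer_measure_of (prod_law n (P n))
     {x \<in> space (prod_law n (P n)). CARD('p) * c < norm (?S n x)} \<le> e"
    using eventually_gt_at_top[of 0]
  proof eventually_elim
    case (elim n)
    interpret PP: prob_space "prod_law n (P n)" by (rule prob_space_prod_law[OF P])
    let ?B = "\<lambda>a. {x \<in> space (prod_law n (P n)). c \<le> \<bar>(1 / sqrt (real n)) * (\<Sum>i<n. sc n (x i) $ a)\<bar>}"
    have B: "?B a \<in> sets (prod_law n (P n))" for a
    proof -
      have [measurable]: "(\<lambda>x. \<Sum>i<n. sc n (x i) $ a) \<in> borel_measurable (prod_law n (P n))"
        by (rule borel_measurable_prod_law_sum[OF L2_measurable[OF L]])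
      show ?thesis by measurable
    qed
    have sub: "{x \<in> space (prod_law n (P n)). CARD('p) * c < norm (?S n x)} \<subseteq> (\<Union>a\<in>UNIV. ?B a)"
    proof
      fix x assume x: "x \<in> {x \<in> space (prod_law n (P n)). CARD('p) * c < norm (?S n x)}"
      show "x \<in> (\<Union>a\<in>UNIV. ?B a)"
      proof (rule ccontr)
        assume "x \<notin> (\<Union>a\<in>UNIV. ?B a)"
        then have "\<bar>?S n x $ a\<bar> \<le> c" for a using x by (auto simp: not_le intro: less_imp_le)
        then have "(\<Sum>a\<in>UNIV. \<bar>?S n x $ a\<bar>) \<le> (\<Sum>a\<in>(UNIV::'p set). c)" by (intro sum_mono)
        then have "norm (?S n x) \<le> CARD('p) * c" using norm_le_l1_cart[of "?S n x"] by simp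
        with x show False by simp
      qed
    qed
    have "measure (prod_law n (P n)) (\<Union>a\<in>UNIV. ?B a) \<le> (\<Sum>a\<in>UNIV. measure (prod_law n (P n)) (?B a))"
      by (intro measure_UNION_le B) auto
    also have "\<dots> \<le> (\<Sum>a\<in>UNIV. (\<bar>v a\<bar> + 1) / c\<^sup>2)"
    proof (rule sum_mono)
      fix a :: 'p
      have "measure (prod_law n (P n)) (?B a) \<le> (\<integral>y. (sc n y $ a)\<^sup>2 \<partial>P n) / c\<^sup>2"
        by (rule prod_law_Chebyshev[OF P L z c(1) elim(2)])
      also have "\<dots> \<le> (\<bar>v a\<bar> + 1) / c\<^sup>2" using elim(1) by (intro divide_right_mono) (auto intro: less_imp_le)
      finally show "measure (prod_law n (P n)) (?B a) \<le> (\<bar>v a\<bar> + 1) / c\<^sup>2" .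
    qed
    also have "\<dots> = V / c\<^sup>2" by (simp add: V_def sum_divide_distrib)
    also have "\<dots> = r" using V r by (simp add: c(2))
    finally have le: "measure (prod_law n (P n)) (\<Union>a\<in>UNIV. ?B a) \<le> r" .
    have "outer_measure_of (prod_law n (P n)) {x \<in> space (prod_law n (P n)). CARD('p) * c < norm (?S n x)}
       \<le> outer_measure_of (prod_law n (P n)) (\<Union>a\<in>UNIV. ?B a)" by (rule outer_measure_of_mono[OF sub])
    also have "\<dots> = ennreal (measure (prod_law n (P n)) (\<Union>a\<in>UNIV. ?B a))"
      using B by (subst outer_measure_of_eq) (auto simp: PP.emeasure_eq_measure)
    also have "\<dots> \<le> ennreal r" by (rule ennreal_leI[OF le])
    finally show ?case by (simp only: real)
  qed
  then show ?thesis by blast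
qed

lemma elog_mono: "a \<le> b \<Longrightarrow> elog a \<le> elog b"
proof -
  assume ab: "a \<le> b"
  show ?thesis
  proof (cases "a = 0 \<or> b = \<infinity>")
    case False
    then have "0 < enn2real a" "enn2real a \<le> enn2real b"
      using ab by (auto simp: enn2real_positive_iff less_top[symmetric] top_unique zero_less_iff_neq_zero intro!: enn2real_mono)
    then show ?thesis using False ab by (auto simp: elog_def top_unique)
  qed (auto simp: elog_def)
qed

lemma local_par_inverse: "0 < n \<Longrightarrow> local_par \<theta>0 n (sqrt (real n) *\<^sub>R (\<theta> - \<theta>0)) = \<theta>"
  by (simp add: local_par_def)

theorem proposition5p1:
  fixes M :: "'x measure"
    and \<Theta> :: "(real^'p) set" and H :: "'e::topological_space set"
    and p :: "real^'p \<Rightarrow> 'e \<Rightarrow> 'x \<Rightarrow> real"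
    and \<theta>0 :: "real^'p" and \<eta>0 :: 'e
    and k :: "nat \<Rightarrow> nat" and \<Gamma> :: "nat \<Rightarrow> (nat \<Rightarrow> real) set"
    and Hm :: "nat \<Rightarrow> 'e set" and T :: "nat \<Rightarrow> 'e \<Rightarrow> (nat \<Rightarrow> real)"
    and q :: "nat \<Rightarrow> real^'p \<Rightarrow> (nat \<Rightarrow> real) \<Rightarrow> 'x \<Rightarrow> real"
    and \<gamma>0 :: "nat \<Rightarrow> (nat \<Rightarrow> real)"
    and \<eta>n :: "nat \<Rightarrow> 'b::real_normed_vector \<Rightarrow> 'e"
    and A :: "(real^'p) \<times> 'b \<Rightarrow> 'x \<Rightarrow> real"
    and score eff :: "'x \<Rightarrow> real^'p" and D :: "'b \<Rightarrow> 'x \<Rightarrow> real"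
    and P0 :: "'x measure" and Pm :: "nat \<Rightarrow> 'x measure"
    and J :: "real^'p^'p" and Jm :: "nat \<Rightarrow> real^'p^'p"
    and m :: "nat \<Rightarrow> nat" and effm :: "nat \<Rightarrow> 'x \<Rightarrow> real^'p"
    and est :: "nat \<Rightarrow> (nat \<Rightarrow> 'x) \<Rightarrow> real^'p"
  \<comment> \<open>the semiparametric family and its parametric approximations\<close>
  assumes "sigma_finite_measure M"
    and "\<theta>0 \<in> \<Theta>" and "\<eta>0 \<in> H"
    and "\<And>\<theta> \<eta>. \<theta> \<in> \<Theta> \<Longrightarrow> \<eta> \<in> H \<Longrightarrow> is_density M (p \<theta> \<eta>)"
    and "\<And>j. 1 \<le> j \<Longrightarrow> \<Gamma> j \<subseteq> extensional {..<k j}"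
    and "\<And>j. 1 \<le> j \<Longrightarrow> bij_betw (T j) (Hm j) (\<Gamma> j)"
    and "\<And>j \<theta> \<eta>. 1 \<le> j \<Longrightarrow> \<theta> \<in> \<Theta> \<Longrightarrow> \<eta> \<in> Hm j \<Longrightarrow> is_density M (p \<theta> \<eta>)"
    and q_def: "\<And>j \<theta> \<gamma>. q j \<theta> \<gamma> = p \<theta> (the_inv_into (Hm j) (T j) \<gamma>)"
    and "\<And>j. 1 \<le> j \<Longrightarrow> \<gamma>0 j \<in> \<Gamma> j"
    and "(\<lambda>j. the_inv_into (Hm j) (T j) (\<gamma>0 j)) \<longlonglongrightarrow> \<eta>0"
    and P0_def: "P0 = law M p \<theta>0 \<eta>0"
    and Pm_def: "\<And>j. Pm j = law M (q j) \<theta>0 (\<gamma>0 j)"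
  \<comment> \<open>differentiability in quadratic mean, efficient score and information\<close>
    and "diff_quadratic_mean M \<Theta> H p \<theta>0 \<eta>0 \<eta>n A score D"
    and "is_efficient_score P0 score D eff"
    and J_def: "J = second_moment P0 eff" and "invertible J"
  \<comment> \<open>the sequence of indices\<close>
    and "\<And>n. 1 \<le> n \<Longrightarrow> 1 \<le> m n" and "filterlim m at_top sequentially"
  \<comment> \<open>expansion of the log-likelihood ratio\<close>
    and "\<exists>g. g \<in> L2 P0 \<and> (\<integral>x. g x \<partial>P0) = 0 \<and> (\<integral>x. g x *\<^sub>R eff x \<partial>P0) = 0 \<and>
           oP1 (\<lambda>n. prod_law n P0)
             (\<lambda>n x. log_lik_ratio (q (m n) \<theta>0 (\<gamma>0 (m n))) (p \<theta>0 \<eta>0) n x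
                - ereal ((1 / sqrt (real n)) * (\<Sum>i<n. g (x i)) - 1/2 * (\<integral>y. (g y)\<^sup>2 \<partial>P0)))"
  \<comment> \<open>convergence of the efficient scores; \<open>effm j\<close> is the efficient score of the \<open>j\<close>th parametric model\<close>
    and "\<And>n. 1 \<le> n \<Longrightarrow> is_parametric_efficient_score M \<Theta> (k (m n)) (\<Gamma> (m n)) (q (m n)) \<theta>0 (\<gamma>0 (m n)) (effm (m n))"
    and "((\<lambda>n. \<integral>\<^sup>+x. ennreal ((norm (sqrt (q (m n) \<theta>0 (\<gamma>0 (m n)) x) *\<^sub>R effm (m n) x
              - sqrt (p \<theta>0 \<eta>0 x) *\<^sub>R eff x))\<^sup>2) \<partial>M) \<longlongrightarrow> 0) sequentially"
    and Jm_def: "\<And>j. Jm j = second_moment (Pm j) (effm j)"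
  \<comment> \<open>expansion of the profile log-likelihood\<close>
    and "\<And>h. oP1 (\<lambda>n. prod_law n (Pm (m n)))
           (\<lambda>n x. profile_log_ratio (q (m n)) (\<Gamma> (m n)) \<theta>0 n x h
              - ereal ((1 / sqrt (real n)) * (h \<bullet> (\<Sum>i<n. effm (m n) (x i)))
                   - 1/2 * (h \<bullet> (Jm (m n) *v h))))"
  \<comment> \<open>the supremum in the profile likelihood is attained\<close>
    and "\<forall>\<^sub>F n in sequentially. AE x in prod_law n (Pm (m n)). \<forall>\<theta>\<in>\<Theta>. \<exists>\<gamma>\<in>\<Gamma> (m n).
           likelihood (q (m n)) n x \<theta> \<gamma> = profile_likelihood (q (m n)) (\<Gamma> (m n)) n x \<theta>"
  \<comment> \<open>\<open>est n\<close> is the maximum likelihood estimator based on \<open>n\<close> observations in model \<open>m n\<close>\<close>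
    and "\<And>n. est n \<in> borel_measurable (prod_law n M)"
    and "\<forall>\<^sub>F n in sequentially. AE x in prod_law n (Pm (m n)). est n x \<in> \<Theta> \<and>
           (\<forall>\<theta>\<in>\<Theta>. profile_likelihood (q (m n)) (\<Gamma> (m n)) n x \<theta>
                  \<le> profile_likelihood (q (m n)) (\<Gamma> (m n)) n x (est n x))"
  \<comment> \<open>concavity\<close>
    and "\<forall>\<^sub>F n in sequentially. AE x in prod_law n (Pm (m n)).
           ext_concave_on {h. local_par \<theta>0 n h \<in> \<Theta>} (profile_log_ratio (q (m n)) (\<Gamma> (m n)) \<theta>0 n x)"
  shows "oP1 (\<lambda>n. prod_law n (Pm (m n)))
           (\<lambda>n x. ereal (norm (sqrt (real n) *\<^sub>R (est n x - \<theta>0)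
              - (1 / sqrt (real n)) *\<^sub>R (\<Sum>i<n. matrix_inv (Jm (m n)) *v effm (m n) (x i)))))
         \<and> best_regular M p \<theta>0 \<eta>n J est"
proof -

  \<comment> \<open>Densities and scores along the sequence of indices\<close>
  define p0 where "p0 = p \<theta>0 \<eta>0"
  \<comment> \<open>The hypotheses on the parametric models start at n = 1, while the lemmas on L2
    convergence speak of every index. At n = 0 the base density and the zero score are
    inserted.\<close>
  define pd where "pd n = (if n = 0 then p0 else q (m n) \<theta>0 (\<gamma>0 (m n)))" for n
  define sc where "sc n = (if n = 0 then (\<lambda>_. 0) else effm (m n))" for n
  define K where "K n = Jm (m n)" for n
  let ?P = "\<lambda>n. prod_law n (density M (pd n))"
  define hh where "hh n x = sqrt (real n) *\<^sub>R (est n x - \<theta>0)" for n x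
  have M: "sigma_finite_measure M" by (rule assms(1))
  have d0: "is_density M p0" unfolding p0_def by (intro assms(4) assms(2,3))
  have P0: "P0 = density M p0" by (simp add: P0_def law_def p0_def)
  have dpd: "is_density M (pd n)" for n
  proof (cases "n = 0")
    case False
    then have j: "1 \<le> m n" by (intro assms(17)) simp
    have "the_inv_into (Hm (m n)) (T (m n)) (\<gamma>0 (m n)) \<in> Hm (m n)"
      using assms(6)[OF j] assms(9)[OF j] by (intro the_inv_into_into) (auto simp: bij_betw_def)
    then have "is_density M (q (m n) \<theta>0 (\<gamma>0 (m n)))" unfolding q_def by (intro assms(7)[OF j] assms(2))
    then show ?thesis using False by (simp add: pd_def)
  qed (simp add: pd_def d0)
  have Pm: "Pm (m n) = density M (pd n)" if "0 < n" for n
    using that by (simp add: Pm_def law_def pd_def)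
  have evP: "\<forall>\<^sub>F n in sequentially. Pm (m n) = density M (pd n) \<and> sc n = effm (m n)"
    using eventually_gt_at_top[of 0] by eventually_elim (auto simp: Pm sc_def)
  have pr: "prob_space (density M (pd n))" for n by (rule is_densityD[OF dpd])
  note dqm = assms(13)[unfolded diff_quadratic_mean_def law_def, folded p0_def]
  have scoreL: "(\<lambda>x. score x $ a) \<in> L2 P0" for a using dqm unfolding P0 by blast
  have DL: "D b \<in> L2 P0" for b using dqm unfolding P0 by blast
  have AL: "A h \<in> L2 P0" for h using dqm unfolding P0 bounded_linear_L2_def by blast
  have effL: "(\<lambda>x. eff x $ a) \<in> L2 P0" for a by (rule efficient_score_L2[OF assms(14) scoreL])
  have effm0: "(\<lambda>x. eff x $ a * sqrt (p0 x)) \<in> L2 M" and effb: "(\<lambda>x. eff x $ a) \<in> borel_measurable M" for a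
    using effL[of a] L2_density_iff[OF d0] unfolding P0 by auto
  have sym: "transpose J = J" unfolding J_def by (rule second_moment_symmetric)
  have pos: "0 < x \<bullet> (J *v x)" if "x \<noteq> 0" for x
    unfolding J_def by (rule second_moment_positive_definite[OF effL _ that]) (use assms(16) J_def in simp)
  have scL: "(\<lambda>x. sc n x $ a) \<in> L2 (density M (pd n))" for n a
  proof (cases "n = 0")
    case False
    then show ?thesis using parametric_efficient_score_L2[OF assms(20), of n a]
      by (simp add: sc_def pd_def law_def)
  qed (simp add: sc_def)
  have sc0: "(\<integral>x. sc n x $ a \<partial>density M (pd n)) = 0" for n a
  proof (cases "n = 0")
    case False
    then have "prob_space (law M (q (m n)) \<theta>0 (\<gamma>0 (m n)))" using pr[of n] by (simp add: pd_def law_def)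
    from parametric_efficient_score_mean[OF assms(20) this, of a] False
    show ?thesis by (simp add: sc_def pd_def law_def)
  qed (simp add: sc_def)
  have scm0: "(\<lambda>x. sc n x $ a * sqrt (pd n x)) \<in> L2 M" and scb: "(\<lambda>x. sc n x $ a) \<in> borel_measurable M" for n a
    using scL[of n a] L2_density_iff[OF dpd] by auto
  have scv: "sc n \<in> borel_measurable M" for n by (rule borel_measurable_vecI[OF scb])
  have ll: "L2_tendsto M (\<lambda>n y. sc n y $ a * sqrt (pd n y)) (\<lambda>y. eff y $ a * sqrt (p0 y))" for a
  proof (rule L2_tendsto_nnI[OF scm0 effm0])
    show "(\<lambda>n. \<integral>\<^sup>+y. ennreal ((sc n y $ a * sqrt (pd n y) - eff y $ a * sqrt (p0 y))\<^sup>2) \<partial>M) \<longlonglongrightarrow> 0"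
    proof (rule tendsto_sandwich[OF _ _ tendsto_const assms(21)])
      show "\<forall>\<^sub>F n in sequentially. (\<integral>\<^sup>+y. ennreal ((sc n y $ a * sqrt (pd n y) - eff y $ a * sqrt (p0 y))\<^sup>2) \<partial>M)
        \<le> (\<integral>\<^sup>+x. ennreal ((norm (sqrt (q (m n) \<theta>0 (\<gamma>0 (m n)) x) *\<^sub>R effm (m n) x - sqrt (p \<theta>0 \<eta>0 x) *\<^sub>R eff x))\<^sup>2) \<partial>M)"
        using eventually_gt_at_top[of 0]
      proof eventually_elim
        case (elim n)
        show ?case
        proof (rule nn_integral_mono, rule ennreal_leI)
          fix y
          let ?v = "sqrt (q (m n) \<theta>0 (\<gamma>0 (m n)) y) *\<^sub>R effm (m n) y - sqrt (p \<theta>0 \<eta>0 y) *\<^sub>R eff y"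
          have "sc n y $ a * sqrt (pd n y) - eff y $ a * sqrt (p0 y) = ?v $ a"
            using elim by (simp add: sc_def pd_def p0_def mult.commute)
          then show "(sc n y $ a * sqrt (pd n y) - eff y $ a * sqrt (p0 y))\<^sup>2 \<le> (norm ?v)\<^sup>2"
            using component_le_norm_cart[of ?v a] by (metis abs_ge_zero power2_abs power_mono)
        qed
      qed
    qed simp
  qed
  \<comment> \<open>Expressed through root densities, the information matrices are inner products in
    L2 of the dominating measure, so their convergence follows from that of the scores.\<close>
  have Keq: "K n $ a $ b = (\<integral>y. (sc n y $ a * sqrt (pd n y)) * (sc n y $ b * sqrt (pd n y)) \<partial>M)" if "0 < n" for n a b
    using integral_density_mult[OF dpd[of n] scb[of n a] scb[of n b]] that
    by (simp add: K_def Jm_def second_moment_def Pm sc_def)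
  have Kl: "(\<lambda>n. K n $ a $ b) \<longlonglongrightarrow> J $ a $ b" for a b
  proof -
    have "(\<lambda>n. \<integral>y. (sc n y $ a * sqrt (pd n y)) * (sc n y $ b * sqrt (pd n y)) \<partial>M)
      \<longlonglongrightarrow> (\<integral>y. (eff y $ a * sqrt (p0 y)) * (eff y $ b * sqrt (p0 y)) \<partial>M)"
      by (rule L2_tendsto_mult[OF ll ll])
    also have "(\<integral>y. (eff y $ a * sqrt (p0 y)) * (eff y $ b * sqrt (p0 y)) \<partial>M) = J $ a $ b"
      using integral_density_mult[OF d0 effb[of a] effb[of b]] by (simp add: J_def second_moment_def P0)
    finally show ?thesis
      by (rule Lim_transform_eventually) (use eventually_gt_at_top[of 0] in eventually_elim, simp add: Keq)
  qed
  have tight: "\<exists>R. \<forall>\<^sub>F n in sequentially. outer_measure_of (prod_law n (Pm (m n)))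
     {x \<in> space (prod_law n (Pm (m n))). R < norm ((1 / sqrt (real n)) *\<^sub>R (\<Sum>i<n. effm (m n) (x i)))} \<le> e"
    if "0 < e" for e :: ennreal
  proof -
    have v: "(\<lambda>n. \<integral>y. (sc n y $ a)\<^sup>2 \<partial>density M (pd n)) \<longlonglongrightarrow> (\<integral>y. (eff y $ a * sqrt (p0 y))\<^sup>2 \<partial>M)" for a
      using L2_tendsto_square[OF ll[of a]] by (simp add: integral_density_square[OF dpd scb])
    have "\<exists>R. \<forall>\<^sub>F n in sequentially. outer_measure_of (?P n)
       {x \<in> space (?P n). R < norm ((1 / sqrt (real n)) *\<^sub>R (\<Sum>i<n. sc n (x i)))} \<le> e"
      by (rule score_sum_tight[OF pr scL sc0 v that])
    then obtain R where R: "\<forall>\<^sub>F n in sequentially. outer_measure_of (?P n)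
       {x \<in> space (?P n). R < norm ((1 / sqrt (real n)) *\<^sub>R (\<Sum>i<n. sc n (x i)))} \<le> e" ..
    have "\<forall>\<^sub>F n in sequentially. outer_measure_of (prod_law n (Pm (m n)))
     {x \<in> space (prod_law n (Pm (m n))). R < norm ((1 / sqrt (real n)) *\<^sub>R (\<Sum>i<n. effm (m n) (x i)))} \<le> e"
      using R evP by eventually_elim simp
    then show ?thesis by blast
  qed
  \<comment> \<open>Differentiability in direction (h, 0) includes that the shifted parameter
    eventually lies in \<Theta>.\<close>
  have dom: "\<forall>\<^sub>F n in sequentially. h \<in> {h. local_par \<theta>0 n h \<in> \<Theta>}" for h
  proof -
    have "\<forall>\<^sub>F n in sequentially. local_par \<theta>0 n h \<in> \<Theta> \<and> \<eta>n n 0 \<in> H" using dqm by blast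
    then show ?thesis by eventually_elim simp
  qed
  have argmax: "\<forall>\<^sub>F n in sequentially. AE x in prod_law n (Pm (m n)).
     \<bar>profile_log_ratio (q (m n)) (\<Gamma> (m n)) \<theta>0 n x 0\<bar> \<noteq> \<infinity> \<longrightarrow> hh n x \<in> {h. local_par \<theta>0 n h \<in> \<Theta>}
       \<and> (\<forall>z\<in>{h. local_par \<theta>0 n h \<in> \<Theta>}. profile_log_ratio (q (m n)) (\<Gamma> (m n)) \<theta>0 n x z
            \<le> profile_log_ratio (q (m n)) (\<Gamma> (m n)) \<theta>0 n x (hh n x))"
    using assms(26) eventually_gt_at_top[of 0]
  proof eventually_elim
    case (elim n)
    from elim(1) show ?case
    proof eventually_elim
      case (elim x)
      have lp: "local_par \<theta>0 n (hh n x) = est n x" using \<open>0 < n\<close> by (simp add: hh_def local_par_inverse)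
      show ?case
      proof (intro impI conjI ballI)
        show "hh n x \<in> {h. local_par \<theta>0 n h \<in> \<Theta>}" using elim lp by simp
        fix z assume z: "z \<in> {h. local_par \<theta>0 n h \<in> \<Theta>}"
        then have "profile_likelihood (q (m n)) (\<Gamma> (m n)) n x (local_par \<theta>0 n z) \<le> profile_likelihood (q (m n)) (\<Gamma> (m n)) n x (est n x)"
          using elim by simp
        then show "profile_log_ratio (q (m n)) (\<Gamma> (m n)) \<theta>0 n x z \<le> profile_log_ratio (q (m n)) (\<Gamma> (m n)) \<theta>0 n x (hh n x)"
          unfolding profile_log_ratio_def lp by (intro ereal_minus_mono elog_mono) auto
      qed
    qed
  qed

  \<comment> \<open>Expansion of the maximum likelihood estimator\<close>
  have expn: "oP1 (\<lambda>n. prod_law n (Pm (m n))) (\<lambda>n x. profile_log_ratio (q (m n)) (\<Gamma> (m n)) \<theta>0 n x h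
       - ereal (h \<bullet> ((1 / sqrt (real n)) *\<^sub>R (\<Sum>i<n. effm (m n) (x i))) - 1/2 * (h \<bullet> (K n *v h))))" for h
    using assms(23)[of h] by (simp add: K_def)
  have first: "oP1 (\<lambda>n. prod_law n (Pm (m n)))
     (\<lambda>n x. ereal (norm (hh n x - matrix_inv (K n) *v ((1 / sqrt (real n)) *\<^sub>R (\<Sum>i<n. effm (m n) (x i))))))"
    by (rule concave_argmax_expansion[OF sym pos Kl expn tight dom assms(27) argmax])
  have concl1: "oP1 (\<lambda>n. prod_law n (Pm (m n)))
           (\<lambda>n x. ereal (norm (sqrt (real n) *\<^sub>R (est n x - \<theta>0)
              - (1 / sqrt (real n)) *\<^sub>R (\<Sum>i<n. matrix_inv (Jm (m n)) *v effm (m n) (x i)))))"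
    using first unfolding hh_def K_def matrix_vector_mult_scaleR matrix_vector_mult_sum_right .

  \<comment> \<open>The approximating laws as local alternatives\<close>
  obtain g where g: "g \<in> L2 P0" "(\<integral>x. g x \<partial>P0) = 0" "(\<integral>x. g x *\<^sub>R eff x \<partial>P0) = 0"
     and gl: "oP1 (\<lambda>n. prod_law n P0)
             (\<lambda>n x. log_lik_ratio (q (m n) \<theta>0 (\<gamma>0 (m n))) (p \<theta>0 \<eta>0) n x
                - ereal ((1 / sqrt (real n)) * (\<Sum>i<n. g (x i)) - 1/2 * (\<integral>y. (g y)\<^sup>2 \<partial>P0)))"
    using assms(19) by blast
  note gP = g(1,2)[unfolded P0]
  have "\<forall>\<^sub>F n in sequentially. prod_law n P0 = prod_law n (density M p0) \<and> (\<forall>x\<in>space (prod_law n P0).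
      log_lik_ratio (q (m n) \<theta>0 (\<gamma>0 (m n))) (p \<theta>0 \<eta>0) n x
                - ereal ((1 / sqrt (real n)) * (\<Sum>i<n. g (x i)) - 1/2 * (\<integral>y. (g y)\<^sup>2 \<partial>P0))
      = log_lik_ratio (pd n) p0 n x
                - ereal ((1 / sqrt (real n)) * (\<Sum>i<n. g (x i)) - 1/2 * (\<integral>y. (g y)\<^sup>2 \<partial>density M p0)))"
    using eventually_gt_at_top[of 0] by eventually_elim (simp add: P0 pd_def p0_def)
  from oP1_cong[OF gl this]
  have dq: "L2_tendsto M (\<lambda>n x. sqrt (real n) * (sqrt (pd n x) - sqrt (p0 x))) (\<lambda>x. 1/2 * g x * sqrt (p0 x))"
    by (rule loglik_expansion_imp_dqm[OF M d0 dpd gP])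
  \<comment> \<open>The direction taken is that events negligible under the approximating laws are
    negligible under the base law, since the estimator is expanded under the former.\<close>
  have c1: "contiguous (\<lambda>n. prod_law n (density M p0)) (\<lambda>n. ?P n)"
    by (rule local_alternatives_contiguous(2)[OF M d0 gP dpd dq])
  have eg: "(\<integral>y. (u \<bullet> eff y) * g y \<partial>density M p0) = 0" for u
  proof -
    have "integrable P0 (\<lambda>x. g x *\<^sub>R eff x)"
      by (rule integrable_vecI) (use L2_integrable_mult[OF g(1) effL] in simp)
    then have "(\<integral>x. u \<bullet> (g x *\<^sub>R eff x) \<partial>P0) = u \<bullet> (\<integral>x. g x *\<^sub>R eff x \<partial>P0)" by (intro integral_inner_right) auto
    then have "(\<integral>x. u \<bullet> (g x *\<^sub>R eff x) \<partial>P0) = 0" unfolding g(3) by simp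
    then show ?thesis unfolding P0[symmetric] by (simp add: mult.commute)
  qed
  have hm: "hh n \<in> borel_measurable (prod_law n M)" for n
    unfolding hh_def using assms(25)[of n] by measurable
  let ?S = "\<lambda>n x. (1 / sqrt (real n)) *\<^sub>R (\<Sum>i<n. sc n (x i))"
  define Y where "Y n x = norm (hh n x - matrix_inv (K n) *v ?S n x)" for n x
  have Ym: "Y n \<in> borel_measurable (prod_law n M)" for n
  proof -
    have "(\<lambda>x. \<Sum>i<n. sc n (x i)) \<in> borel_measurable (prod_law n M)"
      by (rule borel_measurable_prod_law_sum[OF scv])
    then have "?S n \<in> borel_measurable (prod_law n M)" by measurable
    from measurable_compose[OF this linear_borel_measurable[OF matrix_vector_mul_linear, of "matrix_inv (K n)"]] hm[of n]
    show ?thesis unfolding Y_def by measurable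
  qed
  have sets_prod: "sets (prod_law n (density M f)) = sets (prod_law n M)" and space_prod: "space (prod_law n (density M f)) = space (prod_law n M)" for n f
    by (rule sets_prod_law_cong, simp) (simp add: prod_law_def space_PiM)
  have Ym': "Y n \<in> borel_measurable (prod_law n (density M f))" for n f
    using Ym[of n] by (simp add: measurable_cong_sets[OF sets_prod refl])
  have "oP1 (\<lambda>n. ?P n) (\<lambda>n x. ereal (Y n x))"
    by (rule oP1_cong[OF first]) (use evP in eventually_elim, simp add: Y_def)
  then have Y0: "(\<lambda>n. measure (?P n) {x \<in> space (?P n). e < Y n x}) \<longlonglongrightarrow> 0" if "0 < e" for e
    by (rule oP1_imp_measure[OF _ _ Ym' _ that]) (auto simp: Y_def intro: prob_space_prod_law pr)

  have nl: "prob_space (normal_law (matrix_inv J))" "sets (normal_law (matrix_inv J)) = sets borel"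
    by (rule normal_law_matrix_inv[OF sym pos], assumption)+

  \<comment> \<open>Limit law under an arbitrary local alternative\<close>
  have wc: "weakly_converges
        (\<lambda>n. distr (prod_law n (law M p (local_par \<theta>0 n \<tau>) (\<eta>n n b))) borel
               (\<lambda>x. sqrt (real n) *\<^sub>R (est n x - local_par \<theta>0 n \<tau>))) (normal_law (matrix_inv J))" for \<tau> b
  proof -
    \<comment> \<open>Finitely many indices may place the alternative outside the model, where its
      density is unconstrained; there the base density is substituted, which does not affect
      limits.\<close>
    define good where "good n \<longleftrightarrow> local_par \<theta>0 n \<tau> \<in> \<Theta> \<and> \<eta>n n b \<in> H" for n
    define rd where "rd n = (if good n then p (local_par \<theta>0 n \<tau>) (\<eta>n n b) else p0)" for n
    let ?f = "A (\<tau>, b)"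
    have evg: "\<forall>\<^sub>F n in sequentially. good n" using dqm unfolding good_def by blast
    have drd: "is_density M (rd n)" for n
      using d0 assms(4) by (auto simp: rd_def good_def)
    have fL: "?f \<in> L2 (density M p0)" using AL unfolding P0 .
    have fm: "?f \<in> borel_measurable M" and f0: "(\<lambda>x. ?f x * sqrt (p0 x)) \<in> L2 M"
      using fL L2_density_iff[OF d0] by auto
    have dr: "L2_tendsto M (\<lambda>n y. sqrt (real n) * (sqrt (rd n y) - sqrt (p0 y))) (\<lambda>y. 1/2 * ?f y * sqrt (p0 y))"
    proof (rule L2_tendsto_nnI)
      show "(\<lambda>y. sqrt (real n) * (sqrt (rd n y) - sqrt (p0 y))) \<in> L2 M" for n
        by (intro L2_scale L2_diff is_densityD(4) drd d0)
      show "(\<lambda>y. 1/2 * ?f y * sqrt (p0 y)) \<in> L2 M" using L2_scale[OF f0, of "1/2"] by (simp add: mult.assoc)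
      have "(\<lambda>n. \<integral>\<^sup>+x. ennreal ((sqrt (real n) * (sqrt (p (local_par \<theta>0 n \<tau>) (\<eta>n n b) x) - sqrt (p0 x))
                 - 1/2 * ?f x * sqrt (p0 x))\<^sup>2) \<partial>M) \<longlonglongrightarrow> 0"
        using dqm unfolding p0_def by blast
      then show "(\<lambda>n. \<integral>\<^sup>+x. ennreal ((sqrt (real n) * (sqrt (rd n x) - sqrt (p0 x)) - 1/2 * ?f x * sqrt (p0 x))\<^sup>2) \<partial>M) \<longlonglongrightarrow> 0"
        by (rule Lim_transform_eventually) (use evg in eventually_elim, simp add: rd_def)
    qed
    \<comment> \<open>Centring of the tangent is not part of the definition of differentiability; it
      follows because the densities integrate to 1.\<close>
    have fz: "(\<integral>x. ?f x \<partial>density M p0) = 0" by (rule dqm_mean_zero[OF d0 drd fm dr])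
    have c2: "contiguous (\<lambda>n. prod_law n (density M (rd n))) (\<lambda>n. prod_law n (density M p0))"
      by (rule local_alternatives_contiguous(1)[OF M d0 fL fz drd dr])
    \<comment> \<open>Contiguity is chained through the base law: what is negligible under the
      approximating laws is so under the base law and hence under the alternative. In this way the
      expansion reaches the alternative.\<close>
    have c: "contiguous (\<lambda>n. prod_law n (density M (rd n))) (\<lambda>n. ?P n)"
      by (rule contiguous_trans[OF c2 c1]) (simp add: sets_prod)
    have hl: "(\<lambda>n. measure (prod_law n (density M (rd n))) {x \<in> space (prod_law n (density M (rd n))). e < Y n x}) \<longlonglongrightarrow> 0"
      if e: "0 < e" for e
    proof -
      have "{x \<in> space (?P n). e < Y n x} \<in> sets (?P n)" for n
        using Ym'[of n "pd n"] by measurable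
      from contiguousD[OF c this Y0[OF e]] show ?thesis unfolding space_prod .
    qed
    have fA: "AE x in density M p0. ?f x = \<tau> \<bullet> score x + D b x" using dqm by blast
    have ef: "(\<integral>y. (u \<bullet> eff y) * ?f y \<partial>density M p0) = u \<bullet> (J *v \<tau>)" for u
      unfolding J_def P0
      by (rule efficient_score_inner[OF assms(14)[unfolded P0] scoreL[unfolded P0] DL[unfolded P0] L2_measurable[OF fL] fA])
    have li: "integrable (density M (pd n)) (\<lambda>y. sc n y $ a)" for n a
      by (rule finite_measure.L2_integrable[OF prob_space.finite_measure[OF pr] scL])
    have ch: "(\<lambda>n. \<integral>x. iexp (t \<bullet> (hh n x - \<tau>)) \<partial>prod_law n (density M (rd n)))
       \<longlonglongrightarrow> complex_of_real (exp (- ((t \<bullet> (matrix_inv J *v t)) / 2)))" for t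
      by (rule char_limit_estimator[OF d0 dpd drd dq dr fL gP(1) scv effL[unfolded P0] ll sc0 li pos J_def[unfolded P0] Kl ef eg hm hl[unfolded Y_def]])
    define Q where "Q n = distr (prod_law n (density M (rd n))) borel (\<lambda>x. hh n x - \<tau>)" for n
    have hm': "(\<lambda>x. hh n x - \<tau>) \<in> borel_measurable (prod_law n (density M (rd n)))" for n
      using hm[of n] by (simp add: measurable_cong_sets[OF sets_prod refl])
    interpret cc: char_convergent Q "normal_law (matrix_inv J)"
    proof (rule char_convergent.intro)
      show "prob_space (Q n)" for n
        unfolding Q_def by (rule prob_space.prob_space_distr[OF prob_space_prod_law[OF is_densityD(3)[OF drd]] hm'])
      show "sets (Q n) = sets borel" for n by (simp add: Q_def)
      show "prob_space (normal_law (matrix_inv J))" "sets (normal_law (matrix_inv J)) = sets borel" by (rule nl)+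
      fix t
      have "(\<integral>x. iexp (t \<bullet> x) \<partial>Q n) = (\<integral>x. iexp (t \<bullet> (hh n x - \<tau>)) \<partial>prod_law n (density M (rd n)))" for n
        unfolding Q_def by (rule integral_distr[OF hm']) measurable
      then show "(\<lambda>n. \<integral>x. iexp (t \<bullet> x) \<partial>Q n) \<longlonglongrightarrow> (\<integral>x. iexp (t \<bullet> x) \<partial>normal_law (matrix_inv J))"
        using ch[of t] normal_law_matrix_inv(3)[OF sym pos, of t] by simp
    qed
    show ?thesis
    proof (rule weakly_converges_cong[OF cc.weak_convergence])
      show "\<forall>\<^sub>F n in sequentially. Q n = distr (prod_law n (law M p (local_par \<theta>0 n \<tau>) (\<eta>n n b))) borel
               (\<lambda>x. sqrt (real n) *\<^sub>R (est n x - local_par \<theta>0 n \<tau>))"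
        using evg eventually_gt_at_top[of 0]
      proof eventually_elim
        case (elim n)
        have "hh n x - \<tau> = sqrt (real n) *\<^sub>R (est n x - local_par \<theta>0 n \<tau>)" for x
          using elim(2) by (simp add: hh_def local_par_def algebra_simps)
        then show ?case using elim(1) by (simp add: Q_def rd_def law_def)
      qed
    qed
  qed
  have "best_regular M p \<theta>0 \<eta>n J est"
    unfolding best_regular_def regular_with_limit_def using nl wc by blast
  with concl1 show ?thesis by blast
qed

end
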